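(* Suppose that: (1) $V$ has a global minimum at $0$, $V(0)=0$ and $V(\mathsf{x})\ge 0$ for all $\mathsf{x}\in\mathbb{R}^d$; (2) $L:=\sup\|\nabla^2V\|<\infty$; (3) there exist $K\in(0,\infty)$ and $R\in[0,\infty)$ such that $(\mathsf{x}-\mathsf{y})\cdot(\nabla V(\mathsf{x})-\nabla V(\mathsf{y}))\ge K|\mathsf{x}-\mathsf{y}|^2$ for all $\mathsf{x},\mathsf{y}\in\mathbb{R}^d$ with $|\mathsf{x}-\mathsf{y}|\ge R$; (4) $\tilde L:=\sup\|\nabla^2W\|<\infty$. Put $\tilde R:=8R\sqrt{(L+K)/K}$. Let $T\in(0,\infty)$, $h_1\in[0,\infty)$ and $\epsilon\in[0,\infty)$ satisfy $$L(T+h_1)^2\le\frac35\min\Big(\frac14,\frac{3K}{10L},\frac{3}{256\cdot5L\tilde R^2}\Big),\qquad h_1\le\frac{KT}{525L+235K},$$ $$\epsilon\tilde L<\min\Big(\frac K6,\ \frac12\Big(\frac{K(\tilde R+T)}{36\cdot149}\Big)^2\exp\Big(-5\frac{\tilde R}{T}\Big)\Big).$$ Let $c=\frac1{156}KT^2\exp\big(-\frac{5\tilde R}{4T}\big)$ and $M=\exp\big(\frac54(\frac{\tilde R}{T}+2)\big)$. Then for any $m\in\mathbb{N}$, any probability measures $\nu,\eta$ on $\mathbb{R}^{dn}$, and any $h\in[0,h_1]$ such that $h=0$ or $T/h\in\mathbb{N}$, $$\mathcal{W}_\rho(\nu\pi_h^m,\eta\pi_h^m)\le e^{-cm}\,\mathcal{W}_\rho(\nu,\eta),\qquad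 \mathcal{W}_{\ell^1}(\nu\pi_h^m,\eta\pi_h^m)\le Me^{-cm}\,\mathcal{W}_{\ell^1}(\nu,\eta).$$ Further, there exists a unique invariant probability measure $\mu_h$ on $\mathbb{R}^{dn}$ for the transition kernel $\pi_h$ of unadjusted HMC, and $$\mathcal{W}_{\ell^1}(\nu\pi_h^m,\mu_h)\le Me^{-cm}\,\mathcal{W}_{\ell^1}(\nu,\mu_h).$$ Thus, for any $\tilde\epsilon\in(0,\infty)$ and any initial probability distribution $\nu$, the distance $\Delta(m)=\mathcal{W}_{\ell^1}(\nu\pi_h^m,\mu_h)$ satisfies $\Delta(m)\le\tilde\epsilon$ provided $$m\ge\frac1c\Big(\frac52+\frac{5\tilde R}{4T}+\log\Big(\frac{\Delta(0)}{\tilde\epsilon}\Big)\Big).$$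
   Context: Setting. Let $n,d\ge1$ be integers. Points of $\mathbb{R}^{dn}$ are written $x=(x^1,\dots,x^n)$ with $x^i\in\mathbb{R}^d$; $|\cdot|$ is the Euclidean norm and $\|\cdot\|$ the operator norm. $V,W:\mathbb{R}^d\to\mathbb{R}$ are twice continuously differentiable, $\epsilon\in[0,\infty)$, and $$U(x)=\sum_{i=1}^n\Big(V(x^i)+\frac{\epsilon}{n}\sum_{j\ne i}W(x^i-x^j)\Big),\qquad \int_{\mathbb{R}^{dn}}\exp(-U(x))\,\mathrm{d}x<\infty.$$ $\nabla_iU(x)\in\mathbb{R}^d$ is the gradient of $U$ with respect to $x^i$. Unadjusted HMC. For $h>0$ put $\lfloor t\rfloor_h=\max\{s\in h\mathbb{Z}:s\le t\}$, $\lceil t\rceil_h=\min\{s\in h\mathbb{Z}:s\ge t\}$. The flow $(q_t(x,v),p_t(x,v))$ is the solution of $$\frac{\mathrm{d}}{\mathrm{d}t}q^i_t=p^i_{\lfloor t\rfloor_h}-\frac h2\nabla_iU(q_{\lfloor t\rfloor_h}),\qquad\frac{\mathrm{d}}{\mathrm{d}t}p^i_t=-\frac12\big(\nabla_iU(q_{\lfloor t\rfloor_h})+\nabla_iU(q_{\lceil t\rceil_h})\big),\quad i=1,\dots,n,$$ with $(q_0,p_0)=(x,v)$ (velocity Verlet). For $h=0$, it is the exact Hamiltonian flow $\frac{\mathrm{d}}{\mathrm{d}t}q^i_t=p^i_t$, $\frac{\mathrm{d}}{\mathrm{d}t}p^i_t=-\nabla_iU(q_t)$. The transition kernel on $\mathbb{R}^{dn}$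 is $\pi_h(x,B)=P[q_T(x,\xi)\in B]$ with $\xi\sim\mathcal{N}(0,I_{dn})$. Distances. With $R_1:=\frac54(\tilde R+2T)$ and $f(r):=\int_0^r\exp(-\min(R_1,s)/T)\,\mathrm{d}s$, set $\rho(x,y):=\sum_{i=1}^nf(|x^i-y^i|)$ and $\ell^1(x,y):=\sum_{i=1}^n|x^i-y^i|$. For a metric $\delta$ on $\mathbb{R}^{dn}$ and probability measures $\nu,\eta$, $\mathcal{W}_\delta(\nu,\eta)=\inf_{\omega\in\Gamma(\nu,\eta)}\int\delta(x,y)\,\omega(\mathrm{d}x\,\mathrm{d}y)$, where $\Gamma(\nu,\eta)$ is the set of couplings of $\nu$ and $\eta$. When $R=0$ (so $\tilde R=0$) the convention $1/0=+\infty$ is used. *)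

theory Defs
  imports "HOL-Probability.Probability"
begin

section \<open>Gradients, Hessians and the mean-field potential\<close>

definition grad :: "('a::real_inner \<Rightarrow> real) \<Rightarrow> 'a \<Rightarrow> 'a" where
  "grad f x = (THE g. GDERIV f x :> g)"

definition hessian :: "(real^'d \<Rightarrow> real) \<Rightarrow> real^'d \<Rightarrow> real^'d^'d" where
  "hessian f x = jacobian (grad f) (at x)"

definition hess_norm :: "(real^'d \<Rightarrow> real) \<Rightarrow> real^'d \<Rightarrow> real" where
  "hess_norm f x = onorm ((*v) (hessian f x))"

definition twice_cont_differentiable :: "(real^'d \<Rightarrow> real) \<Rightarrow> bool" where
  "twice_cont_differentiable f \<longleftrightarrow>
     (\<forall>x. f differentiable (at x)) \<and> (\<forall>x. grad f differentiable (at x)) \<and>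
     continuous_on UNIV (hessian f)"

text \<open>A point of \<open>\<real>\<^sup>d\<^sup>n\<close> is an element of \<^typ>\<open>real^'d^'n\<close>, whose library norm is the Euclidean one;
  the block \<open>x $ i\<close> is the position of the \<open>i\<close>-th particle.\<close>

definition mf_potential ::
    "(real^'d \<Rightarrow> real) \<Rightarrow> (real^'d \<Rightarrow> real) \<Rightarrow> real \<Rightarrow> real^'d^'n \<Rightarrow> real" where
  "mf_potential V W \<epsilon> x =
     (\<Sum>i\<in>UNIV. V (x $ i) + \<epsilon> / real CARD('n) * (\<Sum>j\<in>UNIV - {i}. W (x $ i - x $ j)))"

definition block_grad :: "(real^'d^'n \<Rightarrow> real) \<Rightarrow> 'n \<Rightarrow> real^'d^'n \<Rightarrow> real^'d" where
  "block_grad U i x = grad (\<lambda>y. U (\<chi> j. if j = i then y else x $ j)) (x $ i)"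

section \<open>Unadjusted Hamiltonian Monte Carlo\<close>

definition time_grid :: "real \<Rightarrow> real set" where
  "time_grid h = range (\<lambda>k::int. h * of_int k)"

definition grid_floor :: "real \<Rightarrow> real \<Rightarrow> real" where
  "grid_floor h t = (GREATEST s. s \<in> time_grid h \<and> s \<le> t)"

definition grid_ceiling :: "real \<Rightarrow> real \<Rightarrow> real" where
  "grid_ceiling h t = (LEAST s. s \<in> time_grid h \<and> t \<le> s)"

lemma grid_floor_eq: "h > 0 \<Longrightarrow> grid_floor h t = h * of_int \<lfloor>t / h\<rfloor>"
  unfolding grid_floor_def time_grid_def
  by (rule Greatest_equality) (use floor_divide_lower[of h t] in \<open>auto simp: field_simps le_floor_iff\<close>)

lemma grid_ceiling_eq: "h > 0 \<Longrightarrow> grid_ceiling h t = h * of_int \<lceil>t / h\<rceil>"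
  unfolding grid_ceiling_def time_grid_def
  by (rule Least_equality) (use ceiling_divide_upper[of h t] in \<open>auto simp: field_simps ceiling_le_iff\<close>)

text \<open>For \<open>h > 0\<close> the right-hand sides are piecewise constant in time, with jumps on the grid. A
  solution is therefore a continuous curve satisfying the equations at all times off the grid.\<close>

definition hmc_solution ::
    "(real^'d^'n \<Rightarrow> real) \<Rightarrow> real \<Rightarrow> real^'d^'n \<Rightarrow> real^'d^'n \<Rightarrow>
     (real \<Rightarrow> real^'d^'n) \<Rightarrow> (real \<Rightarrow> real^'d^'n) \<Rightarrow> bool" where
  "hmc_solution U h x v q p \<longleftrightarrow>
     q 0 = x \<and> p 0 = v \<and> continuous_on {0..} q \<and> continuous_on {0..} p \<and>
     (if h = 0 then
        \<forall>t\<ge>0. \<forall>i.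
          ((\<lambda>s. q s $ i) has_vector_derivative p t $ i) (at t within {0..}) \<and>
          ((\<lambda>s. p s $ i) has_vector_derivative - block_grad U i (q t)) (at t within {0..})
      else
        \<forall>t\<in>{0..} - time_grid h. \<forall>i.
          ((\<lambda>s. q s $ i) has_vector_derivative
             p (grid_floor h t) $ i - (h / 2) *\<^sub>R block_grad U i (q (grid_floor h t)))
             (at t within {0..}) \<and>
          ((\<lambda>s. p s $ i) has_vector_derivative
             - (1 / 2) *\<^sub>R (block_grad U i (q (grid_floor h t)) + block_grad U i (q (grid_ceiling h t))))
             (at t within {0..}))"

definition hmc_flow ::
    "(real^'d^'n \<Rightarrow> real) \<Rightarrow> real \<Rightarrow> real \<Rightarrow> real^'d^'n \<Rightarrow> real^'d^'n \<Rightarrow>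
     (real^'d^'n) \<times> (real^'d^'n)" where
  "hmc_flow U h t x v = (THE z. \<exists>q p. hmc_solution U h x v q p \<and> z = (q t, p t))"

definition std_gaussian :: "'a::euclidean_space measure" where
  "std_gaussian = density lborel (\<lambda>v. ennreal (\<Prod>b\<in>Basis. std_normal_density (v \<bullet> b)))"

definition hmc_kernel ::
    "(real^'d^'n \<Rightarrow> real) \<Rightarrow> real \<Rightarrow> real \<Rightarrow> real^'d^'n \<Rightarrow> (real^'d^'n) measure" where
  "hmc_kernel U T h x = distr std_gaussian borel (\<lambda>\<xi>. fst (hmc_flow U h T x \<xi>))"

definition kernel_iterate :: "'a measure \<Rightarrow> ('a \<Rightarrow> 'a measure) \<Rightarrow> nat \<Rightarrow> 'a measure" where
  "kernel_iterate \<nu> \<pi> m = ((\<lambda>\<mu>. \<mu> \<bind> \<pi>) ^^ m) \<nu>"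

definition invariant_prob :: "('a::topological_space \<Rightarrow> 'a measure) \<Rightarrow> 'a measure \<Rightarrow> bool" where
  "invariant_prob \<pi> \<mu> \<longleftrightarrow> \<mu> \<in> space (prob_algebra borel) \<and> \<mu> \<bind> \<pi> = \<mu>"

section \<open>Distances\<close>

definition couplings :: "'a measure \<Rightarrow> 'a measure \<Rightarrow> ('a \<times> 'a) measure set" where
  "couplings \<nu> \<eta> = {\<omega> \<in> space (prob_algebra (\<nu> \<Otimes>\<^sub>M \<eta>)). distr \<omega> \<nu> fst = \<nu> \<and> distr \<omega> \<eta> snd = \<eta>}"

definition wasserstein :: "('a \<Rightarrow> 'a \<Rightarrow> real) \<Rightarrow> 'a measure \<Rightarrow> 'a measure \<Rightarrow> ennreal" where
  "wasserstein \<delta> \<nu> \<eta> = (INF \<omega>\<in>couplings \<nu> \<eta>. \<integral>\<^sup>+ (x, y). ennreal (\<delta> x y) \<partial>\<omega>)"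

definition dist_profile :: "real \<Rightarrow> real \<Rightarrow> real \<Rightarrow> real" where
  "dist_profile R\<^sub>1 T r = integral {0..r} (\<lambda>s. exp (- (min R\<^sub>1 s / T)))"

definition rho :: "real \<Rightarrow> real \<Rightarrow> real^'d^'n \<Rightarrow> real^'d^'n \<Rightarrow> real" where
  "rho R\<^sub>1 T x y = (\<Sum>i\<in>UNIV. dist_profile R\<^sub>1 T (norm (x $ i - y $ i)))"

definition ell1 :: "real^'d^'n \<Rightarrow> real^'d^'n \<Rightarrow> real" where
  "ell1 x y = (\<Sum>i\<in>UNIV. norm (x $ i - y $ i))"

text \<open>Wasserstein distances may be \<open>0\<close> or \<open>\<infinity>\<close>, so the logarithm takes the values \<open>-\<infinity>\<close>
  and \<open>\<infinity>\<close> there (\<^term>\<open>ln 0 = (0::real)\<close> would be wrong).\<close>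

definition ln_ext :: "ennreal \<Rightarrow> ereal" where
  "ln_ext a = (if a = 0 then -\<infinity> else if a = \<infinity> then \<infinity> else ereal (ln (enn2real a)))"

end

theory Submission
  imports Defs
begin

text \<open>Two copies of the chain, started in \<open>x\<close> and \<open>y\<close>, are coupled particle by particle. If the \<open>i\<close>-th
  particles are at a distance of at least \<open>R'\<close>, they receive the same initial velocity: the confining
  force is uniformly dissipative there, and the dynamics up to time \<open>T\<close> shrinks the distance \<open>r\<close> by the factor
  \<open>1 - K T\<^sup>2 / 4\<close>. At smaller distances the forces may push the particles apart. Since \<open>L T\<^sup>2\<close> is
  small, the motion up to time \<open>T\<close> is close to free motion, and the velocities are coupled such that
  their difference is \<open>-\<gamma>\<close> times the difference of the positions with as high a probability as possible,
  so that the particles approach each other; otherwise one velocity is the reflection of the other. A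
  reflection can increase the distance, but its probability is of order \<open>\<gamma> r\<close>, and in the concave profile
  \<open>f\<close> that defines \<open>\<rho>\<close> every such excursion costs only about \<open>T f'(r)\<close>, against the gain
  \<open>\<gamma> T r f'(r)\<close> of the shift. Hence \<open>f(r)\<close> contracts in expectation in both regimes, by the factor
  \<open>1 - 2 c\<close> (\<open>particle_expectation\<close>).

  The interaction enters through \<open>\<epsilon>\<close>. It changes the distance of two particles by an amount of order
  \<open>\<epsilon> L' T\<^sup>2\<close> times the mean distance of all particles; summed over the particles, this is a small multiple
  of \<open>\<ell>\<^sup>1\<close>, hence of \<open>exp (R\<^sub>1 / T) \<rho>\<close>, and uses up at most the contraction by \<open>c\<close>. This leaves
  \<open>1 - c \<le> exp (- c)\<close> for one step (\<open>one_step_contraction\<close>). The dependence of the trajectories on their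
  initial values is estimated for the Verlet scheme, uniformly in the step size
  (\<open>verlet_free_motion\<close>, \<open>verlet_contraction\<close>), and passes to the exact flow, which is the limit of the
  scheme.

  A contraction of the expected distance by a coupling of the noises yields a contraction of the Wasserstein
  distance: gluing the coupled steps to a coupling of two initial distributions couples their images.
  The estimate for \<open>\<ell>\<^sup>1\<close> follows from \<open>exp (- R\<^sub>1 / T) \<ell>\<^sup>1 \<le> \<rho> \<le> \<ell>\<^sup>1\<close>. Uniqueness of the invariant
  measure holds because the truncated distances \<open>min 1 (a \<rho>)\<close> contract as well. For its existence the
  chain is run backwards: the chains of length \<open>j\<close> and \<open>j + 1\<close> started in \<open>0\<close> are realised on
  one probability space such that their expected distances form a geometric series. They converge almost
  surely, and the law of the limit is invariant.\<close>

section \<open>The velocity Verlet scheme\<close>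

definition verlet_step :: "('a::real_vector \<Rightarrow> 'a) \<Rightarrow> real \<Rightarrow> 'a \<times> 'a \<Rightarrow> 'a \<times> 'a" where
  "verlet_step b h = (\<lambda>(q, p). let q' = q + h *\<^sub>R p - (h\<^sup>2 / 2) *\<^sub>R b q
     in (q', p - (h / 2) *\<^sub>R (b q + b q')))"

abbreviation verlet :: "('a::real_vector \<Rightarrow> 'a) \<Rightarrow> real \<Rightarrow> nat \<Rightarrow> 'a \<times> 'a \<Rightarrow> 'a \<times> 'a" where
  "verlet b h k \<equiv> verlet_step b h ^^ k"

text \<open>The coefficient of the \<open>j\<close>-th force in the \<open>k\<close>-th position. The first force has half the weight, because
  a velocity step averages the forces at both of its ends.\<close>

definition verlet_weight :: "real \<Rightarrow> nat \<Rightarrow> nat \<Rightarrow> real" where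
  "verlet_weight h k j = h\<^sup>2 * ((real k - real j) - (if j = 0 then real k / 2 else 0))"

lemma fst_verlet_Suc:
  "fst (verlet b h (Suc k) z) = fst (verlet b h k z) + h *\<^sub>R snd (verlet b h k z)
     - (h\<^sup>2 / 2) *\<^sub>R b (fst (verlet b h k z))"
  by (simp add: verlet_step_def Let_def split: prod.splits)

lemma snd_verlet_Suc:
  "snd (verlet b h (Suc k) z) = snd (verlet b h k z)
     - (h / 2) *\<^sub>R (b (fst (verlet b h k z)) + b (fst (verlet b h (Suc k) z)))"
  by (simp add: verlet_step_def Let_def split: prod.splits)

lemma verlet_weight_nonneg: "j < k \<Longrightarrow> 0 \<le> verlet_weight h k j"
  by (simp add: verlet_weight_def)

lemma verlet_weight_Suc:
  "verlet_weight h (Suc k) j = verlet_weight h k j + h\<^sup>2 * (1 - (if j = 0 then 1 / 2 else 0))"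
  by (simp add: verlet_weight_def algebra_simps)

lemma verlet_weight_self: "verlet_weight h k k = 0"
  by (simp add: verlet_weight_def)

lemma sum_verlet_weight: "(\<Sum>j<k. verlet_weight h k j) = (h * real k)\<^sup>2 / 2"
proof (induction k)
  case (Suc k)
  have "(\<Sum>j<Suc k. verlet_weight h (Suc k) j)
      = (\<Sum>j<Suc k. verlet_weight h k j) + (\<Sum>j<Suc k. h\<^sup>2 * (1 - (if j = 0 then 1 / 2 else 0)))"
    by (simp only: verlet_weight_Suc sum.distrib)
  also have "(\<Sum>j<Suc k. verlet_weight h k j) = (h * real k)\<^sup>2 / 2"
    using Suc by (simp add: verlet_weight_self)
  also have "(\<Sum>j<Suc k. h\<^sup>2 * (1 - (if j = 0 then 1 / 2 else 0))) = h\<^sup>2 * (real k + 1 / 2)"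
    by (simp add: sum_distrib_left[symmetric] sum_subtractf sum.delta)
  finally show ?case by (simp add: power2_eq_square field_simps)
qed simp

lemma verlet_velocity:
  "snd (verlet b h k (x, v)) = v - h *\<^sub>R (\<Sum>j<k. b (fst (verlet b h j (x, v))))
     + (h / 2) *\<^sub>R (b x - b (fst (verlet b h k (x, v))))"
proof (induction k)
  case (Suc k)
  show ?case
    unfolding snd_verlet_Suc Suc.IH
    by (simp add: algebra_simps scaleR_diff_right scaleR_add_right flip: scaleR_add_left)
qed simp

text \<open>Eliminating the velocities turns the scheme into a quadrature of
  \<open>q\<^sub>t = x + t v - \<integral>\<^sub>0\<^sup>t (t - s) b(q\<^sub>s) ds\<close>: the weights are nonnegative and their sum is the exact
  value \<open>t\<^sup>2 / 2\<close>. This is what makes all estimates uniform in the step size.\<close>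

lemma verlet_position:
  "fst (verlet b h k (x, v)) = x + (h * real k) *\<^sub>R v
     - (\<Sum>j<k. verlet_weight h k j *\<^sub>R b (fst (verlet b h j (x, v))))"
proof (induction k)
  case (Suc k)
  define B where "B j = b (fst (verlet b h j (x, v)))" for j
  have "(\<Sum>j<Suc k. verlet_weight h (Suc k) j *\<^sub>R B j)
      = (\<Sum>j<Suc k. verlet_weight h k j *\<^sub>R B j)
        + (\<Sum>j<Suc k. h\<^sup>2 *\<^sub>R B j - (if j = 0 then (h\<^sup>2 / 2) *\<^sub>R B j else 0))"
    unfolding sum.distrib[symmetric]
    by (rule sum.cong) (auto simp: verlet_weight_Suc algebra_simps scaleR_add_left)
  also have "(\<Sum>j<Suc k. verlet_weight h k j *\<^sub>R B j) = (\<Sum>j<k. verlet_weight h k j *\<^sub>R B j)"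
    by (simp add: verlet_weight_self)
  also have "(\<Sum>j<Suc k. h\<^sup>2 *\<^sub>R B j - (if j = 0 then (h\<^sup>2 / 2) *\<^sub>R B j else 0))
      = h\<^sup>2 *\<^sub>R (\<Sum>j<k. B j) + h\<^sup>2 *\<^sub>R B k - (h\<^sup>2 / 2) *\<^sub>R B 0"
    by (simp add: sum_subtractf sum.delta scaleR_sum_right[symmetric] scaleR_add_right
        del: sum.lessThan_Suc) (simp add: scaleR_add_right)
  finally have weights: "(\<Sum>j<Suc k. verlet_weight h (Suc k) j *\<^sub>R B j)
      = (\<Sum>j<k. verlet_weight h k j *\<^sub>R B j) + (h\<^sup>2 *\<^sub>R (\<Sum>j<k. B j) + h\<^sup>2 *\<^sub>R B k - (h\<^sup>2 / 2) *\<^sub>R B 0)" .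
  have half: "h\<^sup>2 *\<^sub>R B k = (h\<^sup>2 / 2) *\<^sub>R B k + (h\<^sup>2 / 2) *\<^sub>R B k"
    by (simp flip: scaleR_add_left)
  have step: "fst (verlet b h (Suc k) (x, v))
      = fst (verlet b h k (x, v)) + h *\<^sub>R snd (verlet b h k (x, v)) - (h\<^sup>2 / 2) *\<^sub>R B k"
    by (simp only: fst_verlet_Suc B_def)
  have velocity: "snd (verlet b h k (x, v)) = v - h *\<^sub>R (\<Sum>j<k. B j) + (h / 2) *\<^sub>R (B 0 - B k)"
    by (simp add: verlet_velocity B_def)
  have position: "fst (verlet b h k (x, v)) = x + (h * real k) *\<^sub>R v - (\<Sum>j<k. verlet_weight h k j *\<^sub>R B j)"
    unfolding B_def by (rule Suc.IH)
  have "fst (verlet b h (Suc k) (x, v))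
      = x + (h * real (Suc k)) *\<^sub>R v - (\<Sum>j<Suc k. verlet_weight h (Suc k) j *\<^sub>R B j)"
    unfolding step velocity position weights
    using half by (simp add: algebra_simps scaleR_diff_right scaleR_add_right power2_eq_square)
  then show ?case by (simp only: B_def)
qed simp

section \<open>Estimates for the distance of two trajectories\<close>

text \<open>The differences \<open>z i k\<close> of the positions of the \<open>i\<close>-th particles of two trajectories satisfy a
  linear integral inequality, in which the particles interact only through the mean of all distances.
  Summing over the particles closes the inequality for that mean, and the resulting bound is fed back
  into the inequality for a single particle. The quantity \<open>a i\<close> is the largest distance that the
  particles reach in free motion.\<close>

lemma particle_estimates:
  fixes z F :: "'n::finite \<Rightarrow> nat \<Rightarrow> 'a::real_normed_vector" and w :: "'n \<Rightarrow> 'a"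
    and \<omega> :: "nat \<Rightarrow> nat \<Rightarrow> real" and a :: "'n \<Rightarrow> real" and h \<beta> l T X :: real and N :: nat
  assumes rep: "\<And>i k. k \<le> N \<Longrightarrow> z i k = z i 0 + (h * real k) *\<^sub>R w i - (\<Sum>j<k. \<omega> k j *\<^sub>R F i j)"
    and \<omega>_nonneg: "\<And>k j. j < k \<Longrightarrow> 0 \<le> \<omega> k j" and \<omega>_sum: "\<And>k. (\<Sum>j<k. \<omega> k j) = (h * real k)\<^sup>2 / 2"
    and F: "\<And>i k. k \<le> N \<Longrightarrow> norm (F i k) \<le> \<beta> * norm (z i k) + 2 * l / real CARD('n) * (\<Sum>j\<in>UNIV. norm (z j k))"
    and nonneg: "0 \<le> h" "0 \<le> \<beta>" "0 \<le> l" and T: "T = h * real N"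
    and small: "(\<beta> + 2 * l) * T\<^sup>2 \<le> 1 / 4"
    and a_eq: "a = (\<lambda>i. max (norm (z i 0)) (norm (z i 0 + T *\<^sub>R w i)))"
    and X_eq: "X = 8 / 7 * (l * T\<^sup>2 / real CARD('n)) * (\<Sum>i\<in>UNIV. a i)"
  shows "\<forall>k\<le>N. norm (z i k - z i 0 - (h * real k) *\<^sub>R w i) \<le> 4 / 7 * \<beta> * T\<^sup>2 * a i + 8 / 7 * X"
    and "\<forall>k\<le>N. norm (z i k) \<le> 8 / 7 * (a i + X)"
    and "\<forall>k\<le>N. l * T\<^sup>2 / real CARD('n) * (\<Sum>j\<in>UNIV. norm (z j k)) \<le> X"
proof -
  define n where "n = real CARD('n)"
  have n: "n > 0" by (simp add: n_def)
  define m where "m i = Max ((\<lambda>k. norm (z i k)) ` {..N})" for i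
  have m: "norm (z i k) \<le> m i" if "k \<le> N" for i k
    unfolding m_def using that by (intro Max_ge) auto
  have m_in: "\<exists>k\<le>N. m i = norm (z i k)" for i
  proof -
    have "m i \<in> (\<lambda>k. norm (z i k)) ` {..N}" unfolding m_def by (intro Max_in) auto
    then show ?thesis by auto
  qed
  have m0: "0 \<le> m i" for i using m[of 0 i] norm_ge_zero[of "z i 0"] by linarith
  \<comment> \<open>the mean-field term, with every distance replaced by its maximum over time\<close>
  define Y where "Y = 2 * l / n * (\<Sum>i\<in>UNIV. m i)"
  have Y0: "0 \<le> Y" unfolding Y_def using n nonneg m0 by (simp add: sum_nonneg)
  have Fm: "norm (F i k) \<le> \<beta> * m i + Y" if "k \<le> N" for i k
  proof -
    have "norm (F i k) \<le> \<beta> * norm (z i k) + 2 * l / n * (\<Sum>j\<in>UNIV. norm (z j k))"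
      using F[OF that] by (simp add: n_def)
    also have "\<dots> \<le> \<beta> * m i + Y" unfolding Y_def
      using nonneg n m[OF that] by (intro add_mono mult_left_mono sum_mono) auto
    finally show ?thesis .
  qed
  have drift: "norm (z i k - z i 0 - (h * real k) *\<^sub>R w i) \<le> T\<^sup>2 / 2 * (\<beta> * m i + Y)" if "k \<le> N" for i k
  proof -
    have "norm (z i k - z i 0 - (h * real k) *\<^sub>R w i) = norm (\<Sum>j<k. \<omega> k j *\<^sub>R F i j)"
      using rep[OF that] by (metis add_diff_cancel_left' diff_diff_add minus_diff_eq norm_minus_cancel diff_add_cancel uminus_add_conv_diff add.commute)
    also have "\<dots> \<le> (\<Sum>j<k. \<omega> k j * (\<beta> * m i + Y))"
      using that \<omega>_nonneg Fm by (intro sum_norm_le) (auto intro!: mult_left_mono)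
    also have "\<dots> = (h * real k)\<^sup>2 / 2 * (\<beta> * m i + Y)"
      by (simp add: sum_distrib_right[symmetric] \<omega>_sum)
    also have "\<dots> \<le> T\<^sup>2 / 2 * (\<beta> * m i + Y)"
      using that nonneg m0 Y0 by (intro mult_right_mono divide_right_mono power_mono)
        (auto simp: T intro!: mult_left_mono)
    finally show ?thesis .
  qed
  have a0: "0 \<le> a i" for i by (simp add: a_eq le_max_iff_disj)
  have free: "norm (z i 0 + (h * real k) *\<^sub>R w i) \<le> a i" if "k \<le> N" for i k
  proof (cases "N = 0")
    case True then show ?thesis using that by (simp add: a_eq)
  next
    case False
    define s where "s = real k / real N"
    have s: "0 \<le> s" "s \<le> 1" using that by (auto simp: s_def divide_le_eq_1)
    have "z i 0 + (h * real k) *\<^sub>R w i = (1 - s) *\<^sub>R z i 0 + s *\<^sub>R (z i 0 + T *\<^sub>R w i)"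
      using False by (simp add: s_def T algebra_simps)
    also have "norm \<dots> \<le> (1 - s) * norm (z i 0) + s * norm (z i 0 + T *\<^sub>R w i)"
      using s by (intro order_trans[OF norm_triangle_ineq]) auto
    also have "\<dots> \<le> (1 - s) * a i + s * a i"
      using s by (intro add_mono mult_left_mono) (auto simp: a_eq)
    finally show ?thesis by (simp add: algebra_simps)
  qed
  have m1: "m i \<le> a i + T\<^sup>2 / 2 * (\<beta> * m i + Y)" for i
  proof -
    obtain k where k: "k \<le> N" "m i = norm (z i k)" using m_in by blast
    have "norm (z i k) \<le> norm (z i 0 + (h * real k) *\<^sub>R w i) + norm (z i k - z i 0 - (h * real k) *\<^sub>R w i)"
      by (metis add.commute diff_diff_add norm_triangle_sub)
    then show ?thesis using free[OF k(1), of i] drift[OF k(1), of i] k(2) by linarith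
  qed
  define S where "S = (\<Sum>i\<in>UNIV. m i)"
  have S0: "0 \<le> S" using m0 by (simp add: S_def sum_nonneg)
  have nY: "n * Y = 2 * l * S" using n by (simp add: Y_def S_def)
  have "S \<le> (\<Sum>i\<in>UNIV. a i + T\<^sup>2 / 2 * (\<beta> * m i + Y))" unfolding S_def by (rule sum_mono) (rule m1)
  also have "\<dots> = (\<Sum>i\<in>UNIV. a i) + T\<^sup>2 / 2 * (\<beta> * S + n * Y)"
    by (simp only: sum.distrib sum_distrib_left[symmetric] S_def n_def sum_constant of_nat_mult)
  also have "\<dots> = (\<Sum>i\<in>UNIV. a i) + (\<beta> + 2 * l) * T\<^sup>2 / 2 * S" unfolding nY by (simp add: algebra_simps)
  also have "\<dots> \<le> (\<Sum>i\<in>UNIV. a i) + 1 / 8 * S"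
  proof -
    have "(\<beta> + 2 * l) * T\<^sup>2 / 2 \<le> 1 / 8" using small by linarith
    then show ?thesis using S0 by (intro add_left_mono mult_right_mono)
  qed
  finally have S: "S \<le> 8 / 7 * (\<Sum>i\<in>UNIV. a i)" by simp
  have XY: "T\<^sup>2 / 2 * Y \<le> X"
  proof -
    have "T\<^sup>2 / 2 * Y = l * T\<^sup>2 / n * S" by (simp add: Y_def S_def)
    also have "\<dots> \<le> l * T\<^sup>2 / n * (8 / 7 * (\<Sum>i\<in>UNIV. a i))"
      using S n nonneg by (intro mult_left_mono) auto
    finally show ?thesis by (simp add: X_eq n_def)
  qed
  have \<beta>T: "\<beta> * T\<^sup>2 \<le> 1 / 4" using small nonneg by (smt (verit) mult_right_mono zero_le_power2)
  have mi: "m i \<le> 8 / 7 * (a i + X)" for i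
  proof -
    have "T\<^sup>2 / 2 * (\<beta> * m i) = (\<beta> * T\<^sup>2) / 2 * m i" by simp
    also have "\<dots> \<le> 1 / 8 * m i" using \<beta>T m0 by (intro mult_right_mono) auto
    finally have "T\<^sup>2 / 2 * (\<beta> * m i) \<le> 1 / 8 * m i" .
    moreover have "m i \<le> a i + (T\<^sup>2 / 2 * (\<beta> * m i) + T\<^sup>2 / 2 * Y)" using m1[of i] by (simp only: distrib_left)
    moreover have "v \<le> 8 / 7 * (s + X)" if "p \<le> 1 / 8 * v" "v \<le> s + (p + t)" "t \<le> X" for p v s t :: real
    proof -
      have "7 * v \<le> 8 * (s + X)" using that by simp
      then show ?thesis by simp
    qed
    ultimately show ?thesis using XY by blast
  qed
  show "\<forall>k\<le>N. norm (z i k - z i 0 - (h * real k) *\<^sub>R w i) \<le> 4 / 7 * \<beta> * T\<^sup>2 * a i + 8 / 7 * X"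
  proof (intro allI impI)
    fix k assume k: "k \<le> N"
    have X0: "0 \<le> X" using XY Y0 by (smt (verit) divide_nonneg_nonneg mult_nonneg_nonneg zero_le_power2)
    have "norm (z i k - z i 0 - (h * real k) *\<^sub>R w i) \<le> (\<beta> * T\<^sup>2) / 2 * m i + T\<^sup>2 / 2 * Y"
      using drift[OF k, of i] by (simp add: algebra_simps)
    also have "\<dots> \<le> (\<beta> * T\<^sup>2) / 2 * (8 / 7 * (a i + X)) + X"
      using mi[of i] XY nonneg by (intro add_mono mult_left_mono) auto
    also have "\<dots> = 4 / 7 * \<beta> * T\<^sup>2 * a i + (4 / 7 * (\<beta> * T\<^sup>2) + 1) * X" by (simp add: algebra_simps)
    also have "\<dots> \<le> 4 / 7 * \<beta> * T\<^sup>2 * a i + 8 / 7 * X"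
      using \<beta>T X0 by (intro add_left_mono mult_right_mono) auto
    finally show "norm (z i k - z i 0 - (h * real k) *\<^sub>R w i) \<le> 4 / 7 * \<beta> * T\<^sup>2 * a i + 8 / 7 * X" .
  qed
  show "\<forall>k\<le>N. norm (z i k) \<le> 8 / 7 * (a i + X)" using m mi by (meson order_trans)
  show "\<forall>k\<le>N. l * T\<^sup>2 / real CARD('n) * (\<Sum>j\<in>UNIV. norm (z j k)) \<le> X"
  proof (intro allI impI)
    fix k assume k: "k \<le> N"
    have "l * T\<^sup>2 / n * (\<Sum>j\<in>UNIV. norm (z j k)) \<le> l * T\<^sup>2 / n * S"
      unfolding S_def using m[OF k] n nonneg by (intro mult_left_mono sum_mono) auto
    also have "\<dots> = T\<^sup>2 / 2 * Y" by (simp add: Y_def S_def)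
    also have "\<dots> \<le> X" by (rule XY)
    finally show "l * T\<^sup>2 / real CARD('n) * (\<Sum>j\<in>UNIV. norm (z j k)) \<le> X" by (simp add: n_def)
  qed
qed

text \<open>A particle whose force is dissipative contracts on its own: to leading order
  \<open>|p|\<^sup>2 = r\<^sup>2 - T\<^sup>2 z \<bullet> bV\<close>, and the two corrections, the drift of \<open>z\<close> along the trajectory and the
  square of the accumulated force, are of order \<open>L\<^sup>2 T\<^sup>4 r\<^sup>2\<close>, which is a small multiple of
  \<open>K T\<^sup>2 r\<^sup>2\<close>. Terms with \<open>X\<close> carry the influence of the other particles.\<close>

lemma dissipative_particle:
  fixes z bV :: "nat \<Rightarrow> 'a::real_inner" and \<omega> :: "nat \<Rightarrow> real" and \<beta> K L T X r :: real and N :: nat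
  assumes \<omega>_nonneg: "\<And>j. j < N \<Longrightarrow> 0 \<le> \<omega> j" and \<omega>_sum: "(\<Sum>j<N. \<omega> j) = T\<^sup>2 / 2"
    and r: "r = norm (z 0)"
    and drift: "\<And>j. j < N \<Longrightarrow> norm (z j - z 0) \<le> 4 / 7 * \<beta> * T\<^sup>2 * r + 8 / 7 * X"
    and size: "\<And>j. j < N \<Longrightarrow> norm (z j) \<le> 8 / 7 * (r + X)"
    and lip: "\<And>j. j < N \<Longrightarrow> norm (bV j) \<le> L * norm (z j)"
    and diss: "\<And>j. j < N \<Longrightarrow> K * (norm (z j))\<^sup>2 - K * r\<^sup>2 / 64 \<le> z j \<bullet> bV j"
    and \<beta>: "0 \<le> \<beta>" "\<beta> \<le> 101 / 100 * L" and K: "0 < K" "K \<le> L" and X: "0 \<le> X"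
    and LT: "L * T\<^sup>2 \<le> 3 / 20" "L\<^sup>2 * T\<^sup>2 \<le> 18 / 100 * K"
  shows "norm (z 0 - (\<Sum>j<N. \<omega> j *\<^sub>R bV j)) \<le> (1 - 315 / 1000 * K * T\<^sup>2) * r + X"
proof -
  define \<alpha> where "\<alpha> = 4 / 7 * \<beta> * T\<^sup>2"
  have r0: "0 \<le> r" using r by simp
  have L0: "0 < L" using K by simp
  have \<alpha>0: "0 \<le> \<alpha>" using \<beta> by (simp add: \<alpha>_def)
  have "\<beta> * T\<^sup>2 \<le> 101 / 100 * L * T\<^sup>2" using \<beta> by (intro mult_right_mono) auto
  then have \<alpha>1: "\<alpha> \<le> 404 / 700 * (L * T\<^sup>2)" by (simp add: \<alpha>_def)
  then have \<alpha>2: "\<alpha> \<le> 866 / 10000" using LT(1) by simp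
  have "\<alpha> * L \<le> 404 / 700 * (L * T\<^sup>2) * L" using \<alpha>1 L0 by (intro mult_right_mono) auto
  also have "\<dots> = 404 / 700 * (L\<^sup>2 * T\<^sup>2)" by (simp add: power2_eq_square)
  finally have \<alpha>L: "\<alpha> * L \<le> 104 / 1000 * K" using LT(2) K by linarith
  have KT: "K * T\<^sup>2 \<le> 3 / 20" using LT(1) K by (smt (verit) mult_right_mono zero_le_power2)
  have inner: "69 / 100 * K * r\<^sup>2 - 373 / 100 * L * (r * X) - 131 / 100 * L * X\<^sup>2 \<le> z 0 \<bullet> bV j" if j: "j < N" for j
  proof -
    \<comment> \<open>along the trajectory the distance stays close to its initial value \<open>r\<close>\<close>
    have sq: "83 / 100 * r\<^sup>2 - 23 / 10 * (r * X) \<le> (norm (z j))\<^sup>2"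
    proof -
      define s where "s = (1 - \<alpha>) * r"
      have s0: "913 / 1000 * r \<le> s" unfolding s_def using \<alpha>2 r0 by (intro mult_right_mono) auto
      have s1: "s \<le> r" unfolding s_def using \<alpha>0 r0 by (simp add: algebra_simps)
      have s2: "83 / 100 * r\<^sup>2 \<le> s\<^sup>2"
      proof -
        have "(913 / 1000 * r)\<^sup>2 \<le> s\<^sup>2" using s0 r0 by (intro power_mono) auto
        moreover have "0 \<le> r\<^sup>2" by simp
        ultimately show ?thesis by (simp add: power_mult_distrib power2_eq_square del: zero_le_square)
      qed
      have "s * X \<le> r * X" using s1 X by (rule mult_right_mono)
      moreover have "0 \<le> r * X" using r0 X by simp
      moreover have "s\<^sup>2 - 16 / 7 * (s * X) \<le> (norm (z j))\<^sup>2"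
      proof (cases "8 / 7 * X \<le> s")
        case True
        have "norm (z 0) \<le> norm (z j) + norm (z j - z 0)" by (metis norm_minus_commute norm_triangle_sub)
        then have "s - 8 / 7 * X \<le> norm (z j)" using drift[OF j] r by (simp add: s_def \<alpha>_def algebra_simps)
        then have "(s - 8 / 7 * X)\<^sup>2 \<le> (norm (z j))\<^sup>2" using True by (intro power_mono) auto
        moreover have "(s - 8 / 7 * X)\<^sup>2 = s\<^sup>2 - 16 / 7 * (s * X) + (8 / 7 * X)\<^sup>2"
          by (simp add: power2_eq_square algebra_simps)
        moreover have "0 \<le> (8 / 7 * X)\<^sup>2" by simp
        ultimately show ?thesis by linarith
      next
        case False
        have "s * (s - 16 / 7 * X) \<le> 0" using False s0 r0 X by (intro mult_nonneg_nonpos) auto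
        moreover have "0 \<le> (norm (z j))\<^sup>2" by simp
        moreover have "s\<^sup>2 - 16 / 7 * (s * X) = s * (s - 16 / 7 * X)" by (simp add: power2_eq_square algebra_simps)
        ultimately show ?thesis by linarith
      qed
      ultimately show ?thesis using s2 by linarith
    qed
    have "\<bar>(z 0 - z j) \<bullet> bV j\<bar> \<le> norm (z 0 - z j) * norm (bV j)" by (rule Cauchy_Schwarz_ineq2)
    also have "\<dots> \<le> (\<alpha> * r + 8 / 7 * X) * (L * (8 / 7 * (r + X)))"
    proof (rule mult_mono)
      show "norm (z 0 - z j) \<le> \<alpha> * r + 8 / 7 * X" using drift[OF j] by (simp add: norm_minus_commute \<alpha>_def)
      show "norm (bV j) \<le> L * (8 / 7 * (r + X))"
        using lip[OF j] size[OF j] L0 by (meson mult_left_mono less_imp_le order_trans)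
    qed (use \<alpha>0 r0 X in auto)
    also have "\<dots> = 8 / 7 * (\<alpha> * L) * (r * (r + X)) + 64 / 49 * L * (X * (r + X))"
      by (simp add: field_simps)
    also have "\<dots> \<le> 8 / 7 * (104 / 1000 * K) * (r * (r + X)) + 64 / 49 * L * (X * (r + X))"
      using \<alpha>L r0 X by (intro add_right_mono mult_right_mono mult_left_mono) auto
    finally have A: "\<bar>(z 0 - z j) \<bullet> bV j\<bar> \<le> 8 / 7 * (104 / 1000 * K) * (r * (r + X)) + 64 / 49 * L * (X * (r + X))" .
    have B: "K * (83 / 100 * r\<^sup>2 - 23 / 10 * (r * X)) \<le> K * (norm (z j))\<^sup>2"
      using sq K by (intro mult_left_mono) auto
    have C: "z 0 \<bullet> bV j = z j \<bullet> bV j + (z 0 - z j) \<bullet> bV j" by (simp add: inner_diff_left)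
    have KL: "K * (r * X) \<le> L * (r * X)" using K r0 X by (intro mult_right_mono) auto
    have p: "0 \<le> K * r\<^sup>2" "0 \<le> L * X\<^sup>2" "0 \<le> L * (r * X)" using K L0 r0 X by auto
    have e: "8 / 7 * (104 / 1000 * K) * (r * (r + X)) + 64 / 49 * L * (X * (r + X))
       = 832 / 7000 * (K * r\<^sup>2) + 832 / 7000 * (K * (r * X)) + 64 / 49 * (L * (r * X)) + 64 / 49 * (L * X\<^sup>2)"
      "K * (83 / 100 * r\<^sup>2 - 23 / 10 * (r * X)) = 83 / 100 * (K * r\<^sup>2) - 23 / 10 * (K * (r * X))"
      by (simp_all add: field_simps power2_eq_square)
    show ?thesis using A B C KL p diss[OF j] unfolding e by linarith
  qed
  define G where "G = (\<Sum>j<N. \<omega> j *\<^sub>R bV j)"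
  define I where "I = 69 / 100 * K * r\<^sup>2 - 373 / 100 * L * (r * X) - 131 / 100 * L * X\<^sup>2"
  \<comment> \<open>the first-order term: the dissipativity, averaged over the trajectory\<close>
  have zG: "T\<^sup>2 / 2 * I \<le> z 0 \<bullet> G"
  proof -
    have "T\<^sup>2 / 2 * I = (\<Sum>j<N. \<omega> j * I)" by (simp add: sum_distrib_right[symmetric] \<omega>_sum)
    also have "\<dots> \<le> (\<Sum>j<N. \<omega> j * (z 0 \<bullet> bV j))"
      using inner \<omega>_nonneg by (intro sum_mono mult_left_mono) (auto simp: I_def)
    finally show ?thesis by (simp add: G_def inner_sum_right)
  qed
  have "norm G \<le> (\<Sum>j<N. \<omega> j * (L * (8 / 7 * (r + X))))"
    unfolding G_def
  proof (rule sum_norm_le)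
    fix j assume "j \<in> {..<N}"
    then have j: "j < N" by simp
    have "norm (bV j) \<le> L * (8 / 7 * (r + X))"
      using lip[OF j] size[OF j] L0 by (meson mult_left_mono less_imp_le order_trans)
    then have "\<omega> j * norm (bV j) \<le> \<omega> j * (L * (8 / 7 * (r + X)))"
      using \<omega>_nonneg[OF j] by (rule mult_left_mono)
    then show "norm (\<omega> j *\<^sub>R bV j) \<le> \<omega> j * (L * (8 / 7 * (r + X)))"
      using \<omega>_nonneg[OF j] by simp
  qed
  also have "\<dots> = 4 / 7 * (L * T\<^sup>2) * (r + X)" unfolding sum_distrib_right[symmetric] \<omega>_sum by simp
  finally have "(norm G)\<^sup>2 \<le> (4 / 7 * (L * T\<^sup>2) * (r + X))\<^sup>2" by (rule power_mono) simp
  also have "\<dots> = 16 / 49 * (L\<^sup>2 * T\<^sup>2) * (T\<^sup>2 * (r + X)\<^sup>2)" by (simp add: power2_eq_square algebra_simps)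
  also have "\<dots> \<le> 16 / 49 * (18 / 100 * K) * (T\<^sup>2 * (r + X)\<^sup>2)"
    using LT(2) by (intro mult_right_mono mult_left_mono) auto
  finally have G2: "(norm G)\<^sup>2 \<le> 288 / 4900 * (K * T\<^sup>2 * (r + X)\<^sup>2)" by simp
  \<comment> \<open>completing the square: half of the decrease of the squared distance is the decrease of the distance\<close>
  have "(norm (z 0 - G))\<^sup>2 = r\<^sup>2 - 2 * (z 0 \<bullet> G) + (norm G)\<^sup>2"
    by (simp add: r power2_norm_eq_inner inner_diff_left inner_diff_right inner_commute)
  also have "\<dots> \<le> r\<^sup>2 - T\<^sup>2 * I + 288 / 4900 * (K * T\<^sup>2 * (r + X)\<^sup>2)" using zG G2 by simp
  also have "\<dots> = r\<^sup>2 - (69 / 100 - 288 / 4900) * (K * T\<^sup>2) * r\<^sup>2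
      + (373 / 100 * (L * T\<^sup>2) + 576 / 4900 * (K * T\<^sup>2)) * (r * X)
      + (131 / 100 * (L * T\<^sup>2) + 288 / 4900 * (K * T\<^sup>2)) * X\<^sup>2"
    by (simp add: I_def power2_eq_square algebra_simps)
  also have "\<dots> \<le> r\<^sup>2 - 63 / 100 * (K * T\<^sup>2) * r\<^sup>2 + 1 * (r * X) + 1 * X\<^sup>2"
    using LT KT K r0 X by (intro add_mono mult_right_mono diff_mono) auto
  also have "\<dots> \<le> ((1 - 315 / 1000 * K * T\<^sup>2) * r + X)\<^sup>2"
  proof -
    have "0 \<le> (1 - 63 / 100 * (K * T\<^sup>2)) * (r * X)" using KT r0 X by (intro mult_nonneg_nonneg) auto
    moreover have "0 \<le> (315 / 1000 * (K * T\<^sup>2) * r)\<^sup>2" by simp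
    moreover have "((1 - 315 / 1000 * K * T\<^sup>2) * r + X)\<^sup>2
       = r\<^sup>2 - 63 / 100 * (K * T\<^sup>2) * r\<^sup>2 + 1 * (r * X) + 1 * X\<^sup>2
         + (315 / 1000 * (K * T\<^sup>2) * r)\<^sup>2 + (1 - 63 / 100 * (K * T\<^sup>2)) * (r * X)"
      by (simp add: power2_eq_square algebra_simps)
    ultimately show ?thesis by linarith
  qed
  finally show ?thesis unfolding G_def
    using KT r0 X by (intro power2_le_imp_le[of "norm (z 0 - (\<Sum>j<N. \<omega> j *\<^sub>R bV j))"]) (auto intro!: add_nonneg_nonneg mult_nonneg_nonneg)
qed

text \<open>The largest distance that two particles with initial distance vector \<open>z\<close> and initial velocity
  difference \<open>w\<close> reach up to time \<open>T\<close> in free motion, by convexity of the norm.\<close>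

definition free_reach :: "real \<Rightarrow> 'a::real_normed_vector \<Rightarrow> 'a \<Rightarrow> real" where
  "free_reach T z w = max (norm z) (norm (z + T *\<^sub>R w))"

text \<open>An upper bound for the influence of the other particles on the distance of the positions of one
  particle at time \<open>T\<close>. It does not depend on that particle.\<close>

definition interaction :: "real \<Rightarrow> real \<Rightarrow> real^'d^'n \<Rightarrow> real^'d^'n \<Rightarrow> real" where
  "interaction l T z w = 8 / 7 * (l * T\<^sup>2 / real CARD('n)) * (\<Sum>i\<in>UNIV. free_reach T (z $ i) (w $ i))"

lemma free_reach_nonneg: "0 \<le> free_reach T z w"
  by (simp add: free_reach_def le_max_iff_disj)

lemma interaction_nonneg: "0 \<le> l \<Longrightarrow> 0 \<le> interaction l T z w"
  by (simp add: interaction_def sum_nonneg free_reach_nonneg)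

text \<open>Besides the confining force \<open>g\<close>, a particle feels the others through a perturbation
  whose Lipschitz constants are multiples of the small number \<open>l\<close>; the dissipativity of \<open>g\<close> may fail at distances below a
  multiple of \<open>R'\<close>.\<close>

locale mean_field_force =
  fixes b :: "real^'d^'n \<Rightarrow> real^'d^'n" and g :: "real^'d \<Rightarrow> real^'d" and L K l R' T :: real
  assumes K: "0 < K" "K \<le> L" and l: "0 \<le> l" "l \<le> K / 10 ^ 8"
    and g_lip: "norm (g u - g v) \<le> L * norm (u - v)"
    and g_diss: "K * (norm (u - v))\<^sup>2 - K * R'\<^sup>2 / 64 \<le> (u - v) \<bullet> (g u - g v)"
    and mean_field: "norm ((b x $ i - b y $ i) - (g (x $ i) - g (y $ i)))
      \<le> 2 * l * norm (x $ i - y $ i) + 2 * l / real CARD('n) * (\<Sum>j\<in>UNIV. norm (x $ j - y $ j))"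
    and R': "0 \<le> R'" and T: "0 < T" and LT: "L * T\<^sup>2 \<le> 3 / 20" "L\<^sup>2 * T\<^sup>2 \<le> 18 / 100 * K"
begin

lemma force_lip: "norm (b x $ i - b y $ i)
  \<le> (L + 2 * l) * norm (x $ i - y $ i) + 2 * l / real CARD('n) * (\<Sum>j\<in>UNIV. norm (x $ j - y $ j))"
  using g_lip[of "x $ i" "y $ i"] mean_field[of x i y] norm_triangle_sub[of "b x $ i - b y $ i" "g (x $ i) - g (y $ i)"]
  by (simp add: algebra_simps)

lemma l_le: "l \<le> L / 10 ^ 8"
  using l K by simp

lemma KT: "K * T\<^sup>2 \<le> 3 / 20"
  using LT(1) K by (smt (verit) mult_right_mono zero_le_power2)

context
  fixes N :: nat and h :: real and x y \<xi> \<eta> :: "real^'d^'n" and q q' :: "nat \<Rightarrow> real^'d^'n"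
    and a :: "'n \<Rightarrow> real" and X :: real
  assumes h: "0 \<le> h" "h * real N = T"
    and q: "q = (\<lambda>k. fst (verlet b h k (x, \<xi>)))" and q': "q' = (\<lambda>k. fst (verlet b h k (y, \<eta>)))"
    and a: "a = (\<lambda>i. free_reach T ((x - y) $ i) ((\<xi> - \<eta>) $ i))" and X: "X = interaction l T (x - y) (\<xi> - \<eta>)"
begin

lemma verlet_difference: "q k $ i - q' k $ i = (x $ i - y $ i) + (h * real k) *\<^sub>R (\<xi> $ i - \<eta> $ i)
    - (\<Sum>j<k. verlet_weight h k j *\<^sub>R (b (q j) $ i - b (q' j) $ i))"
  unfolding q q' by (subst (1 2) verlet_position) (simp add: algebra_simps sum_subtractf)

lemma verlet_estimates:
  "k \<le> N \<Longrightarrow> norm (q k $ i - q' k $ i - (x $ i - y $ i) - (h * real k) *\<^sub>R (\<xi> $ i - \<eta> $ i))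
      \<le> 4 / 7 * (L + 2 * l) * T\<^sup>2 * a i + 8 / 7 * X"
  "k \<le> N \<Longrightarrow> norm (q k $ i - q' k $ i) \<le> 8 / 7 * (a i + X)"
  "k \<le> N \<Longrightarrow> l * T\<^sup>2 / real CARD('n) * (\<Sum>j\<in>UNIV. norm (q k $ j - q' k $ j)) \<le> X"
proof -
  have q0: "q 0 = x" "q' 0 = y" by (simp_all add: q q')
  note * = particle_estimates[where z = "\<lambda>i k. q k $ i - q' k $ i" and F = "\<lambda>i k. b (q k) $ i - b (q' k) $ i"
      and w = "\<lambda>i. \<xi> $ i - \<eta> $ i" and \<omega> = "verlet_weight h" and a = a and h = h and \<beta> = "L + 2 * l"
      and l = l and T = T and X = X and N = N, unfolded q0]
  have small: "(L + 2 * l + 2 * l) * T\<^sup>2 \<le> 1 / 4"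
  proof -
    have "(L + 2 * l + 2 * l) * T\<^sup>2 \<le> (101 / 100 * L) * T\<^sup>2" using l_le K by (intro mult_right_mono) auto
    then show ?thesis using LT(1) by simp
  qed
  have "a = (\<lambda>i. max (norm (x $ i - y $ i)) (norm (x $ i - y $ i + T *\<^sub>R (\<xi> $ i - \<eta> $ i))))"
    by (simp add: a free_reach_def)
  moreover have "X = 8 / 7 * (l * T\<^sup>2 / real CARD('n)) * (\<Sum>i\<in>UNIV. a i)" by (simp add: X interaction_def a)
  ultimately show
    "k \<le> N \<Longrightarrow> norm (q k $ i - q' k $ i - (x $ i - y $ i) - (h * real k) *\<^sub>R (\<xi> $ i - \<eta> $ i))
      \<le> 4 / 7 * (L + 2 * l) * T\<^sup>2 * a i + 8 / 7 * X"
    "k \<le> N \<Longrightarrow> norm (q k $ i - q' k $ i) \<le> 8 / 7 * (a i + X)"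
    "k \<le> N \<Longrightarrow> l * T\<^sup>2 / real CARD('n) * (\<Sum>j\<in>UNIV. norm (q k $ j - q' k $ j)) \<le> X"
    using *[OF verlet_difference] verlet_weight_nonneg sum_verlet_weight force_lip h l K small
    by auto
qed

lemma verlet_free_motion:
  "norm (q N $ i - q' N $ i - (x $ i - y $ i) - T *\<^sub>R (\<xi> $ i - \<eta> $ i)) \<le> 29 / 50 * (L * T\<^sup>2) * a i + 8 / 7 * X"
proof -
  have "4 / 7 * (L + 2 * l) * (T\<^sup>2 * a i) \<le> 29 / 50 * L * (T\<^sup>2 * a i)"
    using l_le K by (intro mult_right_mono) (auto simp: a free_reach_nonneg)
  then show ?thesis using verlet_estimates(1)[of N i] by (simp add: h(2) mult.assoc)
qed

text \<open>Beyond the distance \<open>R'\<close> the defect \<open>K R'\<^sup>2 / 64\<close> of the dissipativity is at most \<open>K r\<^sup>2 / 64\<close>. The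
  confining force therefore contracts the pair, and the perturbation by the other particles is
  absorbed by the difference between \<open>315 / 1000\<close> and \<open>1 / 4\<close> and by \<open>X\<close>.\<close>

lemma verlet_contraction:
  assumes far: "R' \<le> norm (x $ i - y $ i)" and sync: "\<xi> $ i = \<eta> $ i"
  shows "norm (q N $ i - q' N $ i) \<le> (1 - K * T\<^sup>2 / 4) * norm (x $ i - y $ i) + 3 * X"
proof -
  define r where "r = norm (x $ i - y $ i)"
  define z where "z j = q j $ i - q' j $ i" for j
  define bV where "bV j = g (q j $ i) - g (q' j $ i)" for j
  define e where "e j = (b (q j) $ i - b (q' j) $ i) - bV j" for j
  have r0: "0 \<le> r" by (simp add: r_def)
  have X0: "0 \<le> X" by (simp add: X interaction_nonneg l)
  have z0: "z 0 = x $ i - y $ i" by (simp add: z_def q q')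
  have ar: "a i = r" by (simp add: a free_reach_def sync r_def)
  have weights: "(\<Sum>j<N. verlet_weight h N j) = T\<^sup>2 / 2" using h(2) by (simp add: sum_verlet_weight)
  have main: "norm (z 0 - (\<Sum>j<N. verlet_weight h N j *\<^sub>R bV j)) \<le> (1 - 315 / 1000 * K * T\<^sup>2) * r + X"
  proof (rule dissipative_particle[where L = L and \<beta> = "L + 2 * l"])
    fix j assume j: "j < N"
    show "0 \<le> verlet_weight h N j" by (rule verlet_weight_nonneg[OF j])
    show "norm (z j - z 0) \<le> 4 / 7 * (L + 2 * l) * T\<^sup>2 * r + 8 / 7 * X"
      using verlet_estimates(1)[of j i] j unfolding z_def z0[unfolded z_def] by (simp add: sync ar)
    show "norm (z j) \<le> 8 / 7 * (r + X)" using verlet_estimates(2)[of j i] j by (simp add: z_def ar)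
    show "norm (bV j) \<le> L * norm (z j)" by (simp add: bV_def z_def g_lip)
    have "K * R'\<^sup>2 / 64 \<le> K * r\<^sup>2 / 64" using far R' K by (simp add: r_def power_mono)
    then show "K * (norm (z j))\<^sup>2 - K * r\<^sup>2 / 64 \<le> z j \<bullet> bV j"
      using g_diss[of "q j $ i" "q' j $ i"] by (simp add: z_def bV_def)
  qed (use weights K l l_le X0 LT z0 in \<open>auto simp: r_def\<close>)
  \<comment> \<open>\<open>e\<close> is the part of the force that is caused by the other particles\<close>
  have pert: "norm (\<Sum>j<N. verlet_weight h N j *\<^sub>R e j) \<le> 8 / 7 * (l * T\<^sup>2) * (r + X) + X"
  proof -
    have "norm (\<Sum>j<N. verlet_weight h N j *\<^sub>R e j) \<le> (\<Sum>j<N. verlet_weight h N j * (2 * l * (8 / 7 * (r + X)) + 2 * X / T\<^sup>2))"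
    proof (rule sum_norm_le)
      fix j assume "j \<in> {..<N}"
      then have j: "j < N" by simp
      have "2 * l / real CARD('n) * (\<Sum>k\<in>UNIV. norm (q j $ k - q' j $ k)) \<le> 2 * X / T\<^sup>2"
        using verlet_estimates(3)[of j] j T by (simp add: field_simps)
      moreover have "2 * l * norm (z j) \<le> 2 * l * (8 / 7 * (r + X))"
        using verlet_estimates(2)[of j i] j l by (intro mult_left_mono) (auto simp: z_def ar)
      moreover have "norm (e j) \<le> 2 * l * norm (z j) + 2 * l / real CARD('n) * (\<Sum>k\<in>UNIV. norm (q j $ k - q' j $ k))"
        using mean_field[of "q j" i "q' j"] by (simp add: e_def z_def bV_def)
      ultimately have "norm (e j) \<le> 2 * l * (8 / 7 * (r + X)) + 2 * X / T\<^sup>2" by linarith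
      then show "norm (verlet_weight h N j *\<^sub>R e j) \<le> verlet_weight h N j * (2 * l * (8 / 7 * (r + X)) + 2 * X / T\<^sup>2)"
        using verlet_weight_nonneg[OF j, of h] by (simp add: mult_left_mono)
    qed
    also have "\<dots> = 8 / 7 * (l * T\<^sup>2) * (r + X) + X"
      using T unfolding sum_distrib_right[symmetric] weights by (simp add: field_simps)
    finally show ?thesis .
  qed
  have "z N = (z 0 - (\<Sum>j<N. verlet_weight h N j *\<^sub>R bV j)) - (\<Sum>j<N. verlet_weight h N j *\<^sub>R e j)"
  proof -
    have "(\<Sum>j<N. verlet_weight h N j *\<^sub>R (b (q j) $ i - b (q' j) $ i))
        = (\<Sum>j<N. verlet_weight h N j *\<^sub>R bV j) + (\<Sum>j<N. verlet_weight h N j *\<^sub>R e j)"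
      by (simp add: e_def scaleR_diff_right sum_subtractf)
    then show ?thesis using verlet_difference[of N i] sync by (simp add: z_def[of N] z0)
  qed
  then have "norm (z N) \<le> (1 - 315 / 1000 * K * T\<^sup>2) * r + X + (8 / 7 * (l * T\<^sup>2) * (r + X) + X)"
    using main pert norm_triangle_ineq4 by (smt (verit))
  also have "\<dots> \<le> (1 - K * T\<^sup>2 / 4) * r + 3 * X"
  proof -
    have lT: "l * T\<^sup>2 \<le> K * T\<^sup>2 / 10 ^ 8" using mult_right_mono[OF l(2), of "T\<^sup>2"] by simp
    then have "8 / 7 * (l * T\<^sup>2) * r \<le> 65 / 1000 * (K * T\<^sup>2) * r"
    proof (intro mult_right_mono r0)
      have "0 \<le> K * T\<^sup>2" using K by simp
      then show "8 / 7 * (l * T\<^sup>2) \<le> 65 / 1000 * (K * T\<^sup>2)" using lT by simp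
    qed
    moreover have "8 / 7 * (l * T\<^sup>2) * X \<le> 1 * X"
      using lT KT X0 by (intro mult_right_mono) auto
    ultimately show ?thesis by (simp add: algebra_simps)
  qed
  finally show ?thesis by (simp add: z_def r_def)
qed

end

end

section \<open>The Hamiltonian flow\<close>

lemma norm_increment_le:
  fixes f :: "real \<Rightarrow> 'a::real_normed_vector"
  assumes "a \<le> b" and f: "\<And>s. s \<in> {a..b} \<Longrightarrow> (f has_vector_derivative f' s) (at s within {a..b})"
    and B: "\<And>s. s \<in> {a..b} \<Longrightarrow> norm (f' s) \<le> B"
  shows "norm (f b - f a) \<le> B * (b - a)"
proof -
  have "norm (f b - f a) \<le> B * norm (b - a)"
  proof (rule differentiable_bound[where S = "{a..b}" and f' = "\<lambda>s h. h *\<^sub>R f' s"])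
    show "onorm (\<lambda>h. h *\<^sub>R f' s) \<le> B" if "s \<in> {a..b}" for s
      using mult_right_mono[OF B[OF that] abs_ge_zero] by (intro onorm_le) (simp add: mult.commute)
  qed (use assms in \<open>auto simp: has_vector_derivative_def\<close>)
  then show ?thesis using \<open>a \<le> b\<close> by simp
qed

lemma power_over_fact_has_integral:
  assumes "0 \<le> (t::real)"
  shows "((\<lambda>s. s ^ m / fact m) has_integral (t ^ Suc m / fact (Suc m))) {0..t}"
proof -
  have "((\<lambda>s. s ^ m / fact m) has_integral (t ^ Suc m / fact (Suc m) - 0 ^ Suc m / fact (Suc m))) {0..t}"
  proof (rule fundamental_theorem_of_calculus[OF assms])
    fix s
    have "((\<lambda>s. s ^ Suc m / fact (Suc m)) has_real_derivative (real (Suc m) * s ^ m / fact (Suc m))) (at s within {0..t})"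
      by (intro derivative_eq_intros refl | simp)+
    moreover have "real (Suc m) * s ^ m / fact (Suc m) = s ^ m / fact m" by simp
    ultimately show "((\<lambda>s. s ^ Suc m / fact (Suc m)) has_vector_derivative s ^ m / fact m) (at s within {0..t})"
      by (metis has_real_derivative_iff_has_vector_derivative)
  qed
  then show ?thesis by simp
qed

text \<open>Picard iteration: the increments of the iterates are bounded by the terms of an exponential
  series, so that the iterates converge uniformly on compact time intervals.\<close>

lemma lipschitz_ode_global_solution:
  fixes F :: "'a::euclidean_space \<Rightarrow> 'a"
  assumes lip: "\<And>x y. norm (F x - F y) \<le> C * norm (x - y)" and C: "0 \<le> C"
  obtains y where "y 0 = y0" "continuous_on {0..} y"
    "\<And>t. 0 \<le> t \<Longrightarrow> (y has_vector_derivative F (y t)) (at t within {0..})"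
proof -
  have F_cont: "continuous_on S F" for S
  proof (rule continuous_on_subset[of UNIV])
    show "continuous_on UNIV F"
      using lip C by (intro lipschitz_on_continuous_on[of C] lipschitz_onI) (auto simp: dist_norm)
  qed simp
  define Y where "Y = rec_nat (\<lambda>_::real. y0) (\<lambda>_ f t. y0 + integral {0..t} (\<lambda>s. F (f s)))"
  have Y0: "Y 0 t = y0" and YS: "Y (Suc m) t = y0 + integral {0..t} (\<lambda>s. F (Y m s))" for m t
    by (simp_all add: Y_def)
  have Y_cont: "continuous_on {0..S} (Y m)" for m S
  proof (induction m arbitrary: S)
    case 0 show ?case by (simp add: Y_def)
  next
    case (Suc m)
    have "continuous_on {0..S} (\<lambda>s. F (Y m s))" using continuous_on_compose2[OF F_cont[of UNIV] Suc.IH] by simp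
    then have "(\<lambda>s. F (Y m s)) integrable_on {0..S}" by (rule integrable_continuous_real)
    then have "continuous_on {0..S} (\<lambda>t. y0 + integral {0..t} (\<lambda>s. F (Y m s)))"
      by (intro continuous_intros indefinite_integral_continuous_1)
    then show ?case by (simp add: YS[abs_def])
  qed
  have FY_cont: "continuous_on {0..S} (\<lambda>s. F (Y m s))" for m S
    using continuous_on_compose2[OF F_cont[of UNIV] Y_cont] by simp
  define B where "B = norm (F y0)"
  have incr: "norm (Y (Suc m) t - Y m t) \<le> B * C ^ m * (t ^ Suc m / fact (Suc m))" if "0 \<le> t" for m t
    using that
  proof (induction m arbitrary: t)
    case 0 then show ?case by (simp add: YS Y0 B_def mult.commute)
  next
    case (Suc m)
    have "Y (Suc (Suc m)) t - Y (Suc m) t = integral {0..t} (\<lambda>s. F (Y (Suc m) s) - F (Y m s))"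
      by (subst integral_diff)
        (auto intro!: integrable_continuous_real FY_cont simp: YS[of "Suc m"] YS[of m t])
    also have "norm \<dots> \<le> integral {0..t} (\<lambda>s. (B * C ^ Suc m) * (s ^ Suc m / fact (Suc m)))"
    proof (rule integral_norm_bound_integral)
      show "(\<lambda>s. F (Y (Suc m) s) - F (Y m s)) integrable_on {0..t}"
        by (intro integrable_continuous_real continuous_on_diff FY_cont)
      show "(\<lambda>s. (B * C ^ Suc m) * (s ^ Suc m / fact (Suc m))) integrable_on {0..t}"
        by (intro integrable_continuous_real continuous_intros) auto
      fix s assume "s \<in> {0..t}"
      then have "C * norm (Y (Suc m) s - Y m s) \<le> C * (B * C ^ m * (s ^ Suc m / fact (Suc m)))"
        using Suc.IH[of s] C by (intro mult_left_mono) auto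
      with lip[of "Y (Suc m) s" "Y m s"]
      show "norm (F (Y (Suc m) s) - F (Y m s)) \<le> (B * C ^ Suc m) * (s ^ Suc m / fact (Suc m))"
        by (simp add: mult_ac)
    qed
    also have "\<dots> = (B * C ^ Suc m) * (t ^ Suc (Suc m) / fact (Suc (Suc m)))"
      by (intro integral_unique has_integral_mult_right power_over_fact_has_integral Suc.prems)
    finally show ?case .
  qed
  define y where "y t = y0 + (\<Sum>m. Y (Suc m) t - Y m t)" for t
  have unif: "uniform_limit {0..S} Y y sequentially" for S
  proof (cases "0 \<le> S")
    case S: True
    have "uniform_limit {0..S} (\<lambda>n t. \<Sum>m<n. Y (Suc m) t - Y m t) (\<lambda>t. \<Sum>m. Y (Suc m) t - Y m t) sequentially"
    proof (rule Weierstrass_m_test)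
      fix m t assume t: "t \<in> {0..S}"
      have "t ^ Suc m / fact (Suc m) \<le> S ^ Suc m / fact m"
        using t by (intro frac_le power_mono fact_mono) auto
      then have "B * C ^ m * (t ^ Suc m / fact (Suc m)) \<le> B * C ^ m * (S ^ Suc m / fact m)"
        using C by (intro mult_left_mono) (auto simp: B_def)
      then show "norm (Y (Suc m) t - Y m t) \<le> B * S * ((C * S) ^ m /\<^sub>R fact m)"
        using incr[of t m] t by (simp add: power_mult_distrib divide_inverse mult_ac)
    next
      show "summable (\<lambda>m. B * S * ((C * S) ^ m /\<^sub>R fact m))"
        by (intro summable_mult summable_exp_generic)
    qed
    then have "uniform_limit {0..S} (\<lambda>n t. y0 + (\<Sum>m<n. Y (Suc m) t - Y m t)) y sequentially"
      unfolding y_def by (intro uniform_limit_intros)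
    moreover have "y0 + (\<Sum>m<n. Y (Suc m) t - Y m t) = Y n t" for n t
      using sum_lessThan_telescope[of "\<lambda>m. Y m t" n] by (simp add: Y0)
    ultimately show ?thesis by simp
  qed simp
  have y_cont: "continuous_on {0..S} y" for S
    by (rule uniform_limit_theorem[OF always_eventually unif]) (auto intro: Y_cont)
  have Fy_cont: "continuous_on {0..S} (\<lambda>s. F (y s))" for S
    using continuous_on_compose2[OF F_cont[of UNIV] y_cont] by simp
  have y_eq: "y t = y0 + integral {0..t} (\<lambda>s. F (y s))" if t: "0 \<le> t" for t
  proof -
    have "uniform_limit {0..t} (\<lambda>m s. F (Y m s)) (\<lambda>s. F (y s)) sequentially"
    proof (rule uniform_limit_compose_uniformly_continuous_on[where B = UNIV, OF unif])
      show "uniformly_continuous_on UNIV F"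
        using lip C by (intro lipschitz_on_uniformly_continuous[of C] lipschitz_onI) (auto simp: dist_norm)
    qed auto
    then obtain I J where IJ: "\<And>m. ((\<lambda>s. F (Y m s)) has_integral I m) {0..t}"
        "((\<lambda>s. F (y s)) has_integral J) {0..t}" "I \<longlonglongrightarrow> J"
      using FY_cont by (rule uniform_limit_integral) auto
    have "(\<lambda>m. y0 + I m) \<longlonglongrightarrow> y0 + J" by (intro tendsto_intros IJ)
    moreover have "y0 + I m = Y (Suc m) t" for m using integral_unique[OF IJ(1)] by (simp add: YS)
    moreover have "(\<lambda>m. Y (Suc m) t) \<longlonglongrightarrow> y t"
      using tendsto_uniform_limitI[OF unif[of t]] t by (intro LIMSEQ_Suc) auto
    ultimately have "y t = y0 + J" using LIMSEQ_unique by force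
    then show ?thesis using integral_unique[OF IJ(2)] by simp
  qed
  show thesis
  proof (rule that)
    show "y 0 = y0" by (simp add: y_eq)
    have at: "at t within {0..} = at t within {0..t + 1}" if "0 \<le> t" for t :: real
      by (rule at_within_nhd[of t "{..<t + 1}"]) auto
    show "(y has_vector_derivative F (y t)) (at t within {0..})" if t: "0 \<le> t" for t
      unfolding at[OF t]
    proof (rule has_vector_derivative_transform)
      show "((\<lambda>u. y0 + integral {0..u} (\<lambda>s. F (y s))) has_vector_derivative F (y t)) (at t within {0..t + 1})"
        using integral_has_vector_derivative[OF Fy_cont, of t "t + 1"] t
        by (auto intro!: derivative_eq_intros)
    qed (use t y_eq in auto)
    then show "continuous_on {0..} y"
      by (intro continuous_on_vector_derivative) auto
  qed
qed

text \<open>A one-step method with local error of order \<open>h\<^sup>2\<close> and stable steps has global error of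
  order \<open>h\<close>.\<close>

lemma one_step_method_tendsto:
  fixes y :: "real \<Rightarrow> 'a::real_normed_vector" and \<Phi> :: "real \<Rightarrow> 'a \<Rightarrow> 'a"
  assumes T: "0 < T" and C: "0 \<le> C" and D: "0 \<le> D"
    and loc: "\<And>h t. 0 < h \<Longrightarrow> 0 \<le> t \<Longrightarrow> t + h \<le> T \<Longrightarrow> norm (y (t + h) - \<Phi> h (y t)) \<le> D * h\<^sup>2"
    and stab: "\<And>h u v. 0 < h \<Longrightarrow> h \<le> T \<Longrightarrow> norm (\<Phi> h u - \<Phi> h v) \<le> (1 + C * h) * norm (u - v)"
  shows "(\<lambda>N. (\<Phi> (T / real N) ^^ N) (y 0)) \<longlonglongrightarrow> y T"
proof -
  have err: "norm ((\<Phi> (T / real N) ^^ N) (y 0) - y T) \<le> D * T\<^sup>2 * exp (C * T) / real N" if N: "0 < N" for N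
  proof -
    define h where "h = T / real N"
    have h: "0 < h" "h * real N = T" using T N by (auto simp: h_def)
    have hT: "h \<le> T" using T N by (simp add: h_def divide_le_eq mult_le_cancel_left1)
    have k: "norm ((\<Phi> h ^^ k) (y 0) - y (h * real k)) \<le> D * h\<^sup>2 * real k * (1 + C * h) ^ k" if "k \<le> N" for k
      using that
    proof (induction k)
      case (Suc k)
      let ?u = "(\<Phi> h ^^ k) (y 0)"
      have g: "1 \<le> 1 + C * h" using C h by simp
      have "h * real k + h = h * real (Suc k)" by (simp add: algebra_simps)
      moreover have "h * real (Suc k) \<le> T" using Suc.prems h by (metis mult_left_mono of_nat_le_iff less_imp_le)
      ultimately have "norm (y (h * real (Suc k)) - \<Phi> h (y (h * real k))) \<le> D * h\<^sup>2"
        using loc[of h "h * real k"] h by simp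
      moreover have "norm (\<Phi> h ?u - \<Phi> h (y (h * real k))) \<le> (1 + C * h) * (D * h\<^sup>2 * real k * (1 + C * h) ^ k)"
        using stab[OF h(1) hT, of ?u "y (h * real k)"] Suc g
        by (meson Suc_leD mult_left_mono order_trans zero_le_one)
      ultimately have "norm (\<Phi> h ?u - y (h * real (Suc k))) \<le> (1 + C * h) * (D * h\<^sup>2 * real k * (1 + C * h) ^ k) + D * h\<^sup>2"
        by (smt (verit) norm_diff_triangle_ineq norm_minus_commute norm_triangle_ineq4 diff_add_cancel norm_triangle_le_diff norm_diff_triangle_le)
      moreover have "D * h\<^sup>2 \<le> D * h\<^sup>2 * (1 + C * h) ^ Suc k"
        using mult_left_mono[OF one_le_power[OF g, of "Suc k"], of "D * h\<^sup>2"] D by simp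
      moreover have "(1 + C * h) * (D * h\<^sup>2 * real k * (1 + C * h) ^ k) + D * h\<^sup>2 * (1 + C * h) ^ Suc k
          = D * h\<^sup>2 * real (Suc k) * (1 + C * h) ^ Suc k" by (simp add: algebra_simps)
      ultimately show ?case by simp
    qed simp
    have "norm ((\<Phi> h ^^ N) (y 0) - y T) \<le> D * h\<^sup>2 * real N * (1 + C * h) ^ N"
      using k[of N] h by simp
    also have "\<dots> \<le> D * h\<^sup>2 * real N * exp (C * h) ^ N"
      using D C h by (intro mult_left_mono power_mono exp_ge_add_one_self) auto
    also have "exp (C * h) ^ N = exp (C * T)" using h(2) by (simp add: exp_of_nat_mult[symmetric] mult_ac)
    also have "D * h\<^sup>2 * real N * exp (C * T) = D * T\<^sup>2 * exp (C * T) / real N"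
      using N by (simp add: h_def power2_eq_square)
    finally show ?thesis by (simp add: h_def)
  qed
  have "(\<lambda>N. (\<Phi> (T / real N) ^^ N) (y 0) - y T) \<longlonglongrightarrow> 0"
  proof (rule Lim_null_comparison)
    show "\<forall>\<^sub>F N in sequentially. norm ((\<Phi> (T / real N) ^^ N) (y 0) - y T) \<le> D * T\<^sup>2 * exp (C * T) / real N"
      using eventually_gt_at_top[of 0] by eventually_elim (rule err)
    show "(\<lambda>N. D * T\<^sup>2 * exp (C * T) / real N) \<longlonglongrightarrow> 0" by (rule lim_const_over_n)
  qed
  then show ?thesis by (simp add: LIM_zero_iff)
qed

text \<open>A Lipschitz force makes the Verlet step consistent of order \<open>h\<^sup>2\<close>: positions and forces along a
  trajectory change by \<open>O(h)\<close> within one step.\<close>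

lemma verlet_tendsto_hamiltonian_flow:
  fixes q p :: "real \<Rightarrow> 'a::euclidean_space"
  assumes lip: "\<And>x y. norm (b x - b y) \<le> C * norm (x - y)" and C: "0 \<le> C" and T: "0 < T"
    and q: "\<And>t. 0 \<le> t \<Longrightarrow> (q has_vector_derivative p t) (at t within {0..})"
    and p: "\<And>t. 0 \<le> t \<Longrightarrow> (p has_vector_derivative - b (q t)) (at t within {0..})"
  shows "(\<lambda>N. verlet b (T / real N) N (q 0, p 0)) \<longlonglongrightarrow> (q T, p T)"
proof -
  have b_cont: "continuous_on S b" for S
  proof (rule continuous_on_subset[of UNIV])
    show "continuous_on UNIV b"
      using lip C by (intro lipschitz_on_continuous_on[of C] lipschitz_onI) (auto simp: dist_norm)
  qed simp
  have q_cont: "continuous_on {0..T} q" and p_cont: "continuous_on {0..T} p"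
    by (rule continuous_on_vector_derivative, rule has_vector_derivative_within_subset[OF q], auto)
      (rule continuous_on_vector_derivative, rule has_vector_derivative_within_subset[OF p], auto)
  obtain P where P: "\<And>t. t \<in> {0..T} \<Longrightarrow> norm (p t) \<le> P" "0 \<le> P"
  proof -
    have "bounded (p ` {0..T})" by (intro compact_imp_bounded compact_continuous_image p_cont) auto
    then obtain P where "0 < P" "\<forall>x\<in>p ` {0..T}. norm x \<le> P" using bounded_pos by blast
    then show ?thesis using that[of P] by auto
  qed
  obtain B where B: "\<And>t. t \<in> {0..T} \<Longrightarrow> norm (b (q t)) \<le> B" "0 \<le> B"
  proof -
    have "continuous_on {0..T} (\<lambda>t. b (q t))" using continuous_on_compose2[OF b_cont[of UNIV] q_cont] by simp
    then have "bounded ((\<lambda>t. b (q t)) ` {0..T})" by (intro compact_imp_bounded compact_continuous_image) auto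
    then obtain B where "0 < B" "\<forall>x\<in>(\<lambda>t. b (q t)) ` {0..T}. norm x \<le> B" using bounded_pos by blast
    then show ?thesis using that[of B] by auto
  qed
  \<comment> \<open>constants in the local error and in the stability estimate of one step\<close>
  define D where "D = 3 / 2 * B + (C * P + T / 2 * (C * (3 / 2 * B)))"
  define C' where "C' = 1 + T / 2 * C + 1 / 2 * C + 1 / 2 * C * (1 + T + T\<^sup>2 / 2 * C)"
  have D0: "0 \<le> D" and C'0: "0 \<le> C'" using B P C T by (auto simp: D_def C'_def)
  show ?thesis
  proof (rule one_step_method_tendsto[where \<Phi> = "verlet_step b" and y = "\<lambda>t. (q t, p t)", OF T C'0 D0])
    fix h t :: real assume h: "0 < h" and t: "0 \<le> t" "t + h \<le> T"
    have in_T: "s \<in> {0..T}" if "s \<in> {t..t+h}" for s using that t by auto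
    have dq: "(q has_vector_derivative p s) (at s within S)" and dp: "(p has_vector_derivative - b (q s)) (at s within S)"
      if "s \<in> {t..t+h}" "S \<subseteq> {t..t+h}" for s S
      using that t by (auto intro!: has_vector_derivative_within_subset[OF q] has_vector_derivative_within_subset[OF p])
    have q_incr: "norm (q s - q s') \<le> P * h" if "s \<in> {t..t+h}" "s' \<in> {t..t+h}" "s' \<le> s" for s s'
    proof -
      have "norm (q s - q s') \<le> P * (s - s')"
        using that in_T P by (intro norm_increment_le[where f' = p] dq) auto
      also have "\<dots> \<le> P * h" using that P by (intro mult_left_mono) auto
      finally show ?thesis .
    qed
    have p_incr: "norm (p s - p t) \<le> B * h" if "s \<in> {t..t+h}" for s
    proof -
      have "norm (p s - p t) \<le> B * (s - t)"
        using that in_T B by (intro norm_increment_le[where f' = "\<lambda>s. - b (q s)"] dp) auto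
      also have "\<dots> \<le> B * h" using that B by (intro mult_left_mono) auto
      finally show ?thesis .
    qed
    have b_incr: "norm (b (q s) - b (q s')) \<le> C * (P * h)" if "s \<in> {t..t+h}" "s' \<in> {t..t+h}" for s s'
    proof -
      have "norm (q s - q s') \<le> P * h"
        using q_incr[of s s'] q_incr[of s' s] that by (cases "s' \<le> s") (auto simp: norm_minus_commute)
      then show ?thesis using lip[of "q s" "q s'"] C by (meson mult_left_mono order_trans)
    qed
    let ?q = "q t + h *\<^sub>R p t - (h\<^sup>2 / 2) *\<^sub>R b (q t)"
    have q1: "norm (q (t + h) - ?q) \<le> 3 / 2 * B * h\<^sup>2"
    proof -
      have "norm ((q (t + h) - (t + h) *\<^sub>R p t) - (q t - t *\<^sub>R p t)) \<le> (B * h) * (t + h - t)"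
        using h t p_incr
        by (intro norm_increment_le[where f' = "\<lambda>s. p s - p t" and f = "\<lambda>s. q s - s *\<^sub>R p t"])
          (auto intro!: derivative_eq_intros dq)
      moreover have "norm ((h\<^sup>2 / 2) *\<^sub>R b (q t)) \<le> h\<^sup>2 / 2 * B"
        using B(1)[of t] t h by (auto intro!: mult_left_mono)
      moreover have "q (t + h) - ?q = ((q (t + h) - (t + h) *\<^sub>R p t) - (q t - t *\<^sub>R p t)) + (h\<^sup>2 / 2) *\<^sub>R b (q t)"
        by (simp add: algebra_simps)
      ultimately have "norm (q (t + h) - ?q) \<le> B * h * h + h\<^sup>2 / 2 * B"
        by (metis (no_types, lifting) add_diff_cancel_left' norm_triangle_mono)
      then show ?thesis by (simp add: power2_eq_square field_simps)
    qed
    have p1: "norm (p (t + h) - (p t - (h / 2) *\<^sub>R (b (q t) + b (q (t + h))))) \<le> C * P * h\<^sup>2"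
    proof -
      let ?m = "(1 / 2) *\<^sub>R (b (q t) + b (q (t + h)))"
      have m: "norm (- b (q s) + ?m) \<le> C * P * h" if s: "s \<in> {t..t+h}" for s
      proof -
        have "- b (q s) + ?m = (1 / 2) *\<^sub>R ((b (q t) - b (q s)) + (b (q (t + h)) - b (q s)))"
          by (simp add: algebra_simps flip: scaleR_add_left)
        also have "norm \<dots> \<le> 1 / 2 * (C * (P * h) + C * (P * h))"
          using norm_triangle_mono[OF b_incr[of t s] b_incr[of "t + h" s]] s h by auto
        finally show ?thesis by simp
      qed
      have "norm ((p (t + h) + (t + h) *\<^sub>R ?m) - (p t + t *\<^sub>R ?m)) \<le> (C * P * h) * (t + h - t)"
        using h m by (intro norm_increment_le[where f' = "\<lambda>s. - b (q s) + ?m" and f = "\<lambda>s. p s + s *\<^sub>R ?m"])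
          (auto intro!: derivative_eq_intros dp)
      moreover have "(p (t + h) + (t + h) *\<^sub>R ?m) - (p t + t *\<^sub>R ?m)
          = p (t + h) - (p t - (h / 2) *\<^sub>R (b (q t) + b (q (t + h))))"
        by (simp add: algebra_simps add_divide_distrib)
      ultimately have "norm (p (t + h) - (p t - (h / 2) *\<^sub>R (b (q t) + b (q (t + h))))) \<le> (C * P * h) * (t + h - t)"
        by (simp only:)
      then show ?thesis by (simp add: power2_eq_square mult.assoc)
    qed
    have b1: "norm (b (q (t + h)) - b ?q) \<le> C * (3 / 2 * B * h\<^sup>2)"
      using lip[of "q (t + h)" ?q] q1 C by (meson mult_left_mono order_trans)
    let ?p = "p t - (h / 2) *\<^sub>R (b (q t) + b ?q)"
    have b2: "norm ((h / 2) *\<^sub>R (b (q (t + h)) - b ?q)) \<le> h / 2 * (C * (3 / 2 * B * h\<^sup>2))"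
      using h mult_left_mono[OF b1, of "h / 2"] by simp
    have "p (t + h) - ?p = (p (t + h) - (p t - (h / 2) *\<^sub>R (b (q t) + b (q (t + h))))) - (h / 2) *\<^sub>R (b (q (t + h)) - b ?q)"
      by (simp add: algebra_simps)
    also have "norm \<dots> \<le> C * P * h\<^sup>2 + h / 2 * (C * (3 / 2 * B * h\<^sup>2))"
      by (rule order_trans[OF norm_triangle_ineq4 add_mono[OF p1 b2]])
    also have "\<dots> \<le> C * P * h\<^sup>2 + T / 2 * (C * (3 / 2 * B * h\<^sup>2))"
      using h t C B by (intro add_left_mono mult_right_mono) auto
    finally have p2: "norm (p (t + h) - ?p) \<le> C * P * h\<^sup>2 + T / 2 * (C * (3 / 2 * B * h\<^sup>2))" .
    have "(q (t + h), p (t + h)) - verlet_step b h (q t, p t) = (q (t + h) - ?q, p (t + h) - ?p)"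
      by (simp add: verlet_step_def Let_def)
    then have "norm ((q (t + h), p (t + h)) - verlet_step b h (q t, p t)) \<le> norm (q (t + h) - ?q) + norm (p (t + h) - ?p)"
      by (simp add: norm_Pair_le)
    also have "\<dots> \<le> D * h\<^sup>2" using q1 p2 by (simp add: D_def algebra_simps)
    finally show "norm ((q (t + h), p (t + h)) - verlet_step b h (q t, p t)) \<le> D * h\<^sup>2" .
  next
    fix h :: real and u v :: "'a \<times> 'a" assume h: "0 < h" "h \<le> T"
    define dq dp where "dq = fst u - fst v" and "dp = snd u - snd v"
    define db where "db = b (fst u) - b (fst v)"
    define qu qv where "qu = fst u + h *\<^sub>R snd u - (h\<^sup>2 / 2) *\<^sub>R b (fst u)"
      and "qv = fst v + h *\<^sub>R snd v - (h\<^sup>2 / 2) *\<^sub>R b (fst v)"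
    define n where "n = norm (u - v)"
    have n: "0 \<le> n" by (simp add: n_def)
    have dn: "norm dq \<le> n" "norm dp \<le> n"
      using norm_fst_le[of "fst (u - v)" "snd (u - v)"] norm_snd_le[of "snd (u - v)" "fst (u - v)"] by (auto simp: dq_def dp_def n_def minus_prod_def)
    have dbn: "norm db \<le> C * n"
      using lip[of "fst u" "fst v"] dn C by (metis db_def dq_def mult_left_mono order_trans)
    have "norm (qu - qv) \<le> (1 + T + T\<^sup>2 / 2 * C) * n"
    proof -
      have "qu - qv = dq + h *\<^sub>R dp - (h\<^sup>2 / 2) *\<^sub>R db"
        by (simp add: qu_def qv_def dq_def dp_def db_def algebra_simps)
      also have "norm \<dots> \<le> norm dq + h * norm dp + h\<^sup>2 / 2 * norm db"
        using h by (intro order_trans[OF norm_triangle_ineq4] add_mono order_trans[OF norm_triangle_ineq]) auto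
      also have "\<dots> \<le> n + T * n + T\<^sup>2 / 2 * (C * n)"
        using h dn dbn n by (intro add_mono mult_mono divide_right_mono power_mono) auto
      finally show ?thesis by (simp add: algebra_simps)
    qed
    then have dbn': "norm (b qu - b qv) \<le> C * ((1 + T + T\<^sup>2 / 2 * C) * n)"
      using lip[of qu qv] C by (meson mult_left_mono order_trans)
    have "verlet_step b h u - verlet_step b h v
        = (u - v) + h *\<^sub>R (dp - (h / 2) *\<^sub>R db, - (1 / 2) *\<^sub>R (db + (b qu - b qv)))"
      by (cases u; cases v) (simp add: verlet_step_def Let_def dq_def dp_def db_def qu_def qv_def
          algebra_simps power2_eq_square)
    also have "norm \<dots> \<le> n + h * (C' * n)"
    proof -
      have "norm (dp - (h / 2) *\<^sub>R db, - (1 / 2) *\<^sub>R (db + (b qu - b qv)))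
          \<le> norm (dp - (h / 2) *\<^sub>R db) + norm (- (1 / 2) *\<^sub>R (db + (b qu - b qv)))" by (rule norm_Pair_le)
      also have "norm (dp - (h / 2) *\<^sub>R db) \<le> n + T / 2 * (C * n)"
      proof -
        have "norm (dp - (h / 2) *\<^sub>R db) \<le> norm dp + h / 2 * norm db"
          using h by (intro order_trans[OF norm_triangle_ineq4]) auto
        also have "\<dots> \<le> n + T / 2 * (C * n)" using h dn dbn by (intro add_mono mult_mono) auto
        finally show ?thesis .
      qed
      also have "norm (- (1 / 2) *\<^sub>R (db + (b qu - b qv))) \<le> 1 / 2 * (C * n + C * ((1 + T + T\<^sup>2 / 2 * C) * n))"
        using dbn dbn' norm_triangle_ineq[of db "b qu - b qv"] by simp
      finally have "norm (dp - (h / 2) *\<^sub>R db, - (1 / 2) *\<^sub>R (db + (b qu - b qv))) \<le> C' * n"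
        by (simp add: C'_def algebra_simps)
      then have "norm (h *\<^sub>R (dp - (h / 2) *\<^sub>R db, - (1 / 2) *\<^sub>R (db + (b qu - b qv)))) \<le> h * (C' * n)"
        by (metis abs_of_pos h(1) less_imp_le mult_left_mono norm_scaleR)
      then show ?thesis using norm_triangle_le[of "u - v"] n_def by (metis add_left_mono)
    qed
    finally show "norm (verlet_step b h u - verlet_step b h v) \<le> (1 + C' * h) * norm (u - v)"
      by (simp add: n_def algebra_simps)
  qed
qed

lemma piecewise_linear_curve:
  fixes c s :: "nat \<Rightarrow> 'a::real_normed_vector"
  assumes h: "0 < h" and c: "\<And>k. c (Suc k) = c k + h *\<^sub>R s k"
  shows "\<exists>f. continuous_on {0..} f \<and> (\<forall>k. f (h * real k) = c k) \<and>
    (\<forall>k t. h * real k < t \<longrightarrow> t < h * real (Suc k) \<longrightarrow> (f has_vector_derivative s k) (at t))"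
proof -
  define m where "m k t = max 0 (min h (t - h * real k))" for k t
  define f where "f t = c 0 + (\<Sum>k<nat \<lceil>t / h\<rceil>. m k t *\<^sub>R s k)" for t
  have m0: "m k t = 0" if "t \<le> h * real k" for k t using that h by (simp add: m_def)
  have f_eq: "f t = c 0 + (\<Sum>k<N. m k t *\<^sub>R s k)" if t: "t \<le> h * real N" for t N
  proof -
    have "t / h \<le> real N" using t h by (simp add: field_simps)
    then have sub: "{..<nat \<lceil>t / h\<rceil>} \<subseteq> {..<N}" by (auto simp: ceiling_le_iff nat_le_iff intro: less_le_trans)
    have "m k t = 0" if "t / h \<le> real k" for k
      using that h by (intro m0) (simp add: field_simps)
    then have "(\<Sum>k<nat \<lceil>t / h\<rceil>. m k t *\<^sub>R s k) = (\<Sum>k<N. m k t *\<^sub>R s k)"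
      using sub by (intro sum.mono_neutral_left) auto
    then show ?thesis by (simp add: f_def)
  qed
  have c_eq: "c k = c 0 + (\<Sum>j<k. h *\<^sub>R s j)" for k
    by (induction k) (auto simp: c)
  have f_lin: "f t = c k + (t - h * real k) *\<^sub>R s k" if t: "h * real k \<le> t" "t \<le> h * real (Suc k)" for t k
  proof -
    have "m j t = h" if "j < k" for j
    proof -
      have "h * (real j + 1) \<le> h * real k" using that h by (intro mult_left_mono) auto
      then show ?thesis using t h by (simp add: m_def algebra_simps)
    qed
    moreover have "m k t = t - h * real k" using t by (simp add: m_def algebra_simps)
    ultimately show ?thesis using t by (simp add: f_eq[of t "Suc k"] c_eq[of k])
  qed
  show ?thesis
  proof (intro exI[of _ f] conjI allI impI)
    show "f (h * real k) = c k" for k using f_lin[of k "h * real k"] h by simp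
    show "(f has_vector_derivative s k) (at t)" if t: "h * real k < t" "t < h * real (Suc k)" for k t
    proof (rule has_vector_derivative_transform_within_open[where S = "{h * real k<..<h * real (Suc k)}"])
      show "((\<lambda>t. c k + (t - h * real k) *\<^sub>R s k) has_vector_derivative s k) (at t)"
        by (auto intro!: derivative_eq_intros)
      show "c k + (u - h * real k) *\<^sub>R s k = f u" if "u \<in> {h * real k<..<h * real (Suc k)}" for u
        using f_lin[of k u] that by auto
    qed (use t in auto)
    show "continuous_on {0..} f"
      unfolding continuous_on_eq_continuous_within
    proof
      fix t :: real assume "t \<in> {0..}"
      obtain N where N: "t / h < real N" using reals_Archimedean2 by blast
      then have tN: "t < h * real N" using h by (simp add: field_simps)
      have "continuous_on {0..h * real N} (\<lambda>t. c 0 + (\<Sum>k<N. m k t *\<^sub>R s k))"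
        unfolding m_def by (intro continuous_intros)
      then have "continuous_on {0..h * real N} f" by (rule continuous_on_eq) (simp add: f_eq[of _ N])
      moreover have "at t within {0..h * real N} = at t within {0..}"
        using tN by (intro at_within_nhd[of t "{..<h * real N}"]) auto
      moreover have "t \<in> {0..h * real N}" using \<open>t \<in> {0..}\<close> tN by simp
      ultimately show "continuous (at t within {0..}) f"
        by (metis continuous_on_eq_continuous_within)
    qed
  qed
qed

lemma grid_cell:
  assumes h: "0 < h" and t: "0 \<le> t" "t \<notin> time_grid h"
  obtains k where "h * real k < t" "t < h * real (Suc k)"
proof -
  define k where "k = nat \<lfloor>t / h\<rfloor>"
  have k: "real k = of_int \<lfloor>t / h\<rfloor>" using h t by (simp add: k_def)
  have "h * real k \<le> t" "t < h * real (Suc k)"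
    using h floor_divide_lower[OF h, of t] floor_divide_upper[OF h, of t] by (auto simp: k algebra_simps)
  moreover have "t \<noteq> h * real k" using t(2) unfolding k by (auto simp: time_grid_def)
  ultimately show ?thesis using that[of k] by simp
qed

lemma grid_cell_values:
  assumes h: "0 < h" and t: "h * real k < t" "t < h * real (Suc k)"
  shows "t \<notin> time_grid h" "grid_floor h t = h * real k" "grid_ceiling h t = h * real (Suc k)"
proof -
  have "\<lfloor>t / h\<rfloor> = int k" using h t by (intro floor_unique) (auto simp: field_simps)
  then show "grid_floor h t = h * real k" using h by (simp add: grid_floor_eq)
  have "\<lceil>t / h\<rceil> = int (Suc k)" using h t by (intro ceiling_unique) (auto simp: field_simps)
  then show "grid_ceiling h t = h * real (Suc k)" using h by (simp add: grid_ceiling_eq)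
  show "t \<notin> time_grid h"
  proof
    assume "t \<in> time_grid h"
    then obtain j :: int where j: "t = h * of_int j" by (auto simp: time_grid_def)
    then have "of_int (int k) < (of_int j :: real)" "(of_int j :: real) < of_int (int (Suc k))"
      using t h by auto
    then have "int k < j" "j < int (Suc k)" by (simp_all only: of_int_less_iff)
    then show False by simp
  qed
qed

lemma linear_on_interval:
  fixes f :: "real \<Rightarrow> 'a::banach"
  assumes "a \<le> b" "continuous_on {a..b} f" and f: "\<And>t. a < t \<Longrightarrow> t < b \<Longrightarrow> (f has_vector_derivative v) (at t within {a..b})"
  shows "f b = f a + (b - a) *\<^sub>R v"
proof -
  have "f b - b *\<^sub>R v = f a - a *\<^sub>R v"
  proof (rule has_derivative_zero_unique_strong_interval[where k = "{a, b}" and a = a and b = b and f = "\<lambda>t. f t - t *\<^sub>R v"])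
    show "continuous_on {a..b} (\<lambda>t. f t - t *\<^sub>R v)" using assms(2) by (intro continuous_intros)
    fix t assume "t \<in> {a..b} - {a, b}"
    then have "((\<lambda>t. f t - t *\<^sub>R v) has_vector_derivative 0) (at t within {a..b})"
      using f[of t] by (auto intro!: derivative_eq_intros)
    then show "((\<lambda>t. f t - t *\<^sub>R v) has_derivative (\<lambda>h. 0)) (at t within {a..b})"
      by (simp add: has_vector_derivative_def)
  qed (use assms in auto)
  then show ?thesis by (simp add: algebra_simps)
qed

lemma has_vector_derivative_componentwise_vec:
  fixes f :: "real \<Rightarrow> 'a::euclidean_space^'n"
  assumes f: "\<And>i. ((\<lambda>s. f s $ i) has_vector_derivative v $ i) (at t within S)"
  shows "(f has_vector_derivative v) (at t within S)"
  unfolding has_vector_derivative_def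
proof (subst has_derivative_componentwise_within, rule ballI)
  fix e :: "'a^'n" assume "e \<in> Basis"
  then obtain i u where e: "e = axis i u" by (auto simp: Basis_vec_def)
  have "((\<lambda>s. (f s $ i) \<bullet> u) has_derivative (\<lambda>h. (h *\<^sub>R (v $ i)) \<bullet> u)) (at t within S)"
    using bounded_linear.has_derivative[OF bounded_linear_inner_left f[of i, unfolded has_vector_derivative_def]] .
  then show "((\<lambda>s. f s \<bullet> e) has_derivative (\<lambda>h. (h *\<^sub>R v) \<bullet> e)) (at t within S)"
    by (simp add: e inner_axis)
qed

definition force :: "(real^'d^'n \<Rightarrow> real) \<Rightarrow> real^'d^'n \<Rightarrow> real^'d^'n" where
  "force U x = (\<chi> i. block_grad U i x)"

text \<open>The right-hand sides are constant on every grid cell, so that interpolating the Verlet iterates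
  linearly solves the equations.\<close>

lemma verlet_solves_grid_dynamics:
  assumes h: "0 < h"
  obtains q p where "hmc_solution U h x v q p"
proof -
  define Q P where "Q k = fst (verlet (force U) h k (x, v))" and "P k = snd (verlet (force U) h k (x, v))" for k
  define sq where "sq k = P k - (h / 2) *\<^sub>R force U (Q k)" for k
  define sp where "sp k = - (1 / 2) *\<^sub>R (force U (Q k) + force U (Q (Suc k)))" for k
  have step_q: "Q (Suc k) = Q k + h *\<^sub>R sq k" for k
    unfolding Q_def fst_verlet_Suc sq_def P_def by (simp add: algebra_simps power2_eq_square)
  obtain q where q: "continuous_on {0..} q" "\<And>k. q (h * real k) = Q k"
    "\<And>k t. h * real k < t \<Longrightarrow> t < h * real (Suc k) \<Longrightarrow> (q has_vector_derivative sq k) (at t)" 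
    using piecewise_linear_curve[of h Q sq, OF h step_q] by blast
  have step_p: "P (Suc k) = P k + h *\<^sub>R sp k" for k
    unfolding P_def snd_verlet_Suc sp_def Q_def by (simp add: algebra_simps)
  obtain p where p: "continuous_on {0..} p" "\<And>k. p (h * real k) = P k"
    "\<And>k t. h * real k < t \<Longrightarrow> t < h * real (Suc k) \<Longrightarrow> (p has_vector_derivative sp k) (at t)" 
    using piecewise_linear_curve[of h P sp, OF h step_p] by blast
  have "hmc_solution U h x v q p"
    unfolding hmc_solution_def
  proof (intro conjI)
    show "q 0 = x" "p 0 = v" using q(2)[of 0] p(2)[of 0] by (simp_all add: Q_def P_def)
    have "((\<lambda>s. q s $ i) has_vector_derivative
             p (grid_floor h t) $ i - (h / 2) *\<^sub>R block_grad U i (q (grid_floor h t))) (at t within {0..}) \<and>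
          ((\<lambda>s. p s $ i) has_vector_derivative
             - (1 / 2) *\<^sub>R (block_grad U i (q (grid_floor h t)) + block_grad U i (q (grid_ceiling h t))))
             (at t within {0..})"
      if "t \<in> {0..} - time_grid h" for t i
    proof -
      obtain k where k: "h * real k < t" "t < h * real (Suc k)" using grid_cell[OF h] \<open>t \<in> _\<close> by auto
      have "(q has_vector_derivative sq k) (at t within {0..})" "(p has_vector_derivative sp k) (at t within {0..})"
        using q(3)[OF k] p(3)[OF k] has_vector_derivative_at_within by blast+
      from this[THEN bounded_linear.has_vector_derivative[OF bounded_linear_vec_nth[of i]]] show ?thesis
        unfolding grid_cell_values[OF h k] q(2) p(2) by (simp add: sq_def sp_def force_def)
    qed
    then show "if h = 0 then
        \<forall>t\<ge>0. \<forall>i.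
          ((\<lambda>s. q s $ i) has_vector_derivative p t $ i) (at t within {0..}) \<and>
          ((\<lambda>s. p s $ i) has_vector_derivative - block_grad U i (q t)) (at t within {0..})
      else
        \<forall>t\<in>{0..} - time_grid h. \<forall>i.
          ((\<lambda>s. q s $ i) has_vector_derivative
             p (grid_floor h t) $ i - (h / 2) *\<^sub>R block_grad U i (q (grid_floor h t)))
             (at t within {0..}) \<and>
          ((\<lambda>s. p s $ i) has_vector_derivative
             - (1 / 2) *\<^sub>R (block_grad U i (q (grid_floor h t)) + block_grad U i (q (grid_ceiling h t))))
             (at t within {0..})" using h by auto
  qed (use q p in auto)
  then show ?thesis by (rule that)
qed

text \<open>Conversely, a continuous solution is linear on every grid cell, and its values at the grid points
  obey the Verlet recursion. In particular the flow is well defined at these times.\<close>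

lemma grid_dynamics_eq_verlet:
  assumes h: "0 < h" and sol: "hmc_solution U h x v q p"
  shows "(q (h * real k), p (h * real k)) = verlet (force U) h k (x, v)"
proof (induction k)
  case 0 then show ?case using sol by (simp add: hmc_solution_def)
next
  case (Suc k)
  let ?a = "h * real k" and ?b = "h * real (Suc k)"
  have ab: "0 \<le> ?a" "?a \<le> ?b" "?b - ?a = h" using h by (auto simp: algebra_simps)
  have cont: "continuous_on {?a..?b} q" "continuous_on {?a..?b} p"
  proof -
    have "{?a..?b} \<subseteq> {0..}" using ab(1) by auto
    then show "continuous_on {?a..?b} q" "continuous_on {?a..?b} p"
      using sol unfolding hmc_solution_def by (blast intro: continuous_on_subset)+
  qed
  have d: "((\<lambda>s. q s $ i) has_vector_derivative p ?a $ i - (h / 2) *\<^sub>R block_grad U i (q ?a)) (at t within {?a..?b})"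
      "((\<lambda>s. p s $ i) has_vector_derivative - (1 / 2) *\<^sub>R (block_grad U i (q ?a) + block_grad U i (q ?b))) (at t within {?a..?b})"
    if t: "?a < t" "t < ?b" for t i
  proof -
    note cell = grid_cell_values[OF h t]
    have "t \<in> {0..} - time_grid h" "{?a..?b} \<subseteq> {0..}" using cell(1) t ab(1) by auto
    moreover have "\<forall>t\<in>{0..} - time_grid h. \<forall>i.
          ((\<lambda>s. q s $ i) has_vector_derivative
             p (grid_floor h t) $ i - (h / 2) *\<^sub>R block_grad U i (q (grid_floor h t)))
             (at t within {0..}) \<and>
          ((\<lambda>s. p s $ i) has_vector_derivative
             - (1 / 2) *\<^sub>R (block_grad U i (q (grid_floor h t)) + block_grad U i (q (grid_ceiling h t))))
             (at t within {0..})" using sol h by (simp add: hmc_solution_def)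
    ultimately show
      "((\<lambda>s. q s $ i) has_vector_derivative p ?a $ i - (h / 2) *\<^sub>R block_grad U i (q ?a)) (at t within {?a..?b})"
      "((\<lambda>s. p s $ i) has_vector_derivative - (1 / 2) *\<^sub>R (block_grad U i (q ?a) + block_grad U i (q ?b))) (at t within {?a..?b})"
      unfolding cell(2,3)[symmetric] by (blast intro: has_vector_derivative_within_subset)+
  qed
  have q1: "q ?b $ i = q ?a $ i + h *\<^sub>R (p ?a $ i - (h / 2) *\<^sub>R block_grad U i (q ?a))" for i
    using linear_on_interval[OF ab(2) _ d(1)[of _ i]] cont unfolding ab(3) by (auto intro: continuous_intros)
  have p1: "p ?b $ i = p ?a $ i + h *\<^sub>R (- (1 / 2) *\<^sub>R (block_grad U i (q ?a) + block_grad U i (q ?b)))" for i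
    using linear_on_interval[OF ab(2) _ d(2)[of _ i]] cont unfolding ab(3) by (auto intro: continuous_intros)
  have Q: "q ?b = q ?a + h *\<^sub>R p ?a - (h\<^sup>2 / 2) *\<^sub>R force U (q ?a)"
    unfolding vec_eq_iff[of "q ?b"] q1 by (simp add: force_def algebra_simps power2_eq_square)
  have P: "p ?b = p ?a - (h / 2) *\<^sub>R (force U (q ?a) + force U (q ?b))"
    unfolding vec_eq_iff[of "p ?b"] p1 by (simp add: force_def algebra_simps)
  have "verlet (force U) h (Suc k) (x, v) = verlet_step (force U) h (q ?a, p ?a)"
    by (simp add: Suc.IH)
  also have "\<dots> = (q ?b, p ?b)" by (simp only: verlet_step_def Let_def prod.case Q[symmetric] P[symmetric])
  finally show ?case by simp
qed

lemma hmc_flow_eq_verlet: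
  assumes h: "0 < h"
  shows "hmc_flow U h (h * real N) x v = verlet (force U) h N (x, v)"
  unfolding hmc_flow_def
proof (rule the_equality)
  obtain q p where "hmc_solution U h x v q p" by (rule verlet_solves_grid_dynamics[OF h])
  then show "\<exists>q p. hmc_solution U h x v q p \<and> verlet (force U) h N (x, v) = (q (h * real N), p (h * real N))"
    using grid_dynamics_eq_verlet[OF h] by metis
qed (metis grid_dynamics_eq_verlet[OF h])

text \<open>Every solution of the Hamiltonian equations is the limit of the Verlet scheme. Therefore the exact
  flow is unique, and all estimates for the Verlet scheme carry over to it.\<close>

lemma hmc_flow_eq_lim_verlet:
  fixes U :: "real^'d^'n \<Rightarrow> real"
  assumes lip: "\<And>x y. norm (force U x - force U y) \<le> C * norm (x - y)" and C: "0 \<le> C" and T: "0 < T"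
  shows "(\<lambda>N. verlet (force U) (T / real N) N (x, v)) \<longlonglongrightarrow> hmc_flow U 0 T x v"
proof -
  have conv: "(\<lambda>N. verlet (force U) (T / real N) N (x, v)) \<longlonglongrightarrow> (q T, p T)" if sol: "hmc_solution U 0 x v q p" for q p
  proof -
    have sol': "((\<lambda>s. q s $ i) has_vector_derivative p t $ i) (at t within {0..})"
        "((\<lambda>s. p s $ i) has_vector_derivative (- force U (q t)) $ i) (at t within {0..})"
      if "0 \<le> t" for t i
      using sol that by (auto simp: hmc_solution_def force_def)
    have "(q has_vector_derivative p t) (at t within {0..})" "(p has_vector_derivative - force U (q t)) (at t within {0..})"
      if "0 \<le> t" for t
      by (rule has_vector_derivative_componentwise_vec, rule sol', rule that)+
    from verlet_tendsto_hamiltonian_flow[OF lip C T this] show ?thesis using sol by (simp add: hmc_solution_def)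
  qed
  define F where "F z = (snd z, - force U (fst z))" for z :: "(real^'d^'n) \<times> (real^'d^'n)"
  have F_lip: "norm (F z - F z') \<le> (1 + C) * norm (z - z')" for z z'
  proof -
    have "norm (F z - F z') \<le> norm (snd (z - z')) + norm (force U (fst z) - force U (fst z'))"
      unfolding F_def by (simp add: norm_Pair_le order_trans[OF norm_Pair_le] norm_minus_commute)
    also have "\<dots> \<le> norm (z - z') + C * norm (z - z')"
    proof (rule add_mono)
      show "norm (snd (z - z')) \<le> norm (z - z')"
        using norm_snd_le[of "snd (z - z')" "fst (z - z')"] by (simp add: minus_prod_def)
      have "norm (fst z - fst z') \<le> norm (z - z')"
        using norm_fst_le[of "fst (z - z')" "snd (z - z')"] by (simp add: minus_prod_def)
      then show "norm (force U (fst z) - force U (fst z')) \<le> C * norm (z - z')"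
        using lip[of "fst z" "fst z'"] C by (meson mult_left_mono order_trans)
    qed
    finally show ?thesis by (simp add: algebra_simps)
  qed
  obtain y where y: "y 0 = (x, v)" "continuous_on {0..} y"
    "\<And>t. 0 \<le> t \<Longrightarrow> (y has_vector_derivative F (y t)) (at t within {0..})"
    using lipschitz_ode_global_solution[OF F_lip, of "(x, v)"] C by auto
  have "((\<lambda>s. fst (y s)) has_vector_derivative snd (y t)) (at t within {0..})"
    "((\<lambda>s. snd (y s)) has_vector_derivative - force U (fst (y t))) (at t within {0..})" if "0 \<le> t" for t
    using bounded_linear.has_vector_derivative[OF bounded_linear_fst y(3)[OF that]]
      bounded_linear.has_vector_derivative[OF bounded_linear_snd y(3)[OF that]] by (simp_all add: F_def)
  from this[THEN bounded_linear.has_vector_derivative[OF bounded_linear_vec_nth]]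
  have ex: "hmc_solution U 0 x v (\<lambda>t. fst (y t)) (\<lambda>t. snd (y t))"
    unfolding hmc_solution_def using y(1,2) by (auto simp: force_def intro!: continuous_intros)
  have "hmc_flow U 0 T x v = (fst (y T), snd (y T))"
    unfolding hmc_flow_def
    by (rule the_equality) (use ex conv[OF ex] conv LIMSEQ_unique in blast)+
  then show ?thesis using conv[OF ex] by simp
qed

section \<open>The forces of the mean-field potential\<close>

lemma GDERIV_unique:
  assumes "GDERIV f x :> D" "GDERIV f x :> E"
  shows "D = E"
proof -
  have "(\<lambda>h. h \<bullet> D) = (\<lambda>h. h \<bullet> E)"
    using assms unfolding gderiv_def by (rule has_derivative_unique)
  from fun_cong[OF this, of "D - E"] have "(D - E) \<bullet> (D - E) = 0" by (simp add: inner_diff_right)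
  then show ?thesis by simp
qed

lemma grad_eq: "GDERIV f x :> D \<Longrightarrow> grad f x = D"
  unfolding grad_def by (rule the_equality) (auto intro: GDERIV_unique)

lemma GDERIV_grad:
  fixes f :: "'a::euclidean_space \<Rightarrow> real"
  assumes "f differentiable (at x)"
  shows "GDERIV f x :> grad f x"
proof -
  obtain f' where f': "(f has_derivative f') (at x)" using assms by (auto simp: differentiable_def)
  then have lin: "linear f'" by (rule has_derivative_linear)
  have "f' h = h \<bullet> (\<Sum>b\<in>Basis. f' b *\<^sub>R b)" for h
  proof -
    have "f' h = f' (\<Sum>b\<in>Basis. (h \<bullet> b) *\<^sub>R b)" by (simp add: euclidean_representation)
    also have "\<dots> = (\<Sum>b\<in>Basis. (h \<bullet> b) * f' b)"
      using lin by (simp add: linear_sum linear_cmul)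
    finally show ?thesis by (simp add: inner_sum_right mult.commute)
  qed
  then have "f' = (\<lambda>h. h \<bullet> (\<Sum>b\<in>Basis. f' b *\<^sub>R b))" by (rule ext)
  then have "GDERIV f x :> (\<Sum>b\<in>Basis. f' b *\<^sub>R b)" unfolding gderiv_def using f' by simp
  then show ?thesis by (simp add: grad_eq)
qed

lemma grad_lipschitz:
  fixes f :: "real^'d \<Rightarrow> real"
  assumes C2: "twice_cont_differentiable f" and bdd: "bdd_above (range (hess_norm f))"
  shows "norm (grad f x - grad f y) \<le> (SUP x. hess_norm f x) * norm (x - y)"
proof (rule differentiable_bound[where S = UNIV and f' = "\<lambda>x h. hessian f x *v h"])
  show "(grad f has_derivative (*v) (hessian f z)) (at z)" for z
    using C2 unfolding twice_cont_differentiable_def hessian_def by (subst jacobian_works[symmetric]) auto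
  show "onorm ((*v) (hessian f z)) \<le> (SUP x. hess_norm f x)" for z
    using cSUP_upper[OF _ bdd, of z] by (simp add: hess_norm_def)
qed auto

lemma hess_norm_Sup_nonneg:
  assumes bdd: "bdd_above (range (hess_norm f))"
  shows "0 \<le> (SUP x. hess_norm f x)"
proof -
  have "0 \<le> hess_norm f 0" unfolding hess_norm_def
    by (rule onorm_pos_le) (simp add: matrix_vector_mul_bounded_linear)
  also have "\<dots> \<le> (SUP x. hess_norm f x)" using bdd by (intro cSUP_upper) auto
  finally show ?thesis .
qed

text \<open>The position of the \<open>i\<close>-th particle occurs in its own interaction term and, with the opposite sign,
  in those of all other particles. As \<open>W\<close> need not be even, this gives two different gradients.\<close>

lemma mf_force:
  fixes V W :: "real^'d \<Rightarrow> real" and x :: "real^'d^'n"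
  assumes V: "\<And>y. V differentiable (at y)" and W: "\<And>y. W differentiable (at y)"
  shows "force (mf_potential V W \<epsilon>) x $ i = grad V (x $ i) + (\<epsilon> / real CARD('n)) *\<^sub>R
     (\<Sum>j\<in>UNIV - {i}. grad W (x $ i - x $ j) - grad W (x $ j - x $ i))"
proof -
  define u where "u k y = (if k = i then y else x $ k)" for k :: 'n and y :: "real^'d"
  define du where "du k h = (if k = i then h else 0)" for k :: 'n and h :: "real^'d"
  have u: "(u k has_derivative du k) (at y)" for k y
    by (cases "k = i") (simp_all add: u_def[abs_def] du_def[abs_def])
  have ux: "u k (x $ i) = x $ k" for k by (simp add: u_def)
  have du_inner: "du k h \<bullet> v = (if k = i then h \<bullet> v else 0)" for k h v by (simp add: du_def)
  have Vu: "((\<lambda>y. V (u k y)) has_derivative (\<lambda>h. du k h \<bullet> grad V (x $ k))) (at (x $ i))" for k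
    using has_derivative_compose[OF u GDERIV_grad[OF V, unfolded gderiv_def], of k "x $ i"] by (simp add: ux)
  have Wu: "((\<lambda>y. W (u k y - u j y)) has_derivative (\<lambda>h. (du k h - du j h) \<bullet> grad W (x $ k - x $ j))) (at (x $ i))" for k j
    using has_derivative_compose[OF has_derivative_diff[OF u u] GDERIV_grad[OF W, unfolded gderiv_def], of k j "x $ i"] by (simp add: ux)
  define D where "D = grad V (x $ i) + (\<epsilon> / real CARD('n)) *\<^sub>R
     (\<Sum>j\<in>UNIV - {i}. grad W (x $ i - x $ j) - grad W (x $ j - x $ i))"
  have "((\<lambda>y. mf_potential V W \<epsilon> (\<chi> k. u k y)) has_derivative
      (\<lambda>h. \<Sum>k\<in>UNIV. du k h \<bullet> grad V (x $ k) + \<epsilon> / real CARD('n) *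
        (\<Sum>j\<in>UNIV - {k}. (du k h - du j h) \<bullet> grad W (x $ k - x $ j)))) (at (x $ i))"
    unfolding mf_potential_def vec_lambda_beta
    by (intro has_derivative_sum has_derivative_add has_derivative_mult_right Vu Wu)
  also have "(\<lambda>h. \<Sum>k\<in>UNIV. du k h \<bullet> grad V (x $ k) + \<epsilon> / real CARD('n) *
        (\<Sum>j\<in>UNIV - {k}. (du k h - du j h) \<bullet> grad W (x $ k - x $ j))) = (\<lambda>h. h \<bullet> D)"
  proof
    fix h
    have 1: "(\<Sum>k\<in>UNIV. du k h \<bullet> grad V (x $ k)) = h \<bullet> grad V (x $ i)"
      by (simp add: du_inner)
    have 2: "(\<Sum>k\<in>UNIV. \<Sum>j\<in>UNIV - {k}. du k h \<bullet> grad W (x $ k - x $ j))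
        = (\<Sum>j\<in>UNIV - {i}. h \<bullet> grad W (x $ i - x $ j))"
    proof -
      have "(\<Sum>j\<in>UNIV - {k}. du k h \<bullet> grad W (x $ k - x $ j))
          = (if k = i then \<Sum>j\<in>UNIV - {i}. h \<bullet> grad W (x $ i - x $ j) else 0)" for k
        by (auto simp: du_inner)
      then show ?thesis by (simp add: sum.delta)
    qed
    have 3: "(\<Sum>k\<in>UNIV. \<Sum>j\<in>UNIV - {k}. du j h \<bullet> grad W (x $ k - x $ j))
        = (\<Sum>k\<in>UNIV - {i}. h \<bullet> grad W (x $ k - x $ i))"
    proof -
      have "(\<Sum>j\<in>UNIV - {k}. du j h \<bullet> grad W (x $ k - x $ j)) = (if k \<noteq> i then h \<bullet> grad W (x $ k - x $ i) else 0)" for k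
        by (auto simp: du_inner)
      moreover have "(\<Sum>k\<in>UNIV. if k \<noteq> i then h \<bullet> grad W (x $ k - x $ i) else 0) = (\<Sum>k\<in>UNIV - {i}. h \<bullet> grad W (x $ k - x $ i))"
        by (rule sum.mono_neutral_cong_right) auto
      ultimately show ?thesis by simp
    qed
    show "(\<Sum>k\<in>UNIV. du k h \<bullet> grad V (x $ k) + \<epsilon> / real CARD('n) *
        (\<Sum>j\<in>UNIV - {k}. (du k h - du j h) \<bullet> grad W (x $ k - x $ j))) = h \<bullet> D"
      by (simp only: sum.distrib 1 sum_distrib_left[symmetric] inner_diff_left sum_subtractf 2 3 D_def
          inner_add_right inner_scaleR_right inner_sum_right inner_diff_right)
  qed
  finally have "GDERIV (\<lambda>y. mf_potential V W \<epsilon> (\<chi> k. u k y)) (x $ i) :> D" by (simp add: gderiv_def)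
  then show ?thesis unfolding force_def block_grad_def by (simp add: grad_eq D_def u_def)
qed

lemma mf_force_interaction:
  fixes V W :: "real^'d \<Rightarrow> real" and x y :: "real^'d^'n"
  assumes V: "\<And>y. V differentiable (at y)" and W: "\<And>y. W differentiable (at y)"
    and lip: "\<And>u v. norm (grad W u - grad W v) \<le> L' * norm (u - v)" and \<epsilon>: "0 \<le> \<epsilon>" and L': "0 \<le> L'"
  defines "F \<equiv> force (mf_potential V W \<epsilon>)"
  shows "norm ((F x $ i - F y $ i) - (grad V (x $ i) - grad V (y $ i)))
      \<le> 2 * (\<epsilon> * L') * norm (x $ i - y $ i) + 2 * (\<epsilon> * L') / real CARD('n) * (\<Sum>j\<in>UNIV. norm (x $ j - y $ j))"
proof -
  define z where "z j = norm (x $ j - y $ j)" for j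
  let ?n = "real CARD('n)"
  let ?d = "\<lambda>j. (grad W (x $ i - x $ j) - grad W (x $ j - x $ i)) - (grad W (y $ i - y $ j) - grad W (y $ j - y $ i))"
  have d: "norm (?d j) \<le> 2 * L' * (z i + z j)" for j
  proof -
    have n1: "norm ((x $ i - x $ j) - (y $ i - y $ j)) \<le> z i + z j"
      unfolding z_def by (rule order_trans[OF _ norm_triangle_ineq4]) (simp add: algebra_simps)
    have n2: "norm ((x $ j - x $ i) - (y $ j - y $ i)) \<le> z i + z j"
    proof -
      have "(x $ j - x $ i) - (y $ j - y $ i) = - ((x $ i - x $ j) - (y $ i - y $ j))" by simp
      then show ?thesis using n1 by (simp only: norm_minus_cancel)
    qed
    have 1: "norm (grad W (x $ i - x $ j) - grad W (y $ i - y $ j)) \<le> L' * (z i + z j)"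
      using lip n1 L' by (meson mult_left_mono order_trans)
    have 2: "norm (grad W (x $ j - x $ i) - grad W (y $ j - y $ i)) \<le> L' * (z i + z j)"
      using lip n2 L' by (meson mult_left_mono order_trans)
    have "?d j = (grad W (x $ i - x $ j) - grad W (y $ i - y $ j)) - (grad W (x $ j - x $ i) - grad W (y $ j - y $ i))"
      by simp
    also have "norm \<dots> \<le> L' * (z i + z j) + L' * (z i + z j)"
      by (rule order_trans[OF norm_triangle_ineq4 add_mono[OF 1 2]])
    finally show ?thesis by simp
  qed
  have "(F x $ i - F y $ i) - (grad V (x $ i) - grad V (y $ i)) = (\<epsilon> / ?n) *\<^sub>R (\<Sum>j\<in>UNIV - {i}. ?d j)"
    unfolding F_def mf_force[OF V W]
    by (subst (3) sum_subtractf) (simp only: scaleR_diff_right add_diff_add add_diff_cancel_left' add_diff_cancel)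
  also have "norm \<dots> \<le> \<epsilon> / ?n * (\<Sum>j\<in>UNIV. 2 * L' * (z i + z j))"
  proof -
    have "norm (\<Sum>j\<in>UNIV - {i}. ?d j) \<le> (\<Sum>j\<in>UNIV - {i}. 2 * L' * (z i + z j))" using d by (rule sum_norm_le)
    also have "\<dots> \<le> (\<Sum>j\<in>UNIV. 2 * L' * (z i + z j))"
      using L' by (intro sum_mono2) (auto simp: z_def)
    finally show ?thesis using \<epsilon> by (auto intro!: mult_left_mono divide_right_mono)
  qed
  also have "\<dots> = 2 * (\<epsilon> * L') * z i + 2 * (\<epsilon> * L') / ?n * (\<Sum>j\<in>UNIV. z j)"
    unfolding sum_distrib_left[symmetric] sum.distrib sum_constant by (simp add: field_simps)
  finally show ?thesis by (simp add: z_def)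
qed

lemma norm_vec_le_sum: "norm (x :: 'a::real_normed_vector^'n) \<le> (\<Sum>i\<in>UNIV. norm (x $ i))"
  unfolding norm_vec_def by (rule L2_set_le_sum) simp

context mean_field_force
begin

lemma force_lipschitz:
  obtains C where "0 \<le> C" "\<And>x y. norm (b x - b y) \<le> C * norm (x - y)"
proof (rule that)
  let ?n = "real CARD('n)"
  show "0 \<le> (L + 4 * l) * ?n" using K l by simp
  fix x y
  have "norm (b x - b y) \<le> (\<Sum>i\<in>UNIV. norm (b x $ i - b y $ i))"
    using norm_vec_le_sum[of "b x - b y"] by simp
  also have "\<dots> \<le> (\<Sum>i\<in>(UNIV::'n set). (L + 4 * l) * norm (x - y))"
  proof (rule sum_mono)
    fix i
    have z: "norm (x $ j - y $ j) \<le> norm (x - y)" for j using Finite_Cartesian_Product.norm_nth_le[of "x - y" j] by simp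
    have "(\<Sum>j\<in>UNIV. norm (x $ j - y $ j)) \<le> ?n * norm (x - y)"
      using sum_bounded_above[of UNIV "\<lambda>j. norm (x $ j - y $ j)"] z by simp
    then have "2 * l / ?n * (\<Sum>j\<in>UNIV. norm (x $ j - y $ j)) \<le> 2 * l / ?n * (?n * norm (x - y))"
      using l by (intro mult_left_mono) auto
    moreover have "(L + 2 * l) * norm (x $ i - y $ i) \<le> (L + 2 * l) * norm (x - y)"
      using z K l by (intro mult_left_mono) auto
    ultimately show "norm (b x $ i - b y $ i) \<le> (L + 4 * l) * norm (x - y)"
      using force_lip[of x i y] by (simp add: algebra_simps)
  qed
  also have "\<dots> = (L + 4 * l) * ?n * norm (x - y)" by simp
  finally show "norm (b x - b y) \<le> (L + 4 * l) * ?n * norm (x - y)" .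
qed

end

definition hmc_position :: "(real^'d^'n \<Rightarrow> real) \<Rightarrow> real \<Rightarrow> real \<Rightarrow> real^'d^'n \<Rightarrow> real^'d^'n \<Rightarrow> real^'d^'n" where
  "hmc_position U T h x \<xi> = fst (hmc_flow U h T x \<xi>)"

text \<open>The two estimates that the contraction proof needs: positions at time \<open>T\<close> are close to those
  of the free motion, and particles at a large distance that start with equal velocities approach each
  other. They hold for every step size, and for the exact flow by passing to the limit.\<close>

lemma (in mean_field_force) hmc_position_estimates:
  assumes b: "b = force U" and h: "0 \<le> h" "h = 0 \<or> T / h \<in> \<nat>"
  defines "a \<equiv> \<lambda>x y \<xi> \<eta> i. free_reach T ((x - y) $ i) ((\<xi> - \<eta>) $ i)"
    and "X \<equiv> \<lambda>x y \<xi> \<eta>. interaction l T (x - y) (\<xi> - \<eta>)"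
  shows hmc_free_motion: "norm (hmc_position U T h x \<xi> $ i - hmc_position U T h y \<eta> $ i - (x $ i - y $ i) - T *\<^sub>R (\<xi> $ i - \<eta> $ i))
      \<le> 29 / 50 * (L * T\<^sup>2) * a x y \<xi> \<eta> i + 8 / 7 * X x y \<xi> \<eta>" (is "?free x \<xi> y \<eta> i")
    and hmc_contraction: "R' \<le> norm (x $ i - y $ i) \<Longrightarrow> \<xi> $ i = \<eta> $ i \<Longrightarrow>
      norm (hmc_position U T h x \<xi> $ i - hmc_position U T h y \<eta> $ i)
        \<le> (1 - K * T\<^sup>2 / 4) * norm (x $ i - y $ i) + 3 * X x y \<xi> \<eta>"
proof -
  define Q where "Q N x \<xi> = fst (verlet b (T / real N) N (x, \<xi>))" for N and x \<xi> :: "real^'d^'n"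
  have Q: "norm (Q N x \<xi> $ i - Q N y \<eta> $ i - (x $ i - y $ i) - T *\<^sub>R (\<xi> $ i - \<eta> $ i))
      \<le> 29 / 50 * (L * T\<^sup>2) * a x y \<xi> \<eta> i + 8 / 7 * X x y \<xi> \<eta>"
    "R' \<le> norm (x $ i - y $ i) \<Longrightarrow> \<xi> $ i = \<eta> $ i \<Longrightarrow>
      norm (Q N x \<xi> $ i - Q N y \<eta> $ i) \<le> (1 - K * T\<^sup>2 / 4) * norm (x $ i - y $ i) + 3 * X x y \<xi> \<eta>"
    if N: "0 < N" for N x \<xi> y \<eta> i
  proof -
    have hN: "0 \<le> T / real N" "T / real N * real N = T" using N T by auto
    show "norm (Q N x \<xi> $ i - Q N y \<eta> $ i - (x $ i - y $ i) - T *\<^sub>R (\<xi> $ i - \<eta> $ i))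
      \<le> 29 / 50 * (L * T\<^sup>2) * a x y \<xi> \<eta> i + 8 / 7 * X x y \<xi> \<eta>"
      unfolding Q_def a_def X_def
      by (rule verlet_free_motion[OF hN, of "\<lambda>k. fst (verlet b (T / real N) k (x, \<xi>))" x \<xi>
          "\<lambda>k. fst (verlet b (T / real N) k (y, \<eta>))" y \<eta> "\<lambda>i. free_reach T ((x - y) $ i) ((\<xi> - \<eta>) $ i)"]) simp_all
    show "norm (Q N x \<xi> $ i - Q N y \<eta> $ i) \<le> (1 - K * T\<^sup>2 / 4) * norm (x $ i - y $ i) + 3 * X x y \<xi> \<eta>"
      if "R' \<le> norm (x $ i - y $ i)" "\<xi> $ i = \<eta> $ i"
      unfolding Q_def X_def
      by (rule verlet_contraction[OF hN, of "\<lambda>k. fst (verlet b (T / real N) k (x, \<xi>))" x \<xi>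
          "\<lambda>k. fst (verlet b (T / real N) k (y, \<eta>))" y \<eta> "\<lambda>i. free_reach T ((x - y) $ i) ((\<xi> - \<eta>) $ i)"])
        (use that in simp_all)
  qed
  have "?free x \<xi> y \<eta> i \<and> (R' \<le> norm (x $ i - y $ i) \<longrightarrow> \<xi> $ i = \<eta> $ i \<longrightarrow>
      norm (hmc_position U T h x \<xi> $ i - hmc_position U T h y \<eta> $ i)
        \<le> (1 - K * T\<^sup>2 / 4) * norm (x $ i - y $ i) + 3 * X x y \<xi> \<eta>)"
  proof -
    consider "h = 0" | "0 < h" "T / h \<in> \<nat>" using h by force
    then show ?thesis
    proof cases
      case 1
      obtain C where C: "0 \<le> C" "\<And>x y. norm (b x - b y) \<le> C * norm (x - y)" using force_lipschitz by blast
      have lim: "(\<lambda>N. Q N x \<xi>) \<longlonglongrightarrow> hmc_position U T h x \<xi>" for x \<xi>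
        unfolding Q_def hmc_position_def 1 b
        by (intro tendsto_fst hmc_flow_eq_lim_verlet[OF C(2)[unfolded b] C(1) T])
      have ev: "\<forall>\<^sub>F N in sequentially. 0 < N" by (rule eventually_gt_at_top)
      show ?thesis
      proof (intro conjI impI)
        show "?free x \<xi> y \<eta> i"
          by (rule tendsto_upperbound[where F = sequentially and
                f = "\<lambda>N. norm (Q N x \<xi> $ i - Q N y \<eta> $ i - (x $ i - y $ i) - T *\<^sub>R (\<xi> $ i - \<eta> $ i))"],
              intro tendsto_intros lim) (use Q(1) in \<open>auto intro: eventually_mono[OF ev]\<close>)
        assume *: "R' \<le> norm (x $ i - y $ i)" "\<xi> $ i = \<eta> $ i"
        show "norm (hmc_position U T h x \<xi> $ i - hmc_position U T h y \<eta> $ i)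
            \<le> (1 - K * T\<^sup>2 / 4) * norm (x $ i - y $ i) + 3 * X x y \<xi> \<eta>"
          by (rule tendsto_upperbound[where F = sequentially and f = "\<lambda>N. norm (Q N x \<xi> $ i - Q N y \<eta> $ i)"],
              intro tendsto_intros lim) (use Q(2)[OF _ *] in \<open>auto intro: eventually_mono[OF ev]\<close>)
      qed
    next
      case 2
      then obtain N where N: "T / h = real N" by (auto simp: Nats_def)
      then have N': "0 < N" "T = h * real N" "T / real N = h" using 2 T by (auto simp: field_simps intro: Nat.gr0I)
      have "hmc_position U T h x \<xi> = Q N x \<xi>" for x \<xi>
        unfolding hmc_position_def Q_def N'(3) b hmc_flow_eq_verlet[OF 2(1), symmetric] N'(2)[symmetric] ..
      then show ?thesis using Q[OF N'(1)] by simp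
    qed
  qed
  then show "?free x \<xi> y \<eta> i" and "R' \<le> norm (x $ i - y $ i) \<Longrightarrow> \<xi> $ i = \<eta> $ i \<Longrightarrow>
      norm (hmc_position U T h x \<xi> $ i - hmc_position U T h y \<eta> $ i)
        \<le> (1 - K * T\<^sup>2 / 4) * norm (x $ i - y $ i) + 3 * X x y \<xi> \<eta>" by blast+
qed

section \<open>The smallness of the parameters\<close>

lemma ereal_bound_le:
  assumes "ereal x \<le> ereal (3 / 5) * m" "m \<le> ereal y"
  shows "x \<le> 3 / 5 * y"
proof -
  have "ereal x \<le> ereal (3 / 5) * ereal y" using assms by (meson ereal_mult_left_mono order_trans ereal_less_eq(5) divide_nonneg_nonneg zero_le_numeral)
  then show ?thesis by simp
qed

text \<open>The conditions on \<open>T\<close> and \<open>\<epsilon>\<close> in the form in which they are used. The definition of \<open>R'\<close> gives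
  \<open>K R'\<^sup>2 / 64 = (L + K) R\<^sup>2\<close>, which dominates the possible failure of convexity at distances below \<open>R\<close>;
  and the factor \<open>(R' + T)\<^sup>2\<close> in the bound for \<open>\<epsilon>\<close> is absorbed by a part of the exponential.\<close>

lemma parameter_bounds:
  fixes V :: "real^'d \<Rightarrow> real"
  assumes K: "0 < K" and R: "0 \<le> R" and T: "0 < T" and h1: "0 \<le> h1" and l: "0 \<le> l"
    and lip: "\<And>x y. norm (grad V x - grad V y) \<le> L * norm (x - y)"
    and conv: "\<forall>x y. R \<le> norm (x - y) \<longrightarrow> K * (norm (x - y))\<^sup>2 \<le> (x - y) \<bullet> (grad V x - grad V y)"
    and R'_eq: "R' = 8 * R * sqrt ((L + K) / K)"
    and T_bound: "ereal (L * (T + h1)\<^sup>2) \<le>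
           ereal (3 / 5) * min (ereal (1 / 4))
             (min (ereal (3 * K) / ereal (10 * L)) (ereal 3 / ereal (256 * 5 * L * R'\<^sup>2)))"
    and l_bound: "l < min (K / 6) (1 / 2 * (K * (R' + T) / (36 * 149))\<^sup>2 * exp (- (5 * (R' / T))))"
  shows "K \<le> L" "L * T\<^sup>2 \<le> 3 / 20" "L\<^sup>2 * T\<^sup>2 \<le> 18 / 100 * K" "0 \<le> R'" "L * T * R' \<le> 3 / 80"
    "l \<le> K / 10 ^ 8 * exp (- (3 * (R' / T)))"
    "K * (norm (u - v))\<^sup>2 - K * R'\<^sup>2 / 64 \<le> (u - v) \<bullet> (grad V u - grad V v)"
proof -
  have CS: "\<bar>(x - y) \<bullet> (grad V x - grad V y)\<bar> \<le> L * (norm (x - y))\<^sup>2" for x y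
  proof -
    have "\<bar>(x - y) \<bullet> (grad V x - grad V y)\<bar> \<le> norm (x - y) * norm (grad V x - grad V y)"
      by (rule Cauchy_Schwarz_ineq2)
    also have "\<dots> \<le> norm (x - y) * (L * norm (x - y))" using lip by (intro mult_left_mono) auto
    finally show ?thesis by (simp add: power2_eq_square mult_ac)
  qed
  show KL: "K \<le> L"
  proof -
    obtain x :: "real^'d" where x: "norm x = R + 1" using vector_choose_size[of "R + 1"] R by auto
    have "K * (norm (x - 0))\<^sup>2 \<le> L * (norm (x - 0))\<^sup>2"
      using conv[rule_format, of x 0] CS[of x 0] x by simp
    then show ?thesis using x R by simp
  qed
  have L: "0 < L" using K KL by simp
  show R'0: "0 \<le> R'" using R K L by (simp add: R'_eq)
  have LT: "L * T\<^sup>2 \<le> L * (T + h1)\<^sup>2" using L T h1 by (intro mult_left_mono power_mono) auto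
  show LT1: "L * T\<^sup>2 \<le> 3 / 20"
    using ereal_bound_le[OF T_bound, of "1 / 4"] LT by simp
  show "L\<^sup>2 * T\<^sup>2 \<le> 18 / 100 * K"
  proof -
    have "L * (T + h1)\<^sup>2 \<le> 3 / 5 * (3 * K / (10 * L))"
      using L by (intro ereal_bound_le[OF T_bound]) (simp add: min_le_iff_disj)
    then have "L * (L * T\<^sup>2) \<le> L * (3 / 5 * (3 * K / (10 * L)))"
      using order_trans[OF LT] L by (intro mult_left_mono) auto
    then show ?thesis using L by (simp add: power2_eq_square mult.assoc)
  qed
  show "L * T * R' \<le> 3 / 80"
  proof (cases "R' = 0")
    case False
    then have R'1: "0 < R'" using R'0 by simp
    have "L * (T + h1)\<^sup>2 \<le> 3 / 5 * (3 / (256 * 5 * L * R'\<^sup>2))"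
      using L R'1 by (intro ereal_bound_le[OF T_bound]) (simp add: min_le_iff_disj)
    then have "(L * R'\<^sup>2) * (L * T\<^sup>2) \<le> (L * R'\<^sup>2) * (3 / 5 * (3 / (256 * 5 * L * R'\<^sup>2)))"
      using order_trans[OF LT] L by (intro mult_left_mono) auto
    also have "\<dots> = (3 / 80)\<^sup>2" using L R'1 by (simp add: power2_eq_square)
    finally have "(L * T * R')\<^sup>2 \<le> (3 / 80)\<^sup>2" by (simp add: power2_eq_square mult_ac)
    then show ?thesis by (rule power2_le_imp_le) simp
  qed simp
  show "l \<le> K / 10 ^ 8 * exp (- (3 * (R' / T)))"
  proof -
    define s where "s = R' / T"
    have s: "0 \<le> s" "R' = s * T" using T R'0 by (auto simp: s_def)
    have "K * T\<^sup>2 \<le> 3 / 20" using LT1 KL by (smt (verit) mult_right_mono zero_le_power2)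
    have "R' + T \<le> T * exp s"
      using mult_left_mono[OF exp_ge_add_one_self[of s], of T] T by (simp add: s algebra_simps)
    then have "(R' + T)\<^sup>2 \<le> (T * exp s)\<^sup>2" using R'0 T by (intro power_mono) auto
    also have "\<dots> = T\<^sup>2 * exp (2 * s)" by (simp add: power_mult_distrib exp_double)
    finally have sq: "(R' + T)\<^sup>2 \<le> T\<^sup>2 * exp (2 * s)" .
    have "l \<le> 1 / 2 * (K * (R' + T) / (36 * 149))\<^sup>2 * exp (- (5 * s))"
      using l_bound by (simp add: s_def)
    also have "\<dots> = K\<^sup>2 / (2 * 5364\<^sup>2) * ((R' + T)\<^sup>2 * exp (- (5 * s)))"
      by (simp add: power_divide power_mult_distrib)
    also have "\<dots> \<le> K\<^sup>2 / (2 * 5364\<^sup>2) * (T\<^sup>2 * exp (2 * s) * exp (- (5 * s)))"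
      using sq by (intro mult_left_mono mult_right_mono) auto
    also have "\<dots> = K * (K * T\<^sup>2 / (2 * 5364\<^sup>2)) * exp (- (3 * s))"
      by (simp add: power2_eq_square exp_add[symmetric] mult.assoc)
    also have "\<dots> \<le> K * (1 / 10 ^ 8) * exp (- (3 * s))"
      using \<open>K * T\<^sup>2 \<le> 3 / 20\<close> K by (intro mult_right_mono mult_left_mono) auto
    finally show ?thesis by (simp add: s_def)
  qed
  show "K * (norm (u - v))\<^sup>2 - K * R'\<^sup>2 / 64 \<le> (u - v) \<bullet> (grad V u - grad V v)"
  proof (cases "R \<le> norm (u - v)")
    case True
    have "0 \<le> K * R'\<^sup>2 / 64" using K by simp
    then show ?thesis using conv[rule_format, OF True] by linarith
  next
    case False
    have "K * R'\<^sup>2 / 64 = (L + K) * R\<^sup>2"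
      using K L by (simp add: R'_eq power_mult_distrib field_simps)
    moreover have "(L + K) * (norm (u - v))\<^sup>2 \<le> (L + K) * R\<^sup>2"
      using False K L by (intro mult_left_mono power_mono) auto
    ultimately show ?thesis using CS[of u v] unfolding distrib_right abs_le_iff by linarith
  qed
qed

section \<open>Reflections and the Gaussian distribution\<close>

definition gaussian_density :: "'a::euclidean_space \<Rightarrow> real" where
  "gaussian_density v = (\<Prod>b\<in>Basis. std_normal_density (v \<bullet> b))"

lemma gaussian_density_eq:
  "gaussian_density (v::'a::euclidean_space) = (1 / sqrt (2 * pi)) ^ DIM('a) * exp (- (norm v)\<^sup>2 / 2)"
proof -
  have "gaussian_density v = (1 / sqrt (2 * pi)) ^ DIM('a) * (\<Prod>b\<in>Basis. exp (- (v \<bullet> b)\<^sup>2 / 2))"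
    by (simp only: gaussian_density_def std_normal_density_def prod.distrib prod_constant)
  also have "(\<Prod>b\<in>Basis. exp (- (v \<bullet> b)\<^sup>2 / 2)) = exp (\<Sum>b\<in>Basis. - (v \<bullet> b)\<^sup>2 / 2)"
    by (simp only: exp_sum[OF finite_Basis])
  also have "(\<Sum>b\<in>Basis. - (v \<bullet> b)\<^sup>2 / 2) = - (\<Sum>b\<in>Basis. (v \<bullet> b)\<^sup>2) / 2"
    by (simp only: sum_negf sum_divide_distrib[symmetric])
  also have "(\<Sum>b\<in>Basis. (v \<bullet> b)\<^sup>2) = (norm v)\<^sup>2"
    unfolding power2_norm_eq_inner by (subst (2) euclidean_inner) (simp add: power2_eq_square)
  finally show ?thesis .
qed

lemma gaussian_density_nonneg: "0 \<le> gaussian_density v"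
  by (simp add: gaussian_density_def prod_nonneg)

lemma gaussian_density_measurable [measurable]: "gaussian_density \<in> borel_measurable borel"
  unfolding gaussian_density_def by measurable

lemma std_gaussian_eq: "std_gaussian = density lborel (\<lambda>v. ennreal (gaussian_density v))"
  by (simp add: std_gaussian_def gaussian_density_def)

lemma sets_std_gaussian [simp, measurable_cong]: "sets std_gaussian = sets borel"
  by (simp add: std_gaussian_def)

lemma space_std_gaussian [simp]: "space std_gaussian = UNIV"
  by (simp add: std_gaussian_def)

lemma nn_integral_std_gaussian:
  "f \<in> borel_measurable borel \<Longrightarrow> (\<integral>\<^sup>+x. f x \<partial>std_gaussian) = (\<integral>\<^sup>+x. ennreal (gaussian_density x) * f x \<partial>lborel)"
  unfolding std_gaussian_eq by (subst nn_integral_density) auto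

lemma nn_integral_std_gaussian_prod:
  assumes "\<And>b. b \<in> Basis \<Longrightarrow> f b \<in> borel_measurable borel"
  shows "(\<integral>\<^sup>+x. (\<Prod>b\<in>Basis. f b (x \<bullet> b)) \<partial>(std_gaussian :: 'a::euclidean_space measure))
    = (\<Prod>b\<in>Basis. \<integral>\<^sup>+x. f b x \<partial>std_normal_distribution)"
proof -
  have "(\<integral>\<^sup>+x. (\<Prod>b\<in>Basis. f b (x \<bullet> b)) \<partial>(std_gaussian :: 'a measure))
      = (\<integral>\<^sup>+x. (\<Prod>b\<in>Basis. ennreal (std_normal_density (x \<bullet> b)) * f b (x \<bullet> b)) \<partial>(lborel :: 'a measure))"
    using assms by (subst nn_integral_std_gaussian)
      (auto simp: gaussian_density_def prod.distrib prod_ennreal[symmetric])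
  also have "\<dots> = (\<Prod>b\<in>Basis. \<integral>\<^sup>+x. ennreal (std_normal_density x) * f b x \<partial>lborel)"
    using assms by (intro nn_integral_lborel_prod) auto
  also have "\<dots> = (\<Prod>b\<in>Basis. \<integral>\<^sup>+x. f b x \<partial>std_normal_distribution)"
    using assms by (intro prod.cong refl nn_integral_density[symmetric]) auto
  finally show ?thesis .
qed

lemma prob_space_std_normal: "prob_space std_normal_distribution"
  by (rule prob_space_normal_density) simp

lemma prob_space_std_gaussian: "prob_space (std_gaussian :: 'a::euclidean_space measure)"
proof
  have "emeasure (std_gaussian :: 'a measure) (space std_gaussian) = (\<integral>\<^sup>+x. (\<Prod>b\<in>Basis. (\<lambda>_. 1) (x \<bullet> b)) \<partial>(std_gaussian :: 'a measure))"
    by simp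
  also have "\<dots> = (\<Prod>b\<in>(Basis::'a set). \<integral>\<^sup>+x. 1 \<partial>std_normal_distribution)"
    by (rule nn_integral_std_gaussian_prod) simp
  also have "\<dots> = 1"
    using prob_space.emeasure_space_1[OF prob_space_std_normal] by simp
  finally show "emeasure (std_gaussian :: 'a measure) (space std_gaussian) = 1" .
qed

text \<open>For the unit vector \<open>e\<close>, the reflection in the hyperplane orthogonal to \<open>e\<close>; for \<open>e = 0\<close>, the value of
  \<open>sgn\<close> at \<open>0\<close>, it is the identity.\<close>

definition reflect :: "'a::real_inner \<Rightarrow> 'a \<Rightarrow> 'a" where
  "reflect e x = x - (2 * (e \<bullet> x)) *\<^sub>R e"

lemma linear_reflect: "linear (reflect e)"
  by (rule linearI) (simp_all add: reflect_def algebra_simps inner_add_right scaleR_add_left)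

lemma
  assumes "norm e = 1 \<or> e = 0"
  shows reflect_reflect: "reflect e (reflect e x) = x"
    and inner_reflect: "reflect e x \<bullet> y = x \<bullet> reflect e y"
    and norm_reflect: "norm (reflect e x) = norm x"
proof -
  have e: "e \<bullet> e = 1 \<or> e = 0" using assms by (auto simp: norm_eq_1)
  show 1: "reflect e (reflect e x) = x" for x
    using e by (auto simp: reflect_def inner_diff_right algebra_simps simp flip: scaleR_add_left)
  show 2: "reflect e x \<bullet> y = x \<bullet> reflect e y" for x y
    by (simp add: reflect_def inner_diff_left inner_diff_right inner_commute)
  show "norm (reflect e x) = norm x" by (simp add: norm_eq_sqrt_inner 2 1)
qed

lemma continuous_on_reflect [continuous_intros]: "continuous_on UNIV (reflect (e::'a::euclidean_space))"
  unfolding reflect_def by (intro continuous_intros)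

lemma reflect_measurable [measurable]: "reflect (e::'a::euclidean_space) \<in> borel_measurable borel"
  by (intro borel_measurable_continuous_onI continuous_on_reflect)

lemma nn_integral_lborel_translate:
  fixes f :: "'a::euclidean_space \<Rightarrow> ennreal"
  assumes [measurable]: "f \<in> borel_measurable borel"
  shows "(\<integral>\<^sup>+x. f (c + x) \<partial>lborel) = (\<integral>\<^sup>+x. f x \<partial>lborel)"
proof -
  have "(\<integral>\<^sup>+x. f x \<partial>lborel) = (\<integral>\<^sup>+x. f x \<partial>distr lborel borel ((+) c))" by (simp add: lborel_distr_plus)
  also have "\<dots> = (\<integral>\<^sup>+x. f (c + x) \<partial>lborel)" by (rule nn_integral_distr) auto
  finally show ?thesis ..
qed

text \<open>The argument behind the uniqueness of Haar measure: with \<open>g\<close> the indicator of the unit ball,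
  Fubini's theorem and translation invariance give
  \<open>\<integral>f(x) dx \<integral>g(Ry) dy = \<integral>f(Ry) dy \<integral>g(x) dx\<close>, and \<open>g\<close> is invariant under \<open>R\<close>.\<close>

lemma nn_integral_lborel_reflect:
  fixes f :: "'a::euclidean_space \<Rightarrow> ennreal"
  assumes e: "norm e = 1 \<or> e = 0" and [measurable]: "f \<in> borel_measurable borel"
  shows "(\<integral>\<^sup>+x. f (reflect e x) \<partial>lborel) = (\<integral>\<^sup>+x. f x \<partial>lborel)"
proof -
  let ?R = "reflect e"
  define g :: "'a \<Rightarrow> ennreal" where "g = indicator (ball 0 1)"
  have [measurable]: "g \<in> borel_measurable borel"
    unfolding g_def by (intro borel_measurable_indicator) auto
  have gR: "g (?R y) = g y" for y by (simp add: g_def indicator_def norm_reflect[OF e])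
  have g_minus: "g (y - x) = g (x - y)" for x y by (simp add: g_def indicator_def dist_norm norm_minus_commute)
  have R_add: "?R (x + y) = ?R x + ?R y" for x y using linear_reflect by (rule linear_add)
  define G where "G = (\<integral>\<^sup>+x. g x \<partial>lborel)"
  have "(\<integral>\<^sup>+x. f x \<partial>lborel) * G = (\<integral>\<^sup>+y. (\<integral>\<^sup>+x. f x * g (?R y) \<partial>lborel) \<partial>lborel)"
    by (simp add: gR nn_integral_multc nn_integral_cmult G_def)
  also have "\<dots> = (\<integral>\<^sup>+y. (\<integral>\<^sup>+x. f (?R y + x) * g (?R y) \<partial>lborel) \<partial>lborel)"
    by (subst nn_integral_lborel_translate[of "\<lambda>x. f x * g (?R _)"]) auto
  also have "\<dots> = (\<integral>\<^sup>+x. (\<integral>\<^sup>+y. f (?R y + x) * g (?R y) \<partial>lborel) \<partial>lborel)"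
    by (rule lborel_pair.Fubini') measurable
  also have "\<dots> = (\<integral>\<^sup>+x. (\<integral>\<^sup>+y. f (?R y) * g (?R y - x) \<partial>lborel) \<partial>lborel)"
  proof (rule nn_integral_cong)
    fix x
    have "(\<integral>\<^sup>+y. f (?R y) * g (?R y - x) \<partial>lborel) = (\<integral>\<^sup>+y. f (?R (?R x + y)) * g (?R (?R x + y) - x) \<partial>lborel)"
      by (rule nn_integral_lborel_translate[symmetric]) measurable
    also have "\<dots> = (\<integral>\<^sup>+y. f (?R y + x) * g (?R y) \<partial>lborel)"
      by (simp add: R_add reflect_reflect[OF e] add.commute)
    finally show "(\<integral>\<^sup>+y. f (?R y + x) * g (?R y) \<partial>lborel) = (\<integral>\<^sup>+y. f (?R y) * g (?R y - x) \<partial>lborel)" ..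
  qed
  also have "\<dots> = (\<integral>\<^sup>+y. (\<integral>\<^sup>+x. f (?R y) * g (?R y - x) \<partial>lborel) \<partial>lborel)"
    by (rule lborel_pair.Fubini') measurable
  also have "\<dots> = (\<integral>\<^sup>+y. f (?R y) * G \<partial>lborel)"
  proof (rule nn_integral_cong)
    fix y
    have "(\<integral>\<^sup>+x. g (?R y - x) \<partial>lborel) = (\<integral>\<^sup>+x. g (- ?R y + x) \<partial>lborel)" by (subst g_minus) simp
    also have "\<dots> = G" unfolding G_def by (rule nn_integral_lborel_translate) simp
    finally show "(\<integral>\<^sup>+x. f (?R y) * g (?R y - x) \<partial>lborel) = f (?R y) * G" by (simp add: nn_integral_cmult)
  qed
  also have "\<dots> = (\<integral>\<^sup>+y. f (?R y) \<partial>lborel) * G" by (rule nn_integral_multc) simp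
  finally have "(\<integral>\<^sup>+x. f x \<partial>lborel) * G = (\<integral>\<^sup>+y. f (?R y) \<partial>lborel) * G" .
  moreover have "G \<noteq> 0" "G \<noteq> \<infinity>"
  proof -
    have G: "G = emeasure lborel (ball 0 1 :: 'a set)" by (simp add: G_def g_def)
    show "G \<noteq> \<infinity>" unfolding G using emeasure_lborel_ball_finite[of "0::'a" 1] by auto
    show "G \<noteq> 0" unfolding G
      using content_ball_pos[of 1 "0::'a"] by (auto simp: measure_def)
  qed
  ultimately show ?thesis by (auto simp: ennreal_mult_cancel_left mult.commute[of _ G])
qed

lemma gaussian_density_reflect:
  "norm e = 1 \<or> e = 0 \<Longrightarrow> gaussian_density (reflect e x) = gaussian_density x"
  by (simp add: gaussian_density_eq norm_reflect)

lemma nn_integral_std_gaussian_reflect: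
  fixes f :: "'a::euclidean_space \<Rightarrow> ennreal"
  assumes e: "norm e = 1 \<or> e = 0" and [measurable]: "f \<in> borel_measurable borel"
  shows "(\<integral>\<^sup>+x. f (reflect e x) \<partial>std_gaussian) = (\<integral>\<^sup>+x. f x \<partial>std_gaussian)"
proof -
  have "(\<integral>\<^sup>+x. f (reflect e x) \<partial>std_gaussian) = (\<integral>\<^sup>+x. ennreal (gaussian_density (reflect e x)) * f (reflect e x) \<partial>lborel)"
    by (simp add: nn_integral_std_gaussian gaussian_density_reflect[OF e])
  also have "\<dots> = (\<integral>\<^sup>+x. ennreal (gaussian_density x) * f x \<partial>lborel)"
    by (rule nn_integral_lborel_reflect[OF e]) measurable
  finally show ?thesis by (simp add: nn_integral_std_gaussian)
qed

text \<open>Projections of the Gaussian to unit vectors are standard normal: for a basis vector by the product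
  form of the density, and every unit vector \<open>e\<close> is the image of a basis vector \<open>c\<close> under the
  reflection along \<open>e - c\<close>.\<close>

lemma nn_integral_std_gaussian_inner:
  fixes e :: "'a::euclidean_space" and f :: "real \<Rightarrow> ennreal"
  assumes e: "norm e = 1" and [measurable]: "f \<in> borel_measurable borel"
  shows "(\<integral>\<^sup>+x. f (e \<bullet> x) \<partial>std_gaussian) = (\<integral>\<^sup>+x. f x \<partial>std_normal_distribution)"
proof -
  obtain c :: 'a where c: "c \<in> Basis" using nonempty_Basis by blast
  define n where "n = sgn (e - c)"
  have n: "norm n = 1 \<or> n = 0" by (simp add: n_def norm_sgn)
  have cc: "c \<bullet> c = 1" and ee: "e \<bullet> e = 1" using c e by (simp_all add: norm_eq_1)
  have nc: "reflect n c = e"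
  proof (cases "e = c")
    case False
    have sq: "(norm (e - c))\<^sup>2 = 2 - 2 * (e \<bullet> c)"
      by (simp add: power2_norm_eq_inner inner_diff_left inner_diff_right cc ee inner_commute)
    have "reflect n c = c - (2 * ((e - c) \<bullet> c) / (norm (e - c))\<^sup>2) *\<^sub>R (e - c)"
      by (simp add: n_def sgn_div_norm reflect_def power2_eq_square divide_inverse mult_ac)
    also have "2 * ((e - c) \<bullet> c) / (norm (e - c))\<^sup>2 = - 1"
      using False by (simp add: divide_eq_eq) (simp add: sq inner_diff_left cc)
    finally show ?thesis by simp
  qed (simp add: n_def reflect_def)
  have "(\<integral>\<^sup>+x. f (e \<bullet> x) \<partial>std_gaussian) = (\<integral>\<^sup>+x. f (c \<bullet> reflect n x) \<partial>std_gaussian)"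
    by (simp add: nc[symmetric] inner_reflect[OF n])
  also have "\<dots> = (\<integral>\<^sup>+x. f (c \<bullet> x) \<partial>std_gaussian)"
    by (rule nn_integral_std_gaussian_reflect[OF n]) measurable
  also have "\<dots> = (\<integral>\<^sup>+x. (\<Prod>b\<in>Basis. (\<lambda>b y. if b = c then f y else 1) b (x \<bullet> b)) \<partial>(std_gaussian :: 'a measure))"
    using c by (simp add: prod.delta inner_commute cong: prod.cong if_cong)
  also have "\<dots> = (\<Prod>b\<in>(Basis::'a set). \<integral>\<^sup>+x. (if b = c then f x else 1) \<partial>std_normal_distribution)"
    by (subst nn_integral_std_gaussian_prod) auto
  also have "\<dots> = (\<Prod>b\<in>(Basis::'a set). if b = c then \<integral>\<^sup>+x. f x \<partial>std_normal_distribution else 1)"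
    using prob_space.emeasure_space_1[OF prob_space_std_normal] by (intro prod.cong) auto
  also have "\<dots> = (\<integral>\<^sup>+x. f x \<partial>std_normal_distribution)" using c by simp
  finally show ?thesis .
qed

lemma nn_integral_std_normal_even:
  fixes f :: "real \<Rightarrow> ennreal"
  assumes [measurable]: "f \<in> borel_measurable borel"
  shows "(\<integral>\<^sup>+x. f (- x) \<partial>std_normal_distribution) = (\<integral>\<^sup>+x. f x \<partial>std_normal_distribution)"
proof -
  have "(\<integral>\<^sup>+x. f (- x) \<partial>std_normal_distribution) = (\<integral>\<^sup>+x. ennreal (std_normal_density (- x)) * f (- x) \<partial>lborel)"
    by (subst nn_integral_density) (auto simp: std_normal_density_def)
  also have "\<dots> = (\<integral>\<^sup>+x. ennreal (std_normal_density x) * f x \<partial>distr lborel borel uminus)"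
    by (subst nn_integral_distr) auto
  also have "\<dots> = (\<integral>\<^sup>+x. f x \<partial>std_normal_distribution)"
    by (subst nn_integral_density) (auto simp: lborel_distr_uminus)
  finally show ?thesis .
qed

lemma pi_ge_3: "3 \<le> pi"
  using sin_x_le_x[of "pi / 6"] sin_30 pi_gt_zero by simp

text \<open>The exact values are \<open>1 / \<surd>(2 \<pi>)\<close> and \<open>1 / 2\<close>. By symmetry both are half of an absolute moment.\<close>

lemma std_normal_positive_part:
  "(\<integral>\<^sup>+x. ennreal (max 0 x) \<partial>std_normal_distribution) \<le> ennreal (41 / 100)"
  "(\<integral>\<^sup>+x. ennreal ((max 0 x)\<^sup>2) \<partial>std_normal_distribution) \<le> ennreal (1 / 2)"
proof -
  have half: "(\<integral>\<^sup>+x. f (max 0 x) \<partial>std_normal_distribution) + (\<integral>\<^sup>+x. f (max 0 x) \<partial>std_normal_distribution) = (\<integral>\<^sup>+x. f \<bar>x\<bar> \<partial>std_normal_distribution)"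
    if f: "f \<in> borel_measurable borel" and f0: "f 0 = 0" for f :: "real \<Rightarrow> ennreal"
  proof -
    note [measurable] = f
    have "(\<integral>\<^sup>+x. f (max 0 (- x)) \<partial>std_normal_distribution) = (\<integral>\<^sup>+x. f (max 0 x) \<partial>std_normal_distribution)"
      by (rule nn_integral_std_normal_even) measurable
    then have "(\<integral>\<^sup>+x. f (max 0 x) \<partial>std_normal_distribution) + (\<integral>\<^sup>+x. f (max 0 x) \<partial>std_normal_distribution)
        = (\<integral>\<^sup>+x. f (max 0 x) + f (max 0 (- x)) \<partial>std_normal_distribution)"
      by (subst nn_integral_add) auto
    also have "\<dots> = (\<integral>\<^sup>+x. f \<bar>x\<bar> \<partial>std_normal_distribution)"
      by (rule nn_integral_cong) (auto simp: max_def f0)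
    finally show ?thesis .
  qed
  have double: "a \<le> ennreal y" if "a + a = ennreal (2 * y)" "0 \<le> y" for a :: ennreal and y
  proof -
    show ?thesis
    proof (cases a)
      case (real r)
      then have e: "ennreal (r + r) = ennreal (2 * y)" using that(1) by (simp only: ennreal_plus)
      have "r + r = 2 * y"
        by (rule ennreal_inj[THEN iffD1, OF _ _ e]) (use real that(2) in auto)
      then show ?thesis using real by simp
    next
      case top then show ?thesis using that by (simp add: top_add)
    qed
  qed
  have moment: "(\<integral>\<^sup>+x. ennreal (f x) \<partial>std_normal_distribution) = ennreal I"
    if I: "has_bochner_integral lborel (\<lambda>x. std_normal_density x * f x) I" and f: "f \<in> borel_measurable borel" "\<And>x. 0 \<le> f x"
    for f I
  proof -
    have "(\<integral>\<^sup>+x. ennreal (f x) \<partial>std_normal_distribution) = (\<integral>\<^sup>+x. ennreal (std_normal_density x * f x) \<partial>lborel)"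
      using f by (subst nn_integral_density) (auto simp: ennreal_mult')
    also have "\<dots> = ennreal I"
      using I f by (subst nn_integral_eq_integral) (auto simp: has_bochner_integral_iff)
    finally show ?thesis .
  qed
  have "(\<integral>\<^sup>+x. ennreal \<bar>x\<bar> \<partial>std_normal_distribution) = ennreal (sqrt (2 / pi))"
    using std_normal_moment_abs_odd[of 0] by (intro moment) auto
  with half[of ennreal] have "(\<integral>\<^sup>+x. ennreal (max 0 x) \<partial>std_normal_distribution) \<le> ennreal (sqrt (2 / pi) / 2)"
    by (intro double) auto
  also have "sqrt (2 / pi) \<le> 82 / 100"
  proof (rule real_le_lsqrt)
    have "2 / pi \<le> 2 / 3" using pi_ge_3 by (intro divide_left_mono) auto
    also have "\<dots> \<le> (82 / 100 :: real)\<^sup>2" by (simp add: power2_eq_square)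
    finally show "2 / pi \<le> (82 / 100)\<^sup>2" .
  qed simp
  finally show "(\<integral>\<^sup>+x. ennreal (max 0 x) \<partial>std_normal_distribution) \<le> ennreal (41 / 100)" by (simp add: ennreal_leI)
  have "(\<integral>\<^sup>+x. ennreal (\<bar>x\<bar>\<^sup>2) \<partial>std_normal_distribution) = ennreal 1"
    using std_normal_moment_even[of 1] by (intro moment) (auto simp: power2_eq_square)
  with half[of "\<lambda>x. ennreal (x\<^sup>2)"] show "(\<integral>\<^sup>+x. ennreal ((max 0 x)\<^sup>2) \<partial>std_normal_distribution) \<le> ennreal (1 / 2)"
    by (intro double) auto
qed

section \<open>The coupling of the velocities of two particles\<close>

definition uniform01 :: "real measure" where
  "uniform01 = uniform_measure lborel {0..1}"

lemma sets_uniform01 [simp, measurable_cong]: "sets uniform01 = sets borel"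
  by (simp add: uniform01_def)

lemma space_uniform01 [simp]: "space uniform01 = UNIV"
  by (simp add: uniform01_def)

lemma prob_space_uniform01: "prob_space uniform01"
  unfolding uniform01_def by (rule prob_space_uniform_measure) auto

lemma nn_integral_uniform01_threshold:
  fixes a b :: ennreal
  assumes p: "0 \<le> p" "p \<le> 1"
  shows "(\<integral>\<^sup>+u. (if u \<le> p then a else b) \<partial>uniform01) = ennreal p * a + ennreal (1 - p) * b"
proof -
  have "(\<integral>\<^sup>+u. (if u \<le> p then a else b) \<partial>uniform01)
      = (\<integral>\<^sup>+u. a * indicator {..p} u + b * indicator {p<..} u \<partial>uniform01)"
    by (intro nn_integral_cong) (auto simp: indicator_def)
  also have "\<dots> = a * emeasure uniform01 {..p} + b * emeasure uniform01 {p<..}"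
    by (subst nn_integral_add) (auto simp: nn_integral_cmult)
  also have "emeasure uniform01 {..p} = ennreal p"
  proof -
    have "{0..1} \<inter> {..p} = {0..p}" using p by auto
    then show ?thesis using p by (simp add: uniform01_def divide_ennreal_def)
  qed
  also have "emeasure uniform01 {p<..} = ennreal (1 - p)"
  proof -
    have "{0..1} \<inter> {p<..} = {p<..1}" using p by auto
    then show ?thesis using p by (simp add: uniform01_def divide_ennreal_def)
  qed
  finally show ?thesis by (simp add: mult.commute)
qed

text \<open>The probability with which a particle with initial distance vector \<open>z\<close> and velocity \<open>\<xi>\<close> can be
  coupled to a particle with velocity \<open>\<xi> + \<gamma> z\<close>: the ratio of the Gaussian densities at these two
  velocities, truncated at 1. Otherwise the velocity is reflected in the hyperplane orthogonal to \<open>z\<close>.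
  This is a maximal coupling of two Gaussians whose means differ by \<open>\<gamma> z\<close>, in which the remaining
  mass is moved by a reflection.\<close>

definition shift_prob :: "real \<Rightarrow> 'a::real_inner \<Rightarrow> 'a \<Rightarrow> real" where
  "shift_prob \<gamma> z \<xi> = min 1 (exp (- (\<gamma> * (z \<bullet> \<xi>)) - \<gamma>\<^sup>2 * (norm z)\<^sup>2 / 2))"

definition shift_reflect :: "real \<Rightarrow> 'a::real_inner \<Rightarrow> 'a \<Rightarrow> real \<Rightarrow> 'a" where
  "shift_reflect \<gamma> z \<xi> u = (if u \<le> shift_prob \<gamma> z \<xi> then \<xi> + \<gamma> *\<^sub>R z else reflect (sgn z) \<xi>)"

lemma shift_prob_bounds: "0 \<le> shift_prob \<gamma> z \<xi>" "shift_prob \<gamma> z \<xi> \<le> 1"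
  by (simp_all add: shift_prob_def)

lemma gaussian_density_shift_prob:
  "gaussian_density \<xi> * shift_prob \<gamma> z \<xi> = min (gaussian_density \<xi>) (gaussian_density (\<xi> + \<gamma> *\<^sub>R z))"
proof -
  have "(norm (\<xi> + \<gamma> *\<^sub>R z))\<^sup>2 = (norm \<xi>)\<^sup>2 + 2 * \<gamma> * (z \<bullet> \<xi>) + \<gamma>\<^sup>2 * (norm z)\<^sup>2"
    unfolding power2_norm_eq_inner
    by (simp add: inner_add_left inner_add_right inner_commute power2_eq_square[of \<gamma>] algebra_simps)
  then have "gaussian_density (\<xi> + \<gamma> *\<^sub>R z)
      = gaussian_density \<xi> * exp (- (\<gamma> * (z \<bullet> \<xi>)) - \<gamma>\<^sup>2 * (norm z)\<^sup>2 / 2)"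
    by (simp add: gaussian_density_eq exp_add[symmetric] mult.assoc)
  then show ?thesis
    using gaussian_density_nonneg[of \<xi>] by (simp add: shift_prob_def min_mult_distrib_left)
qed

lemma shift_prob_measurable [measurable (raw)]:
  fixes f g :: "'b \<Rightarrow> 'a::euclidean_space"
  assumes [measurable]: "f \<in> borel_measurable M" "g \<in> borel_measurable M"
  shows "(\<lambda>x. shift_prob \<gamma> (f x) (g x)) \<in> borel_measurable M"
  unfolding shift_prob_def by measurable

lemma shift_reflect_measurable [measurable (raw)]:
  fixes f g :: "'b \<Rightarrow> 'a::euclidean_space"
  assumes [measurable]: "f \<in> borel_measurable M" "g \<in> borel_measurable M" "u \<in> borel_measurable M"
  shows "(\<lambda>x. shift_reflect \<gamma> (f x) (g x) (u x)) \<in> borel_measurable M"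
  unfolding shift_reflect_def reflect_def sgn_div_norm by measurable

text \<open>The coupled velocity is again Gaussian, with density \<open>\<phi>\<close>: the accepted mass is distributed with density
  \<open>min (\<phi> (\<eta> - \<gamma> z)) (\<phi> \<eta>)\<close>, and the reflection maps the rejected mass \<open>\<phi> \<xi> - min (\<phi> \<xi>) (\<phi> (\<xi> + \<gamma> z))\<close>
  to \<open>\<phi> \<eta> - min (\<phi> \<eta>) (\<phi> (\<eta> - \<gamma> z))\<close>, because it preserves \<open>\<phi>\<close> and maps \<open>z\<close> to \<open>- z\<close>.\<close>

lemma nn_integral_shift_reflect:
  fixes f :: "'a::euclidean_space \<Rightarrow> ennreal"
  assumes [measurable]: "f \<in> borel_measurable borel"
  shows "(\<integral>\<^sup>+\<xi>. \<integral>\<^sup>+u. f (shift_reflect \<gamma> z \<xi> u) \<partial>uniform01 \<partial>std_gaussian) = (\<integral>\<^sup>+\<xi>. f \<xi> \<partial>std_gaussian)"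
proof -
  let ?e = "sgn z"
  have e: "norm ?e = 1 \<or> ?e = 0" by (simp add: norm_sgn)
  define G where "G x = ennreal (min (gaussian_density (x - \<gamma> *\<^sub>R z)) (gaussian_density x)) * f x" for x
  define H where "H x = ennreal (gaussian_density x - min (gaussian_density x) (gaussian_density (x - \<gamma> *\<^sub>R z))) * f x" for x
  have [measurable]: "G \<in> borel_measurable borel" "H \<in> borel_measurable borel"
    unfolding G_def H_def by measurable
  have Rz: "reflect ?e (\<xi> + \<gamma> *\<^sub>R z) = reflect ?e \<xi> - \<gamma> *\<^sub>R z" for \<xi>
  proof (cases "z = 0")
    case False
    have "?e \<bullet> z = norm z" using False by (simp add: sgn_div_norm dot_square_norm power2_eq_square field_simps)
    then have "reflect ?e z = z - 2 *\<^sub>R z" using False by (simp add: reflect_def sgn_div_norm)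
    then have "reflect ?e z = - z" by (simp add: scaleR_2)
    then show ?thesis
      using linear_reflect[of ?e] by (simp add: linear_add linear_cmul)
  qed (simp add: reflect_def)
  have H_reflect: "H (reflect ?e \<xi>) = ennreal (gaussian_density \<xi> - min (gaussian_density \<xi>) (gaussian_density (\<xi> + \<gamma> *\<^sub>R z))) * f (reflect ?e \<xi>)" for \<xi>
    unfolding H_def Rz[symmetric] gaussian_density_reflect[OF e] ..
  have "(\<integral>\<^sup>+\<xi>. \<integral>\<^sup>+u. f (shift_reflect \<gamma> z \<xi> u) \<partial>uniform01 \<partial>std_gaussian)
      = (\<integral>\<^sup>+\<xi>. ennreal (shift_prob \<gamma> z \<xi>) * f (\<xi> + \<gamma> *\<^sub>R z) + ennreal (1 - shift_prob \<gamma> z \<xi>) * f (reflect ?e \<xi>) \<partial>std_gaussian)"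
  proof (rule nn_integral_cong)
    fix \<xi>
    have "(\<integral>\<^sup>+u. f (shift_reflect \<gamma> z \<xi> u) \<partial>uniform01)
        = (\<integral>\<^sup>+u. (if u \<le> shift_prob \<gamma> z \<xi> then f (\<xi> + \<gamma> *\<^sub>R z) else f (reflect ?e \<xi>)) \<partial>uniform01)"
      by (intro nn_integral_cong) (simp add: shift_reflect_def)
    then show "(\<integral>\<^sup>+u. f (shift_reflect \<gamma> z \<xi> u) \<partial>uniform01)
        = ennreal (shift_prob \<gamma> z \<xi>) * f (\<xi> + \<gamma> *\<^sub>R z) + ennreal (1 - shift_prob \<gamma> z \<xi>) * f (reflect ?e \<xi>)"
      by (simp add: nn_integral_uniform01_threshold shift_prob_bounds)
  qed
  also have "\<dots> = (\<integral>\<^sup>+\<xi>. G (\<gamma> *\<^sub>R z + \<xi>) + H (reflect ?e \<xi>) \<partial>lborel)"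
  proof (subst nn_integral_std_gaussian, measurable, rule nn_integral_cong)
    fix \<xi>
    have 1: "ennreal (gaussian_density \<xi>) * ennreal (shift_prob \<gamma> z \<xi>) = ennreal (min (gaussian_density \<xi>) (gaussian_density (\<xi> + \<gamma> *\<^sub>R z)))"
      using gaussian_density_nonneg[of \<xi>] shift_prob_bounds[of \<gamma> z \<xi>]
      by (simp add: ennreal_mult[symmetric] gaussian_density_shift_prob)
    have "gaussian_density \<xi> * (1 - shift_prob \<gamma> z \<xi>) = gaussian_density \<xi> - min (gaussian_density \<xi>) (gaussian_density (\<xi> + \<gamma> *\<^sub>R z))"
      by (simp add: right_diff_distrib gaussian_density_shift_prob)
    then have 2: "ennreal (gaussian_density \<xi>) * ennreal (1 - shift_prob \<gamma> z \<xi>) = ennreal (gaussian_density \<xi> - min (gaussian_density \<xi>) (gaussian_density (\<xi> + \<gamma> *\<^sub>R z)))"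
      using gaussian_density_nonneg[of \<xi>] shift_prob_bounds[of \<gamma> z \<xi>]
      by (simp add: ennreal_mult[symmetric])
    show "ennreal (gaussian_density \<xi>) * (ennreal (shift_prob \<gamma> z \<xi>) * f (\<xi> + \<gamma> *\<^sub>R z) + ennreal (1 - shift_prob \<gamma> z \<xi>) * f (reflect ?e \<xi>))
        = G (\<gamma> *\<^sub>R z + \<xi>) + H (reflect ?e \<xi>)"
      unfolding H_reflect by (simp add: distrib_left mult.assoc[symmetric] 1 2 G_def add.commute)
  qed
  also have "\<dots> = (\<integral>\<^sup>+\<xi>. G (\<gamma> *\<^sub>R z + \<xi>) \<partial>lborel) + (\<integral>\<^sup>+\<xi>. H (reflect ?e \<xi>) \<partial>lborel)"
    by (rule nn_integral_add) measurable
  also have "\<dots> = (\<integral>\<^sup>+x. G x \<partial>lborel) + (\<integral>\<^sup>+x. H x \<partial>lborel)"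
    by (simp add: nn_integral_lborel_translate nn_integral_lborel_reflect[OF e])
  also have "\<dots> = (\<integral>\<^sup>+x. G x + H x \<partial>lborel)" by (rule nn_integral_add[symmetric]) measurable
  also have "\<dots> = (\<integral>\<^sup>+x. ennreal (gaussian_density x) * f x \<partial>lborel)"
  proof (rule nn_integral_cong)
    fix x
    have "G x + H x = (ennreal (min (gaussian_density x) (gaussian_density (x - \<gamma> *\<^sub>R z)))
        + ennreal (gaussian_density x - min (gaussian_density x) (gaussian_density (x - \<gamma> *\<^sub>R z)))) * f x"
      by (simp add: G_def H_def distrib_right min.commute)
    also have "\<dots> = ennreal (gaussian_density x) * f x"
      by (subst ennreal_plus[symmetric]) (auto simp: gaussian_density_nonneg)
    finally show "G x + H x = ennreal (gaussian_density x) * f x" .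
  qed
  finally show ?thesis by (simp add: nn_integral_std_gaussian)
qed

section \<open>The concave distance profile\<close>

lemma exp_decay_has_integral:
  assumes "0 < (T::real)" "a \<le> b"
  shows "((\<lambda>s. exp (- (s / T))) has_integral (T * exp (- (a / T)) - T * exp (- (b / T)))) {a..b}"
proof -
  have "((\<lambda>s. exp (- (s / T))) has_integral ((- T * exp (- (b / T))) - (- T * exp (- (a / T))))) {a..b}"
    using assms(1)
    by (intro fundamental_theorem_of_calculus[OF assms(2)])
      (auto intro!: derivative_eq_intros simp flip: has_real_derivative_iff_has_vector_derivative)
  then show ?thesis by simp
qed

locale distance_profile =
  fixes R\<^sub>1 T :: real
  assumes T: "0 < T" and R\<^sub>1: "0 \<le> R\<^sub>1"
begin

abbreviation slope :: "real \<Rightarrow> real" where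
  "slope s \<equiv> exp (- (min R\<^sub>1 s / T))"

abbreviation profile :: "real \<Rightarrow> real" where
  "profile \<equiv> dist_profile R\<^sub>1 T"

lemma slope_integrable: "slope integrable_on {a..b}"
  by (intro integrable_continuous_real continuous_intros) (use T in auto)

lemma slope_antimono: "a \<le> b \<Longrightarrow> slope b \<le> slope a"
  using T by (auto intro!: divide_right_mono)

lemma slope_bounds: "exp (- (R\<^sub>1 / T)) \<le> slope a" "0 \<le> a \<Longrightarrow> slope a \<le> 1"
  using T R\<^sub>1 by (auto intro!: divide_right_mono)

lemma profile_0: "profile 0 = 0"
  by (simp add: dist_profile_def)

lemma profile_diff:
  assumes "0 \<le> a" "a \<le> b"
  shows "profile b - profile a = integral {a..b} slope"
  using Henstock_Kurzweil_Integration.integral_combine[OF assms slope_integrable] by (simp add: dist_profile_def)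

lemma profile_concave:
  assumes a: "0 \<le> a" and b: "0 \<le> b"
  shows "profile b \<le> profile a + slope a * (b - a)"
proof -
  have bounds: "slope b * (b - a) \<le> profile b - profile a \<and> profile b - profile a \<le> slope a * (b - a)"
    if "0 \<le> a" "a \<le> b" for a b
  proof -
    have "integral {a..b} (\<lambda>_. slope b) \<le> integral {a..b} slope" "integral {a..b} slope \<le> integral {a..b} (\<lambda>_. slope a)"
      by (intro integral_le slope_integrable integrable_const_ivl slope_antimono; simp)+
    then show ?thesis using profile_diff[OF that] that by (simp add: mult.commute)
  qed
  show ?thesis
  proof (cases "a \<le> b")
    case True then show ?thesis using bounds[OF a True] by linarith
  next
    case False
    then have "slope a * (a - b) \<le> profile a - profile b" using bounds[OF b, of a] by simp
    then show ?thesis by (simp add: algebra_simps)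
  qed
qed

lemma profile_mono: "0 \<le> a \<Longrightarrow> a \<le> b \<Longrightarrow> profile a \<le> profile b"
proof -
  assume ab: "0 \<le> a" "a \<le> b"
  have "0 \<le> integral {a..b} slope" by (intro integral_nonneg slope_integrable) simp
  then show ?thesis using profile_diff[OF ab] by simp
qed

lemma profile_nonneg: "0 \<le> a \<Longrightarrow> 0 \<le> profile a"
  using profile_mono[of 0 a] by (simp add: profile_0)

lemma profile_add_le: "0 \<le> a \<Longrightarrow> 0 \<le> b \<Longrightarrow> profile (a + b) \<le> profile a + b"
  using profile_concave[of a "a + b"] mult_right_mono[OF slope_bounds(2)[of a], of b] by simp

lemma profile_le: "0 \<le> a \<Longrightarrow> profile a \<le> a"
  using profile_add_le[of 0 a] by (simp add: profile_0)

lemma profile_ge_slope: "0 \<le> a \<Longrightarrow> slope a * a \<le> profile a"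
  using profile_concave[of a 0] by (simp add: profile_0)

lemma profile_ge: "0 \<le> a \<Longrightarrow> exp (- (R\<^sub>1 / T)) * a \<le> profile a"
  using profile_ge_slope[of a] mult_right_mono[OF slope_bounds(1)[of a], of a] by linarith

text \<open>Below \<open>R\<^sub>1\<close> the profile bends so fast that no increment costs more than \<open>T\<close> times the
  slope; beyond \<open>R\<^sub>1\<close> the slope is constant, but smaller by the factor \<open>exp (- (R\<^sub>1 - r) / T)\<close>.\<close>

lemma profile_increment_le:
  assumes r: "0 \<le> r" "r \<le> R\<^sub>1" and s: "0 \<le> s"
  shows "profile (r + s) \<le> profile r + slope r * (T + s * exp (- ((R\<^sub>1 - r) / T)))"
proof -
  have exp_int: "((\<lambda>v. exp (- (v / T)) + exp (- (R\<^sub>1 / T))) has_integral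
      ((T * exp (- (r / T)) - T * exp (- ((r + s) / T))) + s * exp (- (R\<^sub>1 / T)))) {r..r + s}"
    using has_integral_add[OF exp_decay_has_integral[OF T, of r "r + s"] has_integral_const_real[of "exp (- (R\<^sub>1 / T))" r "r + s"]] s
    by simp
  have "profile (r + s) - profile r = integral {r..r + s} slope" using r s by (intro profile_diff) auto
  also have "\<dots> \<le> integral {r..r + s} (\<lambda>v. exp (- (v / T)) + exp (- (R\<^sub>1 / T)))"
    by (intro integral_le slope_integrable has_integral_integrable[OF exp_int]) (auto simp: min_def)
  also have "\<dots> \<le> T * exp (- (r / T)) + s * exp (- (R\<^sub>1 / T))"
    using T by (simp add: integral_unique[OF exp_int])
  also have "exp (- (R\<^sub>1 / T)) = exp (- (r / T)) * exp (- ((R\<^sub>1 - r) / T))"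
    by (simp add: exp_add[symmetric] diff_divide_distrib)
  finally show ?thesis using r by (simp add: algebra_simps)
qed

text \<open>The ratio of \<open>r f'(r)\<close> and \<open>f(r)\<close> is smallest at \<open>r = R\<^sub>1\<close>. This turns a relative decrease of
  the distance into a relative decrease of its profile.\<close>

lemma profile_slope_ratio:
  assumes r: "0 \<le> r"
  shows "R\<^sub>1 / T * exp (- (R\<^sub>1 / T)) * profile r \<le> slope r * r"
proof -
  define A where "A = R\<^sub>1 / T"
  have A: "0 \<le> A" "R\<^sub>1 = A * T" using T R\<^sub>1 by (auto simp: A_def)
  have small: "profile r \<le> T - T * exp (- (r / T))" if "0 \<le> r" "r \<le> R\<^sub>1" for r
  proof -
    have "profile r = integral {0..r} slope" by (simp add: dist_profile_def)
    also have "\<dots> = integral {0..r} (\<lambda>s. exp (- (s / T)))"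
      by (rule integral_cong) (use that in auto)
    also have "\<dots> = T - T * exp (- (r / T))"
      using integral_unique[OF exp_decay_has_integral[OF T that(1)]] by simp
    finally show ?thesis by simp
  qed
  show ?thesis
  proof (cases "r \<le> R\<^sub>1")
    case True
    show ?thesis
    proof (cases "A = 0")
      case True then show ?thesis using r by (simp flip: A_def)
    next
      case False
      define a where "a = r / T"
      have a: "0 \<le> a" "a \<le> A" "r = a * T" using T r True by (auto simp: a_def A_def divide_right_mono)
      have A0: "0 < A" using A False by simp
      define t where "t = a / A"
      have t: "0 \<le> t" "t \<le> 1" "a = t * A" using a A0 by (auto simp: t_def divide_le_eq_1)
      \<comment> \<open>the chord of \<open>exp\<close> between \<open>0\<close> and \<open>A\<close>: \<open>(exp a - 1) / a\<close> is increasing\<close>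
      have "exp ((1 - t) *\<^sub>R 0 + t *\<^sub>R A) \<le> (1 - t) * exp 0 + t * exp A"
        by (rule convex_onD[OF exp_convex]) (use t in auto)
      then have "exp a \<le> 1 - t + t * exp A" unfolding t(3) by simp
      then have "A * (exp a - 1) \<le> A * ((1 - t + t * exp A) - 1)" using A0 by (intro mult_left_mono) auto
      also have "\<dots> = a * (exp A - 1)" unfolding t(3) by (simp only: right_diff_distrib distrib_left mult_1_right mult_ac)
      also have "\<dots> \<le> a * exp A" using a by (intro mult_left_mono) auto
      finally have "exp (- A) * (A * (exp a - 1)) \<le> exp (- A) * (a * exp A)" by (intro mult_left_mono) auto
      moreover have "exp (- A) * (a * exp A) = a * (exp A * exp (- A))" by (simp only: mult_ac)
      ultimately have *: "A * exp (- A) * (exp a - 1) \<le> a" by (simp add: exp_minus_inverse mult_ac)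
      have "A * exp (- A) * profile r \<le> A * exp (- A) * (T - T * exp (- a))"
        using small[OF r True] A by (intro mult_left_mono) (auto simp: a_def)
      also have "\<dots> = T * exp (- a) * (A * exp (- A) * (exp a - 1))"
      proof -
        have "T * exp (- a) * (A * exp (- A) * (exp a - 1)) = A * exp (- A) * (T * (exp a * exp (- a)) - T * exp (- a))"
          by (simp only: right_diff_distrib mult_ac mult_1_right)
        then show ?thesis by (simp only: exp_minus_inverse mult_1_right)
      qed
      also have "\<dots> \<le> T * exp (- a) * a" using * T by (intro mult_left_mono) auto
      also have "\<dots> = exp (- a) * (a * T)" by (simp only: mult_ac)
      also have "\<dots> = slope r * r"
      proof -
        have "slope r = exp (- a)" using True by (simp add: a_def min_absorb2)
        then show ?thesis using a(3) by (simp only:)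
      qed
      finally show ?thesis unfolding A_def .
    qed
  next
    case False
    have "profile r \<le> profile R\<^sub>1 + slope R\<^sub>1 * (r - R\<^sub>1)" using r R\<^sub>1 by (intro profile_concave)
    also have "\<dots> \<le> T + exp (- A) * (r - R\<^sub>1)" using small[of R\<^sub>1] R\<^sub>1 T
      by (simp add: A_def) (smt (verit) exp_gt_zero mult_nonneg_nonneg)
    finally have "A * exp (- A) * profile r \<le> A * exp (- A) * (T + exp (- A) * (r - R\<^sub>1))"
      using A by (intro mult_left_mono) auto
    also have "\<dots> = exp (- A) * (R\<^sub>1 + A * exp (- A) * (r - R\<^sub>1))" by (simp add: A algebra_simps)
    also have "\<dots> \<le> exp (- A) * (R\<^sub>1 + 1 * (r - R\<^sub>1))"
    proof -
      have "A \<le> exp A" using exp_ge_add_one_self[of A] by linarith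
      then have "A * exp (- A) \<le> exp A * exp (- A)" by (intro mult_right_mono) auto
      then have "A * exp (- A) \<le> 1" by (simp only: exp_minus_inverse)
      then show ?thesis using False by (intro mult_left_mono add_left_mono mult_right_mono) auto
    qed
    finally show ?thesis using False by (simp add: A_def)
  qed
qed

end

section \<open>Contraction for one particle\<close>

locale coupling_parameters =
  fixes K L R' T R\<^sub>1 c :: real
  assumes K: "0 < K" "K \<le> L" and R': "0 \<le> R'" and T: "0 < T"
    and LT: "L * T\<^sup>2 \<le> 3 / 20" and LTR: "L * T * R' \<le> 3 / 80"
    and R1_eq: "R\<^sub>1 = 5 / 4 * (R' + 2 * T)" and c: "c = 1 / 156 * K * T\<^sup>2 * exp (- (5 * R' / (4 * T)))"
begin

sublocale distance_profile R\<^sub>1 T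
  using T R' by unfold_locales (auto simp: R1_eq)

text \<open>The shift of the velocities must not let the particles overshoot (\<open>\<gamma> T \<le> 1\<close>), and it must be small
  compared to a standard deviation (\<open>\<gamma> r \<le> 1 / 4\<close> for \<open>r < R'\<close>). For \<open>R' = 0\<close> its value is \<open>0\<close>, but then
  no two particles are at a distance less than \<open>R'\<close>.\<close>

definition \<gamma> :: real where
  "\<gamma> = min (1 / T) (1 / (4 * R'))"

text \<open>Particles at a distance of at least \<open>R'\<close> move with the same velocity, since their forces
  then pull them together. At smaller distances the forces may push them apart, and the shift by
  \<open>\<gamma> z\<close> of the velocity brings them closer instead.\<close>

definition couple_particle :: "'a::real_inner \<Rightarrow> 'a \<Rightarrow> real \<Rightarrow> 'a" where
  "couple_particle z \<xi> u = (if R' \<le> norm z then \<xi> else shift_reflect \<gamma> z \<xi> u)"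

text \<open>A bound for the distance of two particles at time \<open>T\<close>, up to the influence of the other particles, for
  the initial distance vector \<open>z\<close> and the initial velocity difference \<open>w\<close>. It describes the synchronous
  coupling (\<open>w = 0\<close>) if the particles are far apart, and a perturbed free motion otherwise.\<close>

definition particle_bound :: "'a::real_inner \<Rightarrow> 'a \<Rightarrow> real" where
  "particle_bound z w = (if R' \<le> norm z then (1 - K * T\<^sup>2 / 4) * norm z
     else norm (z + T *\<^sub>R w) + 29 / 50 * (L * T\<^sup>2) * free_reach T z w)"

lemma KT: "0 < K * T\<^sup>2" "K * T\<^sup>2 \<le> 3 / 20"
proof -
  show "0 < K * T\<^sup>2" using K T by simp
  have "K * T\<^sup>2 \<le> L * T\<^sup>2" using K by (intro mult_right_mono) auto
  then show "K * T\<^sup>2 \<le> 3 / 20" using LT by simp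
qed

lemma particle_bound_nonneg: "0 \<le> particle_bound z w"
  using KT K free_reach_nonneg[of T z w] by (auto simp: particle_bound_def intro!: add_nonneg_nonneg mult_nonneg_nonneg)

lemma R1_T: "R\<^sub>1 / T = 5 * R' / (4 * T) + 5 / 2"
  using T by (simp add: R1_eq field_simps)

lemma exp_5_2: "exp (5 / 2 :: real) \<le> 25 / 2" "12 \<le> exp (5 / 2 :: real)"
proof -
  have e: "exp (5 / 2 :: real) = (exp 1)\<^sup>2 * exp (1 / 2)"
    by (simp add: power2_eq_square flip: exp_add)
  have e1: "271 / 100 < exp (1::real)" "exp (1::real) < 272 / 100" using e_approx_32 by (auto simp: abs_if split: if_splits)
  have e2: "exp (1 / 2 :: real) \<le> 165 / 100" "164 / 100 \<le> exp (1 / 2 :: real)"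
  proof -
    have sq: "(exp (1 / 2 :: real))\<^sup>2 = exp 1" by (simp add: power2_eq_square flip: exp_add)
    show "exp (1 / 2 :: real) \<le> 165 / 100"
      by (rule power2_le_imp_le) (use sq e1 in \<open>auto simp: power2_eq_square\<close>)
    show "164 / 100 \<le> exp (1 / 2 :: real)"
      by (rule power2_le_imp_le) (use sq e1 in \<open>auto simp: power2_eq_square\<close>)
  qed
  have "(exp (1::real))\<^sup>2 \<le> (272 / 100)\<^sup>2" "(271 / 100)\<^sup>2 \<le> (exp (1::real))\<^sup>2"
    using e1 by (auto intro!: power_mono)
  from mult_mono[OF this(1) e2(1)] mult_mono[OF this(2) e2(2)]
  have "(exp (1::real))\<^sup>2 * exp (1 / 2) \<le> (272 / 100)\<^sup>2 * (165 / 100)" "(271 / 100)\<^sup>2 * (164 / 100) \<le> (exp (1::real))\<^sup>2 * exp (1 / 2)"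
    by simp_all
  then show "exp (5 / 2 :: real) \<le> 25 / 2" "12 \<le> exp (5 / 2 :: real)" by (auto simp: e power2_eq_square)
qed

lemma decay_split: "exp (- (R\<^sub>1 / T)) = exp (- (5 / 2)) * exp (- (5 * R' / (4 * T)))"
  by (simp add: R1_T flip: exp_add)

lemma exp_m5_2: "8 / 100 \<le> exp (- (5 / 2) :: real)" "exp (- (5 / 2) :: real) \<le> 1 / 12"
proof -
  have e: "exp (- (5 / 2) :: real) = 1 / exp (5 / 2)" by (simp only: exp_minus inverse_eq_divide)
  show "8 / 100 \<le> exp (- (5 / 2) :: real)" "exp (- (5 / 2) :: real) \<le> 1 / 12"
    unfolding e using exp_5_2 by (simp_all add: le_divide_eq divide_le_eq)
qed

text \<open>The relative decrease \<open>K T\<^sup>2 / 4\<close> of the distance loses the factor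
  \<open>R\<^sub>1 / T exp (- R\<^sub>1 / T)\<close> when it is measured in the profile; here \<open>R\<^sub>1 / T\<close> is at least \<open>5 / 2\<close>.\<close>

lemma profile_far:
  assumes far: "R' \<le> r" and r: "0 \<le> r"
  shows "profile ((1 - K * T\<^sup>2 / 4) * r) \<le> (1 - 2 * c) * profile r"
proof -
  have "2 / 10 * exp (- (5 * R' / (4 * T))) \<le> R\<^sub>1 / T * exp (- (R\<^sub>1 / T))"
  proof -
    have "5 / 2 * (8 / 100 * exp (- (5 * R' / (4 * T)))) \<le> R\<^sub>1 / T * exp (- (R\<^sub>1 / T))"
      unfolding decay_split using exp_m5_2 R' T by (intro mult_mono) (auto simp: R1_T)
    then show ?thesis by simp
  qed
  then have "2 / 10 * exp (- (5 * R' / (4 * T))) * profile r \<le> slope r * r"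
    using profile_slope_ratio[OF r] profile_nonneg[OF r] by (meson mult_right_mono order_trans)
  then have "K * T\<^sup>2 / 4 * (2 / 10 * exp (- (5 * R' / (4 * T))) * profile r) \<le> K * T\<^sup>2 / 4 * (slope r * r)"
    using KT by (intro mult_left_mono) auto
  moreover have "2 * c * profile r \<le> K * T\<^sup>2 / 4 * (2 / 10 * exp (- (5 * R' / (4 * T))) * profile r)"
  proof -
    have "0 \<le> K * T\<^sup>2 * (exp (- (5 * R' / (4 * T))) * profile r)"
      by (rule mult_nonneg_nonneg[OF less_imp_le[OF KT(1)] mult_nonneg_nonneg[OF exp_ge_zero profile_nonneg[OF r]]])
    then show ?thesis by (simp add: c mult_ac)
  qed
  moreover have "profile ((1 - K * T\<^sup>2 / 4) * r) \<le> profile r + slope r * ((1 - K * T\<^sup>2 / 4) * r - r)"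
    using r KT by (intro profile_concave) auto
  ultimately show ?thesis by (simp add: algebra_simps)
qed

context
  fixes z :: "'a::euclidean_space" and r :: real
  assumes near: "norm z < R'" and r: "r = norm z" and r0: "0 < r"
begin

lemma \<gamma>: "0 < \<gamma>" "\<gamma> * T \<le> 1" "\<gamma> * r \<le> 1 / 4" "L * T\<^sup>2 \<le> 3 / 20 * (\<gamma> * T)" "5 / 16 \<le> \<gamma> * T * (R\<^sub>1 / T)"
proof -
  have R'0: "0 < R'" using near norm_ge_zero[of z] by linarith
  show g0: "0 < \<gamma>" using T R'0 by (simp add: \<gamma>_def)
  show "\<gamma> * T \<le> 1" using T by (simp add: \<gamma>_def min_def field_simps)
  have "\<gamma> * r \<le> 1 / (4 * R') * R'" using near r r0 R'0 g0 by (intro mult_mono) (auto simp: \<gamma>_def)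
  then show "\<gamma> * r \<le> 1 / 4" using R'0 by simp
  show "L * T\<^sup>2 \<le> 3 / 20 * (\<gamma> * T)"
    using LT LTR T R'0 by (auto simp: \<gamma>_def min_def power2_eq_square field_simps)
  show "5 / 16 \<le> \<gamma> * T * (R\<^sub>1 / T)"
    using T R'0 unfolding R1_T by (auto simp: \<gamma>_def min_def field_simps)
qed

text \<open>The part of the velocity along \<open>z\<close> that a reflection turns into additional distance.\<close>

definition v :: "'a \<Rightarrow> real" where
  "v \<xi> = max 0 (sgn z \<bullet> \<xi>)"

text \<open>\<open>1 - exp (- x) \<le> x\<close>, and the quadratic term in the exponent is small since \<open>\<gamma> r \<le> 1 / 4\<close>.\<close>

lemma reject_prob_le: "1 - shift_prob \<gamma> z \<xi> \<le> \<gamma> * r * (v \<xi> + 1 / 8)"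
proof -
  have zs: "z \<bullet> \<xi> = r * (sgn z \<bullet> \<xi>)" using r0 by (simp add: r sgn_div_norm)
  define x where "x = \<gamma> * (z \<bullet> \<xi>) + \<gamma>\<^sup>2 * (norm z)\<^sup>2 / 2"
  have x: "x \<le> \<gamma> * r * (v \<xi> + 1 / 8)"
  proof -
    have "\<gamma> * r * (sgn z \<bullet> \<xi>) \<le> \<gamma> * r * v \<xi>" using \<gamma> r0 by (intro mult_left_mono) (auto simp: v_def)
    moreover have "(\<gamma> * r) * (\<gamma> * r) \<le> (\<gamma> * r) * (1 / 4)" using \<gamma> r0 by (intro mult_left_mono) auto
    moreover have "x = \<gamma> * r * (sgn z \<bullet> \<xi>) + (\<gamma> * r) * (\<gamma> * r) / 2"
      by (simp add: x_def zs r[symmetric] power2_eq_square mult_ac)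
    ultimately show ?thesis by (simp add: distrib_left)
  qed
  have "0 \<le> \<gamma> * r * (v \<xi> + 1 / 8)" using \<gamma> r0 by (simp add: v_def)
  moreover have "1 - exp (- x) \<le> x" using exp_ge_add_one_self[of "- x"] by simp
  moreover have "shift_prob \<gamma> z \<xi> = min 1 (exp (- x))" by (simp add: shift_prob_def x_def)
  ultimately show ?thesis using x by (auto simp: min_def)
qed

lemma shifted_bounds:
  "particle_bound z (\<xi> - (\<xi> + \<gamma> *\<^sub>R z)) \<le> r - 913 / 1000 * (\<gamma> * T) * r"
  "free_reach T z (\<xi> - (\<xi> + \<gamma> *\<^sub>R z)) \<le> r"
proof -
  have "z + T *\<^sub>R (\<xi> - (\<xi> + \<gamma> *\<^sub>R z)) = (1 - \<gamma> * T) *\<^sub>R z" by (simp add: algebra_simps)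
  then have n: "norm (z + T *\<^sub>R (\<xi> - (\<xi> + \<gamma> *\<^sub>R z))) = (1 - \<gamma> * T) * r" using \<gamma> by (simp add: r)
  have "0 \<le> \<gamma> * T" using \<gamma>(1) T by simp
  then have "(1 - \<gamma> * T) * r \<le> r" using mult_right_mono[of "1 - \<gamma> * T" 1 r] r0 by simp
  then show f: "free_reach T z (\<xi> - (\<xi> + \<gamma> *\<^sub>R z)) \<le> r" by (simp only: free_reach_def n) (simp add: r)
  have "29 / 50 * (L * T\<^sup>2) * free_reach T z (\<xi> - (\<xi> + \<gamma> *\<^sub>R z)) \<le> 29 / 50 * (3 / 20 * (\<gamma> * T)) * r"
    by (rule mult_mono[OF _ f _ free_reach_nonneg]) (use \<gamma>(4) \<open>0 \<le> \<gamma> * T\<close> in linarith)+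
  then show "particle_bound z (\<xi> - (\<xi> + \<gamma> *\<^sub>R z)) \<le> r - 913 / 1000 * (\<gamma> * T) * r"
    using near unfolding particle_bound_def n by (simp add: algebra_simps)
qed

text \<open>Reflected velocities differ only along \<open>z\<close>, so that free motion changes the distance to \<open>|r + 2 T s|\<close>,
  where \<open>s\<close> is the component of \<open>\<xi>\<close> along \<open>z\<close>. A rejection is possible only if \<open>s > - \<gamma> r / 2\<close>, and then
  the particles do not pass each other.\<close>

lemma reflected_bounds:
  assumes rej: "shift_prob \<gamma> z \<xi> < 1"
  shows "free_reach T z (\<xi> - reflect (sgn z) \<xi>) \<le> r + 2 * T * v \<xi>"
    and "particle_bound z (\<xi> - reflect (sgn z) \<xi>) \<le> r + (87 / 1000 * (\<gamma> * T) * r + 2174 / 1000 * (T * v \<xi>))"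
proof -
  let ?s = "sgn z \<bullet> \<xi>"
  have zs: "z \<bullet> \<xi> = r * ?s" using r0 by (simp add: r sgn_div_norm)
  have "0 < \<gamma> * (z \<bullet> \<xi>) + \<gamma>\<^sup>2 * (norm z)\<^sup>2 / 2" using rej by (simp add: shift_prob_def min_def split: if_splits)
  also have "\<dots> = (\<gamma> * r) * (?s + \<gamma> * r / 2)" by (simp add: zs r[symmetric] power2_eq_square algebra_simps)
  finally have "0 < ?s + \<gamma> * r / 2" by (rule zero_less_mult_pos) (use \<gamma>(1) r0 in simp)
  then have s: "- (\<gamma> * r / 2) < ?s" by simp
  have "z = r *\<^sub>R sgn z" using r0 by (simp add: r sgn_div_norm)
  then have "z + T *\<^sub>R (\<xi> - reflect (sgn z) \<xi>) = (r + 2 * T * ?s) *\<^sub>R sgn z"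
    by (simp add: reflect_def scaleR_add_left mult_ac)
  then have n: "norm (z + T *\<^sub>R (\<xi> - reflect (sgn z) \<xi>)) = \<bar>r + 2 * T * ?s\<bar>" using r0 by (simp add: r norm_sgn)
  have "2 * T * (- (\<gamma> * r / 2)) \<le> 2 * T * ?s" using s T by (intro mult_left_mono) auto
  moreover have "\<gamma> * T * r \<le> r" using \<gamma>(2) r0 by (simp add: mult_le_cancel_right1)
  ultimately have "0 \<le> r + 2 * T * ?s" by (simp add: algebra_simps)
  moreover have "2 * T * ?s \<le> 2 * T * v \<xi>" using T by (intro mult_left_mono) (auto simp: v_def)
  ultimately have n1: "norm (z + T *\<^sub>R (\<xi> - reflect (sgn z) \<xi>)) \<le> r + 2 * T * v \<xi>" unfolding n by simp
  have v0: "0 \<le> v \<xi>" by (simp add: v_def)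
  then show f: "free_reach T z (\<xi> - reflect (sgn z) \<xi>) \<le> r + 2 * T * v \<xi>"
    using n1 T by (simp add: free_reach_def r[symmetric])
  have "29 / 50 * (L * T\<^sup>2) * free_reach T z (\<xi> - reflect (sgn z) \<xi>) \<le> 29 / 50 * (L * T\<^sup>2) * (r + 2 * T * v \<xi>)"
    using f K by (intro mult_left_mono) auto
  also have "\<dots> = 29 / 50 * (L * T\<^sup>2) * r + 29 / 50 * (L * T\<^sup>2) * (2 * T * v \<xi>)" by (simp add: distrib_left)
  also have "\<dots> \<le> 29 / 50 * (3 / 20 * (\<gamma> * T)) * r + 29 / 50 * (3 / 20) * (2 * T * v \<xi>)"
    using \<gamma>(4) LT r0 v0 T by (intro add_mono mult_right_mono mult_left_mono) auto
  finally show "particle_bound z (\<xi> - reflect (sgn z) \<xi>) \<le> r + (87 / 1000 * (\<gamma> * T) * r + 2174 / 1000 * (T * v \<xi>))"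
    using n1 near unfolding particle_bound_def by (simp add: algebra_simps)
qed

lemma expectation_poly_v:
  assumes "0 \<le> q0" "0 \<le> q1" "0 \<le> q2"
  shows "(\<integral>\<^sup>+\<xi>. ennreal (q0 + q1 * v \<xi> + q2 * (v \<xi>)\<^sup>2) \<partial>std_gaussian) \<le> ennreal (q0 + 41 / 100 * q1 + 1 / 2 * q2)"
proof -
  have e: "norm (sgn z) = 1" using r0 r by (auto simp: norm_sgn)
  have "(\<integral>\<^sup>+\<xi>. ennreal (q0 + q1 * v \<xi> + q2 * (v \<xi>)\<^sup>2) \<partial>std_gaussian)
      = (\<integral>\<^sup>+\<xi>. (\<lambda>x. ennreal (q0 + q1 * max 0 x + q2 * (max 0 x)\<^sup>2)) (sgn z \<bullet> \<xi>) \<partial>std_gaussian)"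
    by (simp add: v_def)
  also have "\<dots> = (\<integral>\<^sup>+x. ennreal (q0 + q1 * max 0 x + q2 * (max 0 x)\<^sup>2) \<partial>std_normal_distribution)"
    by (rule nn_integral_std_gaussian_inner[OF e]) measurable
  also have "\<dots> = (\<integral>\<^sup>+x. ennreal q0 + ennreal q1 * ennreal (max 0 x) + ennreal q2 * ennreal ((max 0 x)\<^sup>2) \<partial>std_normal_distribution)"
    using assms by (intro nn_integral_cong) (simp add: ennreal_plus ennreal_mult)
  also have "\<dots> = ennreal q0 + ennreal q1 * (\<integral>\<^sup>+x. ennreal (max 0 x) \<partial>std_normal_distribution)
      + ennreal q2 * (\<integral>\<^sup>+x. ennreal ((max 0 x)\<^sup>2) \<partial>std_normal_distribution)"
    using prob_space.emeasure_space_1[OF prob_space_std_normal]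
    by (simp add: nn_integral_add nn_integral_cmult)
  also have "\<dots> \<le> ennreal q0 + ennreal q1 * ennreal (41 / 100) + ennreal q2 * ennreal (1 / 2)"
    by (intro add_mono mult_left_mono std_normal_positive_part order_refl) auto
  also have "\<dots> = ennreal (q0 + 41 / 100 * q1 + 1 / 2 * q2)"
  proof -
    have "ennreal q1 * ennreal (41 / 100) = ennreal (q1 * (41 / 100))"
      by (rule ennreal_mult[symmetric]) (use assms in auto)
    moreover have "ennreal q2 * ennreal (1 / 2) = ennreal (q2 * (1 / 2))"
      by (rule ennreal_mult[symmetric]) (use assms in auto)
    moreover have "ennreal (q0 + q1 * (41 / 100) + q2 * (1 / 2)) = ennreal q0 + ennreal (q1 * (41 / 100)) + ennreal (q2 * (1 / 2))"
      using assms by (subst ennreal_plus, simp, simp, subst ennreal_plus) auto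
    ultimately show ?thesis by (simp only: mult.commute)
  qed
  finally show ?thesis .
qed

lemma inner_expectation:
  fixes F :: "'a \<Rightarrow> real"
  assumes F0: "\<And>w. 0 \<le> F w"
  shows "(\<integral>\<^sup>+u. ennreal (F (\<xi> - couple_particle z \<xi> u)) \<partial>uniform01)
    = ennreal (shift_prob \<gamma> z \<xi> * F (\<xi> - (\<xi> + \<gamma> *\<^sub>R z)) + (1 - shift_prob \<gamma> z \<xi>) * F (\<xi> - reflect (sgn z) \<xi>))"
proof -
  have "(\<integral>\<^sup>+u. ennreal (F (\<xi> - couple_particle z \<xi> u)) \<partial>uniform01)
      = (\<integral>\<^sup>+u. (if u \<le> shift_prob \<gamma> z \<xi> then ennreal (F (\<xi> - (\<xi> + \<gamma> *\<^sub>R z))) else ennreal (F (\<xi> - reflect (sgn z) \<xi>))) \<partial>uniform01)"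
    using near by (intro nn_integral_cong) (simp add: couple_particle_def shift_reflect_def)
  then show ?thesis
    using F0 shift_prob_bounds[of \<gamma> z \<xi>]
    by (simp add: nn_integral_uniform01_threshold ennreal_mult[symmetric] ennreal_plus[symmetric] del: ennreal_plus)
qed

text \<open>In units of the slope at \<open>r\<close>, a shift gains \<open>\<gamma> T r\<close>. A reflection has a probability of about
  \<open>\<gamma> r / \<surd>(2 \<pi>)\<close>, and by the concavity of the profile it costs not much more than \<open>T\<close>, although the
  distance grows by \<open>2 T\<close> times a Gaussian. The numerical constants leave a margin between the two.\<close>

lemma near_profile_expectation:
  "(\<integral>\<^sup>+\<xi>. \<integral>\<^sup>+u. ennreal (profile (particle_bound z (\<xi> - couple_particle z \<xi> u))) \<partial>uniform01 \<partial>std_gaussian)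
    \<le> ennreal ((1 - 2 * c) * profile r)"
proof -
  define a where "a = slope r"
  have a: "0 < a" "a \<le> 1" using slope_bounds(2)[of r] r0 by (auto simp: a_def)
  \<comment> \<open>the gain of an accepted shift, with slope \<open>a\<close>:
    \<open>\<gamma> T r\<close> minus the error \<open>29/50 * 3/20 * \<gamma> T r\<close> of free motion\<close>
  define g where "g = 913 / 1000 * (\<gamma> * T) * r * a"
  have \<gamma>T: "0 \<le> \<gamma> * T" using \<gamma>(1) T by simp
  have g0: "0 \<le> g" unfolding g_def using \<gamma>T r0 a by simp
  have gT: "g \<le> 913 / 4000 * T * a"
  proof -
    have "g = 913 / 1000 * (T * a) * (\<gamma> * r)" by (simp add: g_def)
    also have "\<dots> \<le> 913 / 1000 * (T * a) * (1 / 4)" using \<gamma>(3) T a by (intro mult_left_mono) auto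
    finally show ?thesis by simp
  qed
  have g_le: "g \<le> profile r"
  proof -
    have "g = (913 / 1000 * (\<gamma> * T)) * (r * a)" by (simp add: g_def)
    also have "\<dots> \<le> 1 * (r * a)" using \<gamma>(2) r0 a by (intro mult_right_mono) auto
    also have "\<dots> \<le> profile r" using profile_ge_slope[of r] r0 by (simp add: a_def mult.commute)
    finally show ?thesis .
  qed
  \<comment> \<open>below \<open>R'\<close> there is room for a decrease of the slope by the factor \<open>exp (5 / 2)\<close>\<close>
  have R1r: "r \<le> R\<^sub>1" "exp (- ((R\<^sub>1 - r) / T)) \<le> 1 / 12"
  proof -
    have d: "5 / 2 * T \<le> R\<^sub>1 - r" unfolding R1_eq using near r R' by argo
    then show "r \<le> R\<^sub>1" using T by simp
    have "5 / 2 \<le> (R\<^sub>1 - r) / T" using d T by (simp add: field_simps)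
    then have "exp (- ((R\<^sub>1 - r) / T)) \<le> exp (- (5 / 2))" by simp
    then show "exp (- ((R\<^sub>1 - r) / T)) \<le> 1 / 12" by (rule order_trans[OF _ exp_m5_2(2)])
  qed
  define D where "D = \<gamma> * r * T * a"
  have D0: "0 \<le> D" unfolding D_def using \<gamma>(1) r0 T a by simp
  \<comment> \<open>coefficients of the quadratic polynomial in \<open>v \<xi>\<close> that bounds the cost;
    they are the rounded products of \<open>v \<xi> + 1/8\<close> from the rejection probability
    and the cost of a rejection\<close>
  define q0 where "q0 = profile r - g + 1538 / 10000 * D"
  define q1 where "q1 = 12529 / 10000 * D"
  define q2 where "q2 = 1812 / 10000 * D"
  have q: "0 \<le> q0" "0 \<le> q1" "0 \<le> q2" using g_le D0 by (auto simp: q0_def q1_def q2_def)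
  have pointwise: "(\<integral>\<^sup>+u. ennreal (profile (particle_bound z (\<xi> - couple_particle z \<xi> u))) \<partial>uniform01)
      \<le> ennreal (q0 + q1 * v \<xi> + q2 * (v \<xi>)\<^sup>2)" for \<xi>
  proof -
    define p where "p = shift_prob \<gamma> z \<xi>"
    have p: "0 \<le> p" "p \<le> 1" by (simp_all add: p_def shift_prob_bounds)
    have v0: "0 \<le> v \<xi>" by (simp add: v_def)
    define s where "s = 87 / 1000 * (\<gamma> * T) * r + 2174 / 1000 * (T * v \<xi>)"
    have s0: "0 \<le> s" using \<gamma>T r0 T v0 by (simp add: s_def)
    have sT: "s / 12 \<le> 19 / 10000 * T + 1812 / 10000 * (T * v \<xi>)"
    proof -
      have "87 / 1000 * (\<gamma> * T) * r = 87 / 1000 * T * (\<gamma> * r)" by simp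
      also have "\<dots> \<le> 87 / 1000 * T * (1 / 4)" using \<gamma>(3) T by (intro mult_left_mono) auto
      finally have A: "87 / 1000 * (\<gamma> * T) * r \<le> 87 / 4000 * T" by simp
      have "0 \<le> T * v \<xi>" using T v0 by simp
      moreover have "(x + 2174 / 1000 * y) / 12 \<le> 19 / 10000 * T + 1812 / 10000 * y"
        if "x \<le> 87 / 4000 * T" "0 \<le> y" for x y using that T by (simp add: field_simps)
      ultimately show ?thesis using A unfolding s_def by blast
    qed
    have succ: "profile (particle_bound z (\<xi> - (\<xi> + \<gamma> *\<^sub>R z))) \<le> profile r - g"
    proof -
      have "profile (particle_bound z (\<xi> - (\<xi> + \<gamma> *\<^sub>R z))) \<le> profile r + a * (particle_bound z (\<xi> - (\<xi> + \<gamma> *\<^sub>R z)) - r)"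
        unfolding a_def using r0 by (intro profile_concave particle_bound_nonneg) auto
      also have "a * (particle_bound z (\<xi> - (\<xi> + \<gamma> *\<^sub>R z)) - r) \<le> a * (- (913 / 1000 * (\<gamma> * T) * r))"
        using shifted_bounds(1)[of \<xi>] a by (intro mult_left_mono) auto
      finally show ?thesis by (simp add: g_def mult_ac)
    qed
    have fail: "(1 - p) * profile (particle_bound z (\<xi> - reflect (sgn z) \<xi>)) \<le> (1 - p) * (profile r + a * (T + s / 12))"
    proof (cases "p = 1")
      case False
      then have "shift_prob \<gamma> z \<xi> < 1" using p by (simp add: p_def)
      then have "profile (particle_bound z (\<xi> - reflect (sgn z) \<xi>)) \<le> profile (r + s)"
        unfolding s_def by (intro profile_mono particle_bound_nonneg reflected_bounds(2))
      also have "\<dots> \<le> profile r + a * (T + s * exp (- ((R\<^sub>1 - r) / T)))"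
        unfolding a_def using r0 R1r(1) s0 by (intro profile_increment_le) auto
      also have "\<dots> \<le> profile r + a * (T + s * (1 / 12))"
        using R1r(2) s0 a by (intro add_left_mono mult_left_mono) auto
      finally show ?thesis using p by (intro mult_left_mono) auto
    qed simp
    have "(1 - p) * (g + a * (T + s / 12)) \<le> (\<gamma> * r * (v \<xi> + 1 / 8)) * (a * T * (12302 / 10000 + 1812 / 10000 * v \<xi>))"
    proof (rule mult_mono)
      show "1 - p \<le> \<gamma> * r * (v \<xi> + 1 / 8)" unfolding p_def by (rule reject_prob_le)
      have "a * (s / 12) \<le> a * (19 / 10000 * T + 1812 / 10000 * (T * v \<xi>))" using sT a by (intro mult_left_mono) auto
      moreover have "0 \<le> T * a" using T a by simp
      ultimately show "g + a * (T + s / 12) \<le> a * T * (12302 / 10000 + 1812 / 10000 * v \<xi>)"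
        using gT by (simp add: algebra_simps)
      show "0 \<le> \<gamma> * r * (v \<xi> + 1 / 8)" using \<gamma>(1) r0 v0 by simp
      show "0 \<le> g + a * (T + s / 12)" using g0 a T s0 by simp
    qed
    also have "\<dots> = D * ((v \<xi> + 1 / 8) * (12302 / 10000 + 1812 / 10000 * v \<xi>))" by (simp add: D_def)
    also have "\<dots> \<le> D * (1538 / 10000 + 12529 / 10000 * v \<xi> + 1812 / 10000 * (v \<xi>)\<^sup>2)"
    proof (rule mult_left_mono[OF _ D0])
      have "(v \<xi> + 1 / 8) * (12302 / 10000 + 1812 / 10000 * v \<xi>)
          = 12302 / 80000 + (12302 / 10000 + 1812 / 80000) * v \<xi> + 1812 / 10000 * (v \<xi>)\<^sup>2"
        by (simp add: power2_eq_square field_simps)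
      then show "(v \<xi> + 1 / 8) * (12302 / 10000 + 1812 / 10000 * v \<xi>)
          \<le> 1538 / 10000 + 12529 / 10000 * v \<xi> + 1812 / 10000 * (v \<xi>)\<^sup>2"
        using v0 by simp
    qed
    finally have cost: "(1 - p) * (g + a * (T + s / 12)) \<le> D * (1538 / 10000 + 12529 / 10000 * v \<xi> + 1812 / 10000 * (v \<xi>)\<^sup>2)" .
    have "p * profile (particle_bound z (\<xi> - (\<xi> + \<gamma> *\<^sub>R z))) + (1 - p) * profile (particle_bound z (\<xi> - reflect (sgn z) \<xi>))
        \<le> p * (profile r - g) + (1 - p) * (profile r + a * (T + s / 12))"
      by (rule add_mono[OF mult_left_mono[OF succ p(1)] fail])
    also have "\<dots> = profile r - g + (1 - p) * (g + a * (T + s / 12))" by (simp add: algebra_simps)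
    also have "\<dots> \<le> q0 + q1 * v \<xi> + q2 * (v \<xi>)\<^sup>2"
      using cost by (simp add: q0_def q1_def q2_def algebra_simps)
    finally show ?thesis
      by (subst inner_expectation) (auto simp: p_def[symmetric] profile_nonneg particle_bound_nonneg intro!: ennreal_leI)
  qed
  have "(\<integral>\<^sup>+\<xi>. \<integral>\<^sup>+u. ennreal (profile (particle_bound z (\<xi> - couple_particle z \<xi> u))) \<partial>uniform01 \<partial>std_gaussian)
      \<le> (\<integral>\<^sup>+\<xi>. ennreal (q0 + q1 * v \<xi> + q2 * (v \<xi>)\<^sup>2) \<partial>std_gaussian)"
    by (intro nn_integral_mono pointwise)
  also have "\<dots> \<le> ennreal (q0 + 41 / 100 * q1 + 1 / 2 * q2)" by (rule expectation_poly_v[OF q])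
  also have "\<dots> \<le> ennreal ((1 - 2 * c) * profile r)"
  proof (rule ennreal_leI)
    have "g = 913 / 1000 * D" by (simp add: g_def D_def mult_ac)
    then have "q0 + 41 / 100 * q1 + 1 / 2 * q2 \<le> profile r - 15 / 100 * D"
      using D0 by (simp add: q0_def q1_def q2_def)
    moreover have "2 * c * profile r \<le> 15 / 100 * D"
    proof -
      have "5 / 16 * (8 / 100 * exp (- (5 * R' / (4 * T)))) \<le> (\<gamma> * T * (R\<^sub>1 / T)) * exp (- (R\<^sub>1 / T))"
        unfolding decay_split using exp_m5_2 \<gamma>(5) by (intro mult_mono) auto
      then have "5 / 16 * (8 / 100 * exp (- (5 * R' / (4 * T)))) * profile r \<le> (\<gamma> * T * (R\<^sub>1 / T)) * exp (- (R\<^sub>1 / T)) * profile r"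
        using r0 by (intro mult_right_mono profile_nonneg) auto
      also have "\<dots> = \<gamma> * T * (R\<^sub>1 / T * exp (- (R\<^sub>1 / T)) * profile r)" by simp
      also have "\<dots> \<le> \<gamma> * T * (slope r * r)" using \<gamma>T r0 by (intro mult_left_mono profile_slope_ratio) auto
      also have "\<dots> = D" by (simp add: D_def a_def)
      finally have A: "25 / 1000 * exp (- (5 * R' / (4 * T))) * profile r \<le> D" by simp
      have "2 * c * profile r = (2 / 156 * (K * T\<^sup>2)) * (exp (- (5 * R' / (4 * T))) * profile r)" by (simp add: c)
      also have "\<dots> \<le> (2 / 156 * (3 / 20)) * (exp (- (5 * R' / (4 * T))) * profile r)"
        using KT profile_nonneg[of r] r0 by (intro mult_right_mono mult_left_mono) auto
      also have "\<dots> \<le> 15 / 100 * (25 / 1000 * exp (- (5 * R' / (4 * T))) * profile r)"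
        using profile_nonneg[of r] r0 by simp
      also have "\<dots> \<le> 15 / 100 * D" using A by (intro mult_left_mono) auto
      finally show ?thesis .
    qed
    ultimately show "q0 + 41 / 100 * q1 + 1 / 2 * q2 \<le> (1 - 2 * c) * profile r" by (simp add: algebra_simps)
  qed
  finally show ?thesis .
qed

text \<open>A reflection changes the velocity by an amount of order \<open>1\<close>, but its probability is of order \<open>\<gamma> r\<close>.
  Hence the expected reach is a multiple of \<open>r\<close>.\<close>

lemma near_reach_expectation:
  "(\<integral>\<^sup>+\<xi>. \<integral>\<^sup>+u. ennreal (free_reach T z (\<xi> - couple_particle z \<xi> u)) \<partial>uniform01 \<partial>std_gaussian) \<le> ennreal (3 * r)"
proof -
  have pointwise: "(\<integral>\<^sup>+u. ennreal (free_reach T z (\<xi> - couple_particle z \<xi> u)) \<partial>uniform01)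
      \<le> ennreal (r + r / 4 * v \<xi> + 2 * r * (v \<xi>)\<^sup>2)" for \<xi>
  proof -
    define p where "p = shift_prob \<gamma> z \<xi>"
    have p: "0 \<le> p" "p \<le> 1" by (simp_all add: p_def shift_prob_bounds)
    have v0: "0 \<le> v \<xi>" by (simp add: v_def)
    have "(1 - p) * free_reach T z (\<xi> - reflect (sgn z) \<xi>) \<le> (1 - p) * (r + 2 * T * v \<xi>)"
    proof (cases "p = 1")
      case False
      then have "shift_prob \<gamma> z \<xi> < 1" using p by (simp add: p_def)
      then show ?thesis using p reflected_bounds(1)[of \<xi>] by (intro mult_left_mono) auto
    qed simp
    then have "p * free_reach T z (\<xi> - (\<xi> + \<gamma> *\<^sub>R z)) + (1 - p) * free_reach T z (\<xi> - reflect (sgn z) \<xi>)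
        \<le> p * r + (1 - p) * (r + 2 * T * v \<xi>)"
      by (rule add_mono[OF mult_left_mono[OF shifted_bounds(2) p(1)]])
    also have "\<dots> = r + (1 - p) * (2 * T * v \<xi>)" by (simp add: algebra_simps)
    also have "\<dots> \<le> r + \<gamma> * r * (v \<xi> + 1 / 8) * (2 * T * v \<xi>)"
      using reject_prob_le[of \<xi>] T v0 by (intro add_left_mono mult_right_mono) (auto simp: p_def)
    also have "\<dots> = r + (\<gamma> * T) * (2 * r * ((v \<xi> + 1 / 8) * v \<xi>))" by simp
    also have "\<dots> \<le> r + 1 * (2 * r * ((v \<xi> + 1 / 8) * v \<xi>))"
      using \<gamma>(2) r0 v0 by (intro add_left_mono mult_right_mono) auto
    also have "\<dots> = r + r / 4 * v \<xi> + 2 * r * (v \<xi>)\<^sup>2" by (simp add: power2_eq_square algebra_simps)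
    finally show ?thesis
      by (subst inner_expectation) (auto simp: p_def[symmetric] free_reach_nonneg intro!: ennreal_leI)
  qed
  have "(\<integral>\<^sup>+\<xi>. \<integral>\<^sup>+u. ennreal (free_reach T z (\<xi> - couple_particle z \<xi> u)) \<partial>uniform01 \<partial>std_gaussian)
      \<le> (\<integral>\<^sup>+\<xi>. ennreal (r + r / 4 * v \<xi> + 2 * r * (v \<xi>)\<^sup>2) \<partial>std_gaussian)"
    by (intro nn_integral_mono pointwise)
  also have "\<dots> \<le> ennreal (r + 41 / 100 * (r / 4) + 1 / 2 * (2 * r))" using r0 by (intro expectation_poly_v) auto
  also have "\<dots> \<le> ennreal (3 * r)" using r0 by (intro ennreal_leI) simp
  finally show ?thesis .
qed

end

lemma couple_particle_0: "couple_particle 0 \<xi> u = \<xi>"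
  by (simp add: couple_particle_def shift_reflect_def reflect_def)

lemma particle_expectation:
  fixes z :: "'a::euclidean_space"
  shows "(\<integral>\<^sup>+\<xi>. \<integral>\<^sup>+u. ennreal (profile (particle_bound z (\<xi> - couple_particle z \<xi> u))) \<partial>uniform01 \<partial>std_gaussian)
      \<le> ennreal ((1 - 2 * c) * profile (norm z))" (is "?P")
    and "(\<integral>\<^sup>+\<xi>. \<integral>\<^sup>+u. ennreal (free_reach T z (\<xi> - couple_particle z \<xi> u)) \<partial>uniform01 \<partial>std_gaussian)
      \<le> ennreal (3 * norm z)" (is "?F")
proof -
  have one: "emeasure uniform01 UNIV = 1" "emeasure (std_gaussian :: 'a measure) UNIV = 1"
    using prob_space.emeasure_space_1[OF prob_space_uniform01]
      prob_space.emeasure_space_1[OF prob_space_std_gaussian[where ?'a = 'a]] by simp_all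
  consider "norm z < R'" "0 < norm z" | "R' \<le> norm z" | "z = 0" "norm z < R'" by fastforce
  then have "?P \<and> ?F"
  proof cases
    case 1
    then show ?thesis using near_profile_expectation[OF 1(1) refl] near_reach_expectation[OF 1(1) refl] by simp
  next
    case 2
    then show ?thesis
      using profile_far[of "norm z"] by (simp add: couple_particle_def particle_bound_def free_reach_def one ennreal_leI)
  next
    case 3
    then show ?thesis
      by (simp add: couple_particle_0 particle_bound_def free_reach_def one profile_0)
  qed
  then show ?P ?F by blast+
qed

end

section \<open>Independent particles\<close>

lemma vec_nth_borel_measurable [measurable (raw)]:
  fixes f :: "'a \<Rightarrow> 'b::euclidean_space^'n"
  assumes [measurable]: "f \<in> borel_measurable M"
  shows "(\<lambda>x. f x $ i) \<in> borel_measurable M"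
proof -
  have "(\<lambda>x::'b^'n. x $ i) \<in> borel_measurable borel"
    by (intro borel_measurable_continuous_onI continuous_intros)
  then show ?thesis by measurable
qed

lemma vec_lambda_borel_measurable [measurable (raw)]:
  fixes f :: "'n::finite \<Rightarrow> 'a \<Rightarrow> 'b::euclidean_space"
  assumes [measurable]: "\<And>i. f i \<in> borel_measurable M"
  shows "(\<lambda>x. \<chi> i. f i x) \<in> borel_measurable M"
proof (rule borel_measurable_euclidean_space[THEN iffD2], rule ballI)
  fix e :: "'b^'n" assume "e \<in> Basis"
  then obtain i u where "e = axis i u" by (auto simp: Basis_vec_def)
  then show "(\<lambda>x. (\<chi> i. f i x) \<bullet> e) \<in> borel_measurable M" by (simp add: inner_axis)
qed

lemma emeasure_std_gaussian_box:
  "emeasure (std_gaussian :: 'a::euclidean_space measure) (box l u)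
    = (\<Prod>b\<in>Basis. emeasure std_normal_distribution {l \<bullet> b<..<u \<bullet> b})"
proof -
  have "emeasure (std_gaussian :: 'a measure) (box l u) = (\<integral>\<^sup>+x. indicator (box l u) x \<partial>(std_gaussian :: 'a measure))"
    by (simp add: nn_integral_indicator)
  also have "\<dots> = (\<integral>\<^sup>+x. (\<Prod>b\<in>Basis. indicator {l \<bullet> b<..<u \<bullet> b} (x \<bullet> b)) \<partial>(std_gaussian :: 'a measure))"
    by (intro nn_integral_cong) (auto simp: indicator_def mem_box prod_eq_1_iff)
  also have "\<dots> = (\<Prod>b\<in>Basis. \<integral>\<^sup>+x. indicator {l \<bullet> b<..<u \<bullet> b} x \<partial>std_normal_distribution)"
    by (rule nn_integral_std_gaussian_prod) auto
  finally show ?thesis by simp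
qed

text \<open>Boxes are stable under intersection and generate the Borel sets.\<close>

lemma std_gaussian_eqI:
  assumes sets: "sets M = sets borel" and "prob_space M"
    and box: "\<And>l u. emeasure M (box l u) = (\<Prod>b\<in>Basis. emeasure std_normal_distribution {l \<bullet> b<..<u \<bullet> b})"
  shows "M = (std_gaussian :: 'a::euclidean_space measure)"
proof -
  let ?E = "range (\<lambda>(a, b). box a b :: 'a set)"
  interpret M: prob_space M by fact
  show ?thesis
  proof (rule measure_eqI_generator_eq)
    show "Int_stable ?E" by (auto simp: Int_stable_def box_Int_box)
    show "?E \<subseteq> Pow UNIV" "sets M = sigma_sets UNIV ?E" "sets std_gaussian = sigma_sets UNIV ?E"
      by (simp_all add: borel_eq_box sets)
    let ?A = "\<lambda>n::nat. box (- (real n *\<^sub>R One)) (real n *\<^sub>R One) :: 'a set"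
    show "range ?A \<subseteq> ?E" "(\<Union>i. ?A i) = UNIV" unfolding UN_box_eq_UNIV by auto
    show "emeasure M (?A i) \<noteq> \<infinity>" for i by simp
    show "emeasure M X = emeasure std_gaussian X" if X: "X \<in> ?E" for X
    proof -
      obtain a b where "X = box a b" using X by auto
      then show ?thesis by (simp only: box emeasure_std_gaussian_box)
    qed
  qed
qed

lemma prod_Basis_vec:
  fixes f :: "'a::euclidean_space^'n \<Rightarrow> 'c::comm_monoid_mult"
  shows "(\<Prod>b\<in>Basis. f b) = (\<Prod>i\<in>UNIV. \<Prod>u\<in>Basis. f (axis i u))"
proof -
  let ?g = "\<lambda>(i, u). axis i u :: 'a^'n"
  have inj: "inj_on ?g (UNIV \<times> Basis)"
    by (auto simp: inj_on_def axis_eq_axis nonzero_Basis)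
  have "(Basis :: ('a^'n) set) = ?g ` (UNIV \<times> Basis)" by (auto simp: Basis_vec_def)
  then have "(\<Prod>b\<in>Basis. f b) = prod f (?g ` (UNIV \<times> Basis))" by (rule arg_cong)
  also have "\<dots> = (\<Prod>(i, u)\<in>UNIV \<times> Basis. f (axis i u))"
    by (subst prod.reindex[OF inj]) (simp add: comp_def case_prod_unfold)
  finally have "(\<Prod>b\<in>Basis. f b) = (\<Prod>(i, u)\<in>UNIV \<times> Basis. f (axis i u))" .
  then show ?thesis by (simp add: prod.cartesian_product)
qed

abbreviation particle_velocities :: "('n::finite \<Rightarrow> 'a::euclidean_space) measure" where
  "particle_velocities \<equiv> PiM UNIV (\<lambda>_. std_gaussian)"

lemma product_prob_std_gaussian: "product_prob_space (\<lambda>_. std_gaussian :: 'a::euclidean_space measure)"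
proof -
  interpret prob_space "std_gaussian :: 'a measure" by (rule prob_space_std_gaussian)
  show ?thesis by unfold_locales
qed

lemma product_prob_uniform01: "product_prob_space (\<lambda>_. uniform01)"
proof -
  interpret prob_space uniform01 by (rule prob_space_uniform01)
  show ?thesis by unfold_locales
qed

text \<open>The coordinates of a vector of vectors are those of its blocks, so that both sides agree on boxes.\<close>

lemma std_gaussian_particles:
  "distr particle_velocities borel (\<lambda>\<xi>. \<chi> i. \<xi> i) = (std_gaussian :: ('a::euclidean_space^'n) measure)"
proof (rule std_gaussian_eqI)
  interpret product_prob_space "\<lambda>_::'n. std_gaussian :: 'a measure" UNIV by (rule product_prob_std_gaussian)
  interpret P: prob_space "particle_velocities :: ('n \<Rightarrow> 'a) measure" by (rule prob_space_PiM) (rule prob_space_std_gaussian)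
  show "prob_space (distr particle_velocities borel (\<lambda>\<xi>. \<chi> i. \<xi> i :: 'a^'n))"
    by (rule P.prob_space_distr) measurable
  fix l u :: "'a^'n"
  have "emeasure (distr particle_velocities borel (\<lambda>\<xi>. \<chi> i. \<xi> i)) (box l u)
      = emeasure particle_velocities (\<Pi>\<^sub>E i\<in>UNIV. box (l $ i) (u $ i))"
  proof (subst emeasure_distr)
    have "(\<lambda>\<xi>. \<chi> i. \<xi> i) -` box l u \<inter> space particle_velocities = (\<Pi>\<^sub>E i\<in>UNIV. box (l $ i) (u $ i))"
      by (fastforce simp: space_PiM mem_box Basis_vec_def inner_axis PiE_UNIV_domain)
    then show "emeasure particle_velocities ((\<lambda>\<xi>. \<chi> i. \<xi> i) -` box l u \<inter> space particle_velocities)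
      = emeasure particle_velocities (\<Pi>\<^sub>E i\<in>UNIV. box (l $ i) (u $ i))" by simp
  qed auto
  also have "\<dots> = (\<Prod>i\<in>UNIV. emeasure std_gaussian (box (l $ i) (u $ i)))"
    by (rule emeasure_PiM) auto
  also have "\<dots> = (\<Prod>b\<in>Basis. emeasure std_normal_distribution {l \<bullet> b<..<u \<bullet> b})"
    by (simp add: emeasure_std_gaussian_box prod_Basis_vec inner_axis)
  finally show "emeasure (distr particle_velocities borel (\<lambda>\<xi>. \<chi> i. \<xi> i)) (box l u)
      = (\<Prod>b\<in>Basis. emeasure std_normal_distribution {l \<bullet> b<..<u \<bullet> b})" .
qed simp

lemma nn_integral_particles:
  fixes f :: "'a::euclidean_space^'n \<Rightarrow> ennreal"
  assumes [measurable]: "f \<in> borel_measurable borel"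
  shows "(\<integral>\<^sup>+\<xi>. f \<xi> \<partial>std_gaussian) = (\<integral>\<^sup>+\<xi>. f (\<chi> i. \<xi> i) \<partial>particle_velocities)"
  unfolding std_gaussian_particles[symmetric] by (rule nn_integral_distr) measurable

lemma (in product_prob_space) nn_integral_PiM_component:
  assumes "finite I" "i \<in> I" and [measurable]: "f \<in> borel_measurable (M i)"
  shows "(\<integral>\<^sup>+x. f (x i) \<partial>PiM I M) = (\<integral>\<^sup>+x. f x \<partial>M i)"
proof -
  define g where "g j = (if j = i then f else (\<lambda>_. 1))" for j
  have "(\<integral>\<^sup>+x. f (x i) \<partial>PiM I M) = (\<integral>\<^sup>+x. (\<Prod>j\<in>I. g j (x j)) \<partial>PiM I M)"
  proof (rule nn_integral_cong)
    fix x
    have "(\<Prod>j\<in>I. g j (x j)) = (\<Prod>j\<in>I. if j = i then f (x i) else 1)" by (rule prod.cong) (auto simp: g_def)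
    then show "f (x i) = (\<Prod>j\<in>I. g j (x j))" using assms by simp
  qed
  also have "\<dots> = (\<Prod>j\<in>I. integral\<^sup>N (M j) (g j))"
    by (rule product_nn_integral_prod) (use assms in \<open>auto simp: g_def\<close>)
  also have "\<dots> = (\<Prod>j\<in>I. if j = i then integral\<^sup>N (M i) f else 1)"
    by (rule prod.cong) (auto simp: g_def M.emeasure_space_1)
  finally show ?thesis using assms by simp
qed

abbreviation uniforms :: "('n::finite \<Rightarrow> real) measure" where
  "uniforms \<equiv> PiM UNIV (\<lambda>_. uniform01)"

lemma prob_space_uniforms: "prob_space uniforms"
  by (rule prob_space_PiM) (rule prob_space_uniform01)

lemma nn_integral_one_particle:
  fixes f :: "'a::euclidean_space \<Rightarrow> real \<Rightarrow> ennreal" and i :: "'n::finite"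
  assumes [measurable]: "case_prod f \<in> borel_measurable (borel \<Otimes>\<^sub>M borel)"
  shows "(\<integral>\<^sup>+\<xi>. \<integral>\<^sup>+u. f (\<xi> $ i) (u i) \<partial>uniforms \<partial>(std_gaussian :: ('a^'n) measure))
    = (\<integral>\<^sup>+\<xi>. \<integral>\<^sup>+u. f \<xi> u \<partial>uniform01 \<partial>std_gaussian)"
proof -
  interpret U: product_prob_space "\<lambda>_::'n. uniform01" UNIV by (rule product_prob_uniform01)
  interpret G: product_prob_space "\<lambda>_::'n. std_gaussian :: 'a measure" UNIV by (rule product_prob_std_gaussian)
  interpret u: prob_space uniform01 by (rule prob_space_uniform01)
  have "(\<integral>\<^sup>+u. f \<xi> (u i) \<partial>uniforms) = (\<integral>\<^sup>+u. f \<xi> u \<partial>uniform01)" for \<xi>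
    by (rule U.nn_integral_PiM_component) auto
  then have "(\<integral>\<^sup>+\<xi>. \<integral>\<^sup>+u. f (\<xi> $ i) (u i) \<partial>uniforms \<partial>(std_gaussian :: ('a^'n) measure))
      = (\<integral>\<^sup>+\<xi>. \<integral>\<^sup>+u. f (\<xi> $ i) u \<partial>uniform01 \<partial>(std_gaussian :: ('a^'n) measure))" by simp
  also have "\<dots> = (\<integral>\<^sup>+\<xi>. \<integral>\<^sup>+u. f (\<xi> i) u \<partial>uniform01 \<partial>(particle_velocities :: ('n \<Rightarrow> 'a) measure))"
    by (subst nn_integral_particles) auto
  also have "\<dots> = (\<integral>\<^sup>+\<xi>. \<integral>\<^sup>+u. f \<xi> u \<partial>uniform01 \<partial>std_gaussian)"
    by (rule G.nn_integral_PiM_component) auto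
  finally show ?thesis .
qed

text \<open>Transforming every particle by a map that preserves the Gaussian distribution preserves the
  joint distribution.\<close>

lemma distr_particlewise:
  fixes C :: "'n::finite \<Rightarrow> 'a::euclidean_space \<Rightarrow> real \<Rightarrow> 'a"
  assumes meas [measurable]: "\<And>i. case_prod (C i) \<in> borel_measurable (borel \<Otimes>\<^sub>M borel)"
    and C: "\<And>i f. f \<in> borel_measurable borel \<Longrightarrow>
      (\<integral>\<^sup>+\<xi>. \<integral>\<^sup>+u. f (C i \<xi> u) \<partial>uniform01 \<partial>std_gaussian) = (\<integral>\<^sup>+\<xi>. (f \<xi> :: ennreal) \<partial>std_gaussian)"
  shows "distr (std_gaussian \<Otimes>\<^sub>M uniforms) borel (\<lambda>(\<xi>, u). \<chi> i. C i (\<xi> $ i) (u i)) = (std_gaussian :: ('a^'n) measure)"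
proof -
  interpret U: product_prob_space "\<lambda>_::'n. uniform01" UNIV by (rule product_prob_uniform01)
  interpret G: product_prob_space "\<lambda>_::'n. std_gaussian :: 'a measure" UNIV by (rule product_prob_std_gaussian)
  interpret u: prob_space uniform01 by (rule prob_space_uniform01)
  let ?P = "particle_velocities :: ('n \<Rightarrow> 'a) measure"
  let ?S = "std_gaussian \<Otimes>\<^sub>M uniforms :: (('a^'n) \<times> ('n \<Rightarrow> real)) measure"
  have M: "(\<lambda>(\<xi>, u) i. C i (\<xi> $ i) (u i)) \<in> ?S \<rightarrow>\<^sub>M ?P"
    unfolding case_prod_unfold by (intro measurable_PiM_single') (auto simp: space_PiM PiE_UNIV_domain)
  have "distr ?S ?P (\<lambda>(\<xi>, u) i. C i (\<xi> $ i) (u i)) = ?P"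
  proof (rule G.PiM_eqI)
    fix A :: "'n \<Rightarrow> 'a set" assume A: "\<And>i. i \<in> UNIV \<Longrightarrow> A i \<in> sets std_gaussian"
    then have [measurable]: "A i \<in> sets borel" for i by simp
    have "emeasure (distr ?S ?P (\<lambda>(\<xi>, u) i. C i (\<xi> $ i) (u i))) (Pi\<^sub>E UNIV A)
        = (\<integral>\<^sup>+\<omega>. indicator (Pi\<^sub>E UNIV A) ((\<lambda>(\<xi>, u) i. C i (\<xi> $ i) (u i)) \<omega>) \<partial>?S)"
      using A by (subst nn_integral_distr[symmetric, OF M]) (auto intro!: sets_PiM_I_finite)
    also have "\<dots> = (\<integral>\<^sup>+\<omega>. (\<Prod>i\<in>UNIV. indicator (A i) (C i (fst \<omega> $ i) (snd \<omega> i))) \<partial>?S)"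
      by (intro nn_integral_cong) (auto simp: indicator_def PiE_UNIV_domain Pi_iff intro!: prod.neutral)
    also have "\<dots> = (\<integral>\<^sup>+\<xi>. \<integral>\<^sup>+u. (\<Prod>i\<in>UNIV. indicator (A i) (C i (\<xi> $ i) (u i))) \<partial>uniforms \<partial>std_gaussian)"
      by (subst sigma_finite_measure.nn_integral_fst[OF prob_space_imp_sigma_finite[OF prob_space_uniforms], symmetric]) (auto simp: case_prod_unfold)
    also have "\<dots> = (\<integral>\<^sup>+\<xi>. (\<Prod>i\<in>UNIV. \<integral>\<^sup>+u. indicator (A i) (C i (\<xi> $ i) u) \<partial>uniform01) \<partial>(std_gaussian :: ('a^'n) measure))"
      by (intro nn_integral_cong U.product_nn_integral_prod) auto
    also have "\<dots> = (\<integral>\<^sup>+\<xi>. (\<Prod>i\<in>UNIV. \<integral>\<^sup>+u. indicator (A i) (C i (\<xi> i) u) \<partial>uniform01) \<partial>?P)"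
      by (subst nn_integral_particles) auto
    also have "\<dots> = (\<Prod>i\<in>UNIV. \<integral>\<^sup>+\<xi>. \<integral>\<^sup>+u. indicator (A i) (C i \<xi> u) \<partial>uniform01 \<partial>std_gaussian)"
      by (rule G.product_nn_integral_prod) auto
    also have "\<dots> = (\<Prod>i\<in>UNIV. emeasure std_gaussian (A i))"
      by (intro prod.cong refl) (subst C, auto)
    finally show "emeasure (distr ?S ?P (\<lambda>(\<xi>, u) i. C i (\<xi> $ i) (u i))) (Pi\<^sub>E UNIV A) = (\<Prod>i\<in>UNIV. emeasure std_gaussian (A i))" .
  qed auto
  then have "std_gaussian = distr (distr ?S ?P (\<lambda>(\<xi>, u) i. C i (\<xi> $ i) (u i))) borel (\<lambda>\<xi>. \<chi> i. \<xi> i :: 'a^'n)"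
    by (simp add: std_gaussian_particles)
  also have "\<dots> = distr ?S borel (\<lambda>(\<xi>, u). \<chi> i. C i (\<xi> $ i) (u i))"
    by (subst distr_distr[OF _ M]) (auto simp: comp_def case_prod_unfold)
  finally show ?thesis ..
qed

section \<open>Contraction of one step\<close>

lemma (in distance_profile) profile_measurable [measurable]: "profile \<in> borel_measurable borel"
proof (rule borel_measurable_mono, rule monoI)
  fix a b :: real assume "a \<le> b"
  have neg: "profile a = 0" if "a < 0" for a using that by (simp add: dist_profile_def)
  show "profile a \<le> profile b"
  proof (cases "0 \<le> a")
    case True then show ?thesis using \<open>a \<le> b\<close> by (intro profile_mono)
  next
    case False
    then show ?thesis using neg[of a] neg[of b] profile_nonneg[of b] by (cases "0 \<le> b") auto
  qed
qed

lemma norm_le_free_motion: "norm a \<le> norm (b + c) + norm (a - b - c)" for a :: "'a::real_normed_vector"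
  using norm_triangle_ineq[of "b + c" "a - b - c"] by simp

locale hmc_contraction =
  F?: mean_field_force b g L K l R' T + C?: coupling_parameters K L R' T R\<^sub>1 c
  for b :: "real^'d^'n \<Rightarrow> real^'d^'n" and g L K l R' T R\<^sub>1 c +
  fixes U :: "real^'d^'n \<Rightarrow> real" and h :: real
  assumes b: "b = force U" and h: "0 \<le> h" "h = 0 \<or> T / h \<in> \<nat>"
    and l_small: "l \<le> K / 10 ^ 8 * exp (- (3 * (R' / T)))"
begin

abbreviation position :: "real^'d^'n \<Rightarrow> real^'d^'n \<Rightarrow> real^'d^'n" where
  "position \<equiv> hmc_position U T h"

definition couple :: "real^'d^'n \<Rightarrow> real^'d^'n \<Rightarrow> real^'d^'n \<Rightarrow> ('n \<Rightarrow> real) \<Rightarrow> real^'d^'n" where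
  "couple x y \<xi> u = (\<chi> i. couple_particle (x $ i - y $ i) (\<xi> $ i) (u i))"

lemma couple_particle_measurable [measurable (raw)]:
  fixes f1 f2 :: "'b \<Rightarrow> 'a::euclidean_space"
  assumes [measurable]: "f1 \<in> borel_measurable M" "f2 \<in> borel_measurable M" "u \<in> borel_measurable M"
  shows "(\<lambda>x. couple_particle (f1 x) (f2 x) (u x)) \<in> borel_measurable M"
  unfolding couple_particle_def by measurable

lemma couple_law: "distr (std_gaussian \<Otimes>\<^sub>M uniforms) borel (\<lambda>(\<xi>, u). couple x y \<xi> u) = std_gaussian"
  unfolding couple_def
proof (rule distr_particlewise)
  fix i and f :: "real^'d \<Rightarrow> ennreal" assume [measurable]: "f \<in> borel_measurable borel"
  show "(\<integral>\<^sup>+\<xi>. \<integral>\<^sup>+u. f (couple_particle (x $ i - y $ i) \<xi> u) \<partial>uniform01 \<partial>std_gaussian) = (\<integral>\<^sup>+\<xi>. f \<xi> \<partial>std_gaussian)"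
    using prob_space.emeasure_space_1[OF prob_space_uniform01]
    by (cases "R' \<le> norm (x $ i - y $ i)") (simp_all add: couple_particle_def nn_integral_shift_reflect)
qed measurable

lemma couple_measurable [measurable (raw)]:
  assumes [measurable]: "f1 \<in> borel_measurable M" "f2 \<in> borel_measurable M" "f3 \<in> borel_measurable M" "f4 \<in> M \<rightarrow>\<^sub>M uniforms"
  shows "(\<lambda>x. couple (f1 x) (f2 x) (f3 x) (f4 x)) \<in> borel_measurable M"
proof -
  have [measurable]: "(\<lambda>x. f4 x i) \<in> borel_measurable M" for i
    using measurable_compose[OF assms(4) measurable_component_singleton[of i UNIV "\<lambda>_. uniform01"]]
    by (simp add: measurable_cong_sets[OF refl sets_uniform01])
  show ?thesis unfolding couple_def by measurable
qed

text \<open>This gives measurability and continuity of the random map, and a moment of its image of \<open>0\<close>.\<close>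

lemma position_lipschitz:
  obtains C where "0 \<le> C" "\<And>x y \<xi> \<eta>. norm (position x \<xi> - position y \<eta>) \<le> C * (norm (x - y) + norm (\<xi> - \<eta>))"
proof (rule that)
  let ?n = "real CARD('n)"
  have lT: "l * T\<^sup>2 \<le> 1"
  proof -
    have "l * T\<^sup>2 \<le> K / 10 ^ 8 * T\<^sup>2" using F.l by (intro mult_right_mono) auto
    then show ?thesis using C.KT by simp
  qed
  show "0 \<le> ?n * (5 * (1 + T))" using F.T by simp
  fix x y \<xi> \<eta> :: "real^'d^'n"
  define s where "s = norm (x - y) + T * norm (\<xi> - \<eta>)"
  have s0: "0 \<le> s" using F.T by (simp add: s_def)
  have reach: "free_reach T ((x - y) $ i) ((\<xi> - \<eta>) $ i) \<le> s" for i
  proof -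
    have "norm ((x - y) $ i) \<le> norm (x - y)" "norm ((\<xi> - \<eta>) $ i) \<le> norm (\<xi> - \<eta>)"
      by (rule Finite_Cartesian_Product.norm_nth_le)+
    moreover from this(2) have "T * norm ((\<xi> - \<eta>) $ i) \<le> T * norm (\<xi> - \<eta>)" using F.T by (intro mult_left_mono) auto
    moreover have "norm ((x - y) $ i + T *\<^sub>R (\<xi> - \<eta>) $ i) \<le> norm ((x - y) $ i) + T * norm ((\<xi> - \<eta>) $ i)"
      using F.T norm_triangle_ineq[of "(x - y) $ i" "T *\<^sub>R (\<xi> - \<eta>) $ i"] by simp
    moreover have "0 \<le> T * norm (\<xi> - \<eta>)" using F.T by simp
    ultimately have "norm ((x - y) $ i) \<le> s" "norm ((x - y) $ i + T *\<^sub>R (\<xi> - \<eta>) $ i) \<le> s"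
      unfolding s_def by linarith+
    then show ?thesis by (simp only: free_reach_def max.bounded_iff)
  qed
  have X: "interaction l T (x - y) (\<xi> - \<eta>) \<le> 8 / 7 * s"
  proof -
    have "(\<Sum>i\<in>UNIV. free_reach T ((x - y) $ i) ((\<xi> - \<eta>) $ i)) \<le> ?n * s"
      using sum_bounded_above[of UNIV "\<lambda>i. free_reach T ((x - y) $ i) ((\<xi> - \<eta>) $ i)"] reach by simp
    then have "interaction l T (x - y) (\<xi> - \<eta>) \<le> 8 / 7 * (l * T\<^sup>2 / ?n) * (?n * s)"
      unfolding interaction_def using F.l by (intro mult_left_mono) auto
    also have "\<dots> = 8 / 7 * (l * T\<^sup>2) * s" by simp
    also have "\<dots> \<le> 8 / 7 * 1 * s" using lT s0 by (intro mult_right_mono) auto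
    finally show ?thesis by simp
  qed
  have "norm (position x \<xi> $ i - position y \<eta> $ i) \<le> 5 * s" for i
  proof -
    have "norm (position x \<xi> $ i - position y \<eta> $ i)
        \<le> norm (x $ i - y $ i + T *\<^sub>R (\<xi> $ i - \<eta> $ i)) + norm (position x \<xi> $ i - position y \<eta> $ i - (x $ i - y $ i) - T *\<^sub>R (\<xi> $ i - \<eta> $ i))"
      by (rule norm_le_free_motion)
    also have "norm (x $ i - y $ i + T *\<^sub>R (\<xi> $ i - \<eta> $ i)) \<le> s" using reach[of i] by (simp add: free_reach_def)
    also have "norm (position x \<xi> $ i - position y \<eta> $ i - (x $ i - y $ i) - T *\<^sub>R (\<xi> $ i - \<eta> $ i))
        \<le> 29 / 50 * (L * T\<^sup>2) * free_reach T ((x - y) $ i) ((\<xi> - \<eta>) $ i) + 8 / 7 * interaction l T (x - y) (\<xi> - \<eta>)"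
      by (rule hmc_free_motion[OF b h])
    also have "\<dots> \<le> 1 * s + 8 / 7 * (8 / 7 * s)"
    proof (rule add_mono)
      show "29 / 50 * (L * T\<^sup>2) * free_reach T ((x - y) $ i) ((\<xi> - \<eta>) $ i) \<le> 1 * s"
        by (rule mult_mono[OF _ reach _ free_reach_nonneg]) (use C.LT in auto)
      show "8 / 7 * interaction l T (x - y) (\<xi> - \<eta>) \<le> 8 / 7 * (8 / 7 * s)"
        using X by (rule mult_left_mono) simp
    qed
    finally show ?thesis using s0 by simp
  qed
  then have "(\<Sum>i\<in>UNIV. norm ((position x \<xi> - position y \<eta>) $ i)) \<le> ?n * (5 * s)"
    using sum_bounded_above[of UNIV "\<lambda>i. norm ((position x \<xi> - position y \<eta>) $ i)"] by simp
  then have "norm (position x \<xi> - position y \<eta>) \<le> ?n * (5 * s)"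
    using norm_vec_le_sum[of "position x \<xi> - position y \<eta>"] by linarith
  also have "\<dots> \<le> ?n * (5 * ((1 + T) * (norm (x - y) + norm (\<xi> - \<eta>))))"
    using F.T by (intro mult_left_mono) (auto simp: s_def algebra_simps)
  finally show "norm (position x \<xi> - position y \<eta>) \<le> ?n * (5 * (1 + T)) * (norm (x - y) + norm (\<xi> - \<eta>))"
    by (simp only: mult.assoc)
qed

lemma position_measurable [measurable (raw)]:
  assumes [measurable]: "f1 \<in> borel_measurable M" "f2 \<in> borel_measurable M"
  shows "(\<lambda>x. position (f1 x) (f2 x)) \<in> borel_measurable M"
proof -
  obtain C where C: "0 \<le> C" "\<And>x y \<xi> \<eta>. norm (position x \<xi> - position y \<eta>) \<le> C * (norm (x - y) + norm (\<xi> - \<eta>))"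
    using position_lipschitz by blast
  have "continuous_on UNIV (\<lambda>z. position (fst z) (snd z))"
  proof (rule lipschitz_on_continuous_on, rule lipschitz_onI)
    show "0 \<le> C * 2" using C by simp
    fix z z' :: "(real^'d^'n) \<times> (real^'d^'n)"
    have "norm (fst z - fst z') + norm (snd z - snd z') \<le> 2 * norm (z - z')"
      using norm_fst_le[of "fst (z - z')" "snd (z - z')"] norm_snd_le[of "snd (z - z')" "fst (z - z')"]
      by (simp add: minus_prod_def)
    then show "dist (position (fst z) (snd z)) (position (fst z') (snd z')) \<le> C * 2 * dist z z'"
      using order_trans[OF C(2) mult_left_mono[OF _ C(1)]] by (simp only: dist_norm mult.assoc)
  qed
  then have position: "(\<lambda>z. position (fst z) (snd z)) \<in> borel_measurable borel" by (rule borel_measurable_continuous_onI)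
  have "(\<lambda>x. (f1 x, f2 x)) \<in> borel_measurable M" by (intro borel_measurable_Pair assms)
  from measurable_compose[OF this position] show ?thesis by simp
qed

lemma rho_measurable [measurable (raw)]:
  assumes [measurable]: "f1 \<in> borel_measurable M" "f2 \<in> borel_measurable M"
  shows "(\<lambda>x. rho R\<^sub>1 T (f1 x) (f2 x :: real^'d^'n)) \<in> borel_measurable M"
  unfolding rho_def by measurable

lemma rho_nonneg: "0 \<le> rho R\<^sub>1 T (x :: real^'d^'n) y"
  unfolding rho_def by (intro sum_nonneg profile_nonneg) simp

lemma rho_le_ell1: "rho R\<^sub>1 T x y \<le> ell1 x (y :: real^'d^'n)"
  unfolding rho_def ell1_def by (intro sum_mono profile_le) simp

lemma ell1_le_rho: "exp (- (R\<^sub>1 / T)) * ell1 x (y :: real^'d^'n) \<le> rho R\<^sub>1 T x y"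
  unfolding rho_def ell1_def sum_distrib_left by (intro sum_mono profile_ge) simp

text \<open>The weakness of the interaction makes up for two factors \<open>exp (- 5 R' / (4 T))\<close>: one in the rate \<open>c\<close>, and
  one lost in the comparison of \<open>\<ell>\<^sup>1\<close> with \<open>\<rho>\<close>.\<close>

lemma interaction_small: "72 / 7 * (l * T\<^sup>2) \<le> c * exp (- (R\<^sub>1 / T))"
proof -
  define \<rho> where "\<rho> = R' / T"
  have \<rho>: "0 \<le> \<rho>" using F.R' F.T by (simp add: \<rho>_def)
  have e: "exp (- (5 * R' / (4 * T))) = exp (- (5 / 4 * \<rho>))" by (simp add: \<rho>_def)
  have "72 / 7 * (l * T\<^sup>2) \<le> 72 / 7 * ((K / 10 ^ 8 * exp (- (3 * \<rho>))) * T\<^sup>2)"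
    using l_small by (intro mult_left_mono mult_right_mono) (auto simp: \<rho>_def)
  also have "\<dots> = (K * T\<^sup>2) * (72 / (7 * 10 ^ 8)) * exp (- (3 * \<rho>))" by simp
  also have "\<dots> \<le> (K * T\<^sup>2) * (8 / (156 * 100)) * exp (- (5 / 2 * \<rho>))"
    using F.K \<rho> by (intro mult_mono) auto
  also have "exp (- (5 / 2 * \<rho>)) = exp (- (5 / 4 * \<rho>)) * exp (- (5 / 4 * \<rho>))" by (simp flip: exp_add)
  also have "(K * T\<^sup>2) * (8 / (156 * 100)) * (exp (- (5 / 4 * \<rho>)) * exp (- (5 / 4 * \<rho>)))
      = c * (8 / 100 * exp (- (5 / 4 * \<rho>)))"
    by (simp add: C.c e)
  also have "\<dots> \<le> c * exp (- (R\<^sub>1 / T))"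
    unfolding decay_split e using exp_m5_2(1) C.KT by (intro mult_left_mono mult_right_mono) (auto simp: C.c)
  finally show ?thesis .
qed

lemma c_bounds: "0 < c" "c < 1"
proof -
  show "0 < c" using C.KT by (simp add: C.c)
  have "exp (- (5 * R' / (4 * T))) \<le> 1" using F.R' F.T by simp
  then have "K * T\<^sup>2 * exp (- (5 * R' / (4 * T))) \<le> 3 / 20 * 1" using C.KT by (intro mult_mono) auto
  then show "c < 1" by (simp add: C.c)
qed

text \<open>The profile is \<open>1\<close>-Lipschitz, which separates the motion of a pair from the influence of the others.\<close>

lemma position_distance:
  fixes x y \<xi> :: "real^'d^'n" and u
  defines "z \<equiv> \<lambda>i. x $ i - y $ i"
  defines "w \<equiv> \<lambda>i. \<xi> $ i - couple_particle (z i) (\<xi> $ i) (u i)"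
  shows "rho R\<^sub>1 T (position x \<xi>) (position y (couple x y \<xi> u))
    \<le> (\<Sum>i\<in>UNIV. profile (particle_bound (z i) (w i))) + 24 / 7 * (l * T\<^sup>2) * (\<Sum>i\<in>UNIV. free_reach T (z i) (w i))"
proof -
  let ?\<eta> = "couple x y \<xi> u"
  define X where "X = interaction l T (x - y) (\<xi> - ?\<eta>)"
  have X0: "0 \<le> X" by (simp add: X_def interaction_nonneg F.l)
  have w: "w i = (\<xi> - ?\<eta>) $ i" "z i = (x - y) $ i" for i by (simp_all add: w_def z_def couple_def)
  have "profile (norm (position x \<xi> $ i - position y ?\<eta> $ i)) \<le> profile (particle_bound (z i) (w i)) + 3 * X" for i
  proof -
    have "norm (position x \<xi> $ i - position y ?\<eta> $ i) \<le> particle_bound (z i) (w i) + 3 * X"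
    proof (cases "R' \<le> norm (z i)")
      case True
      then have "\<xi> $ i = ?\<eta> $ i" by (simp add: couple_def couple_particle_def z_def)
      then show ?thesis
        using hmc_contraction[OF b h, of x i y \<xi> ?\<eta>] True by (simp add: X_def particle_bound_def z_def)
    next
      case False
      have "norm (position x \<xi> $ i - position y ?\<eta> $ i) \<le> norm (z i + T *\<^sub>R w i)
          + norm (position x \<xi> $ i - position y ?\<eta> $ i - (x $ i - y $ i) - T *\<^sub>R (\<xi> $ i - ?\<eta> $ i))"
        using norm_le_free_motion[of "position x \<xi> $ i - position y ?\<eta> $ i" "x $ i - y $ i" "T *\<^sub>R (\<xi> $ i - ?\<eta> $ i)"]
        by (simp add: w)
      also have "norm (position x \<xi> $ i - position y ?\<eta> $ i - (x $ i - y $ i) - T *\<^sub>R (\<xi> $ i - ?\<eta> $ i))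
          \<le> 29 / 50 * (L * T\<^sup>2) * free_reach T (z i) (w i) + 8 / 7 * X"
        unfolding w X_def by (rule hmc_free_motion[OF b h])
      finally show ?thesis using False X0 by (simp add: particle_bound_def)
    qed
    then have "profile (norm (position x \<xi> $ i - position y ?\<eta> $ i)) \<le> profile (particle_bound (z i) (w i) + 3 * X)"
      by (intro profile_mono) auto
    also have "\<dots> \<le> profile (particle_bound (z i) (w i)) + 3 * X"
      using X0 by (intro profile_add_le particle_bound_nonneg) auto
    finally show ?thesis .
  qed
  then have "rho R\<^sub>1 T (position x \<xi>) (position y ?\<eta>) \<le> (\<Sum>i\<in>(UNIV::'n set). profile (particle_bound (z i) (w i)) + 3 * X)"
    unfolding rho_def by (rule sum_mono)
  also have "\<dots> = (\<Sum>i\<in>UNIV. profile (particle_bound (z i) (w i))) + real CARD('n) * (3 * X)"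
    by (simp add: sum.distrib)
  also have "real CARD('n) * (3 * X) = 24 / 7 * (l * T\<^sup>2) * (\<Sum>i\<in>UNIV. free_reach T (z i) (w i))"
    by (simp add: X_def interaction_def w)
  finally show ?thesis .
qed

text \<open>The expected cost of the interaction is a multiple of \<open>l T\<^sup>2\<close> times the \<open>\<ell>\<^sup>1\<close> distance, which is
  at most \<open>exp (R\<^sub>1 / T)\<close> times \<open>\<rho>\<close>. Since \<open>l\<close> is exponentially small, it uses up at most half
  of the contraction of the single particles.\<close>

lemma one_step_contraction:
  "(\<integral>\<^sup>+\<xi>. \<integral>\<^sup>+u. ennreal (rho R\<^sub>1 T (position x \<xi>) (position y (couple x y \<xi> u))) \<partial>uniforms \<partial>std_gaussian)
    \<le> ennreal ((1 - c) * rho R\<^sub>1 T x y)"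
proof -
  define z where "z i = x $ i - y $ i" for i
  define k where "k = 24 / 7 * (l * T\<^sup>2)"
  have k0: "0 \<le> k" using F.l by (simp add: k_def)
  let ?w = "\<lambda>i \<xi> u. \<xi> - couple_particle (z i) \<xi> u"
  have [measurable]: "(\<lambda>(\<xi>, u). ennreal (profile (particle_bound (z i) (?w i \<xi> u)))) \<in> borel_measurable (borel \<Otimes>\<^sub>M borel)"
    "(\<lambda>(\<xi>, u). ennreal (free_reach T (z i) (?w i \<xi> u))) \<in> borel_measurable (borel \<Otimes>\<^sub>M borel)" for i
    unfolding particle_bound_def free_reach_def by measurable
  interpret us: sigma_finite_measure "uniforms :: ('n \<Rightarrow> real) measure"
    by (rule prob_space_imp_sigma_finite[OF prob_space_uniforms])
  have m: "(\<lambda>(\<xi>, u). ennreal (profile (particle_bound (z i) (?w i (\<xi> $ i) (u i))))) \<in> borel_measurable (borel \<Otimes>\<^sub>M uniforms)"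
    "(\<lambda>(\<xi>, u). ennreal (free_reach T (z i) (?w i (\<xi> $ i) (u i)))) \<in> borel_measurable (borel \<Otimes>\<^sub>M uniforms)" for i :: 'n
    unfolding particle_bound_def free_reach_def by measurable
  have "(\<integral>\<^sup>+\<xi>. \<integral>\<^sup>+u. ennreal (rho R\<^sub>1 T (position x \<xi>) (position y (couple x y \<xi> u))) \<partial>uniforms \<partial>std_gaussian)
      \<le> (\<integral>\<^sup>+\<xi>. \<integral>\<^sup>+u. (\<Sum>i\<in>UNIV. ennreal (profile (particle_bound (z i) (?w i (\<xi> $ i) (u i))))
           + ennreal k * ennreal (free_reach T (z i) (?w i (\<xi> $ i) (u i)))) \<partial>uniforms \<partial>std_gaussian)"
  proof (intro nn_integral_mono)
    fix \<xi> u
    have "ennreal (rho R\<^sub>1 T (position x \<xi>) (position y (couple x y \<xi> u)))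
       \<le> ennreal (\<Sum>i\<in>UNIV. profile (particle_bound (z i) (?w i (\<xi> $ i) (u i))) + k * free_reach T (z i) (?w i (\<xi> $ i) (u i)))"
      using position_distance[of x \<xi> y u] by (intro ennreal_leI) (simp add: z_def k_def sum.distrib sum_distrib_left)
    also have "\<dots> = (\<Sum>i\<in>UNIV. ennreal (profile (particle_bound (z i) (?w i (\<xi> $ i) (u i)))
           + k * free_reach T (z i) (?w i (\<xi> $ i) (u i))))"
      using k0 by (intro sum_ennreal[symmetric] add_nonneg_nonneg mult_nonneg_nonneg profile_nonneg particle_bound_nonneg free_reach_nonneg)
    also have "\<dots> = (\<Sum>i\<in>UNIV. ennreal (profile (particle_bound (z i) (?w i (\<xi> $ i) (u i))))
           + ennreal k * ennreal (free_reach T (z i) (?w i (\<xi> $ i) (u i))))"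
      using k0 by (intro sum.cong refl) (simp add: ennreal_plus ennreal_mult profile_nonneg particle_bound_nonneg free_reach_nonneg)
    finally show "ennreal (rho R\<^sub>1 T (position x \<xi>) (position y (couple x y \<xi> u))) \<le> \<dots>" .
  qed
  also have "\<dots> = (\<Sum>i\<in>UNIV. (\<integral>\<^sup>+\<xi>. \<integral>\<^sup>+u. ennreal (profile (particle_bound (z i) (?w i (\<xi> $ i) (u i)))) \<partial>uniforms \<partial>std_gaussian)
      + ennreal k * (\<integral>\<^sup>+\<xi>. \<integral>\<^sup>+u. ennreal (free_reach T (z i) (?w i (\<xi> $ i) (u i))) \<partial>uniforms \<partial>std_gaussian))"
    using m by (simp add: nn_integral_sum nn_integral_add nn_integral_cmult)
  also have "\<dots> \<le> (\<Sum>i\<in>(UNIV::'n set). ennreal ((1 - 2 * c) * profile (norm (z i))) + ennreal k * ennreal (3 * norm (z i)))"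
  proof (intro sum_mono add_mono mult_left_mono)
    fix i :: 'n
    show "(\<integral>\<^sup>+\<xi>. \<integral>\<^sup>+u. ennreal (profile (particle_bound (z i) (?w i (\<xi> $ i) (u i)))) \<partial>uniforms \<partial>(std_gaussian :: (real^'d^'n) measure))
        \<le> ennreal ((1 - 2 * c) * profile (norm (z i)))"
      by (subst nn_integral_one_particle[of "\<lambda>\<xi> u. ennreal (profile (particle_bound (z i) (?w i \<xi> u)))"])
        (simp_all add: particle_expectation)
    show "(\<integral>\<^sup>+\<xi>. \<integral>\<^sup>+u. ennreal (free_reach T (z i) (?w i (\<xi> $ i) (u i))) \<partial>uniforms \<partial>(std_gaussian :: (real^'d^'n) measure))
        \<le> ennreal (3 * norm (z i))"
      by (subst nn_integral_one_particle[of "\<lambda>\<xi> u. ennreal (free_reach T (z i) (?w i \<xi> u))"])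
        (simp_all add: particle_expectation)
  qed simp
  also have "\<dots> \<le> (\<Sum>i\<in>(UNIV::'n set). ennreal ((1 - c) * profile (norm (z i))))"
  proof (rule sum_mono)
    fix i :: 'n
    let ?r = "norm (z i)"
    have p: "0 \<le> profile ?r" by (simp add: profile_nonneg)
    have c2: "0 \<le> 1 - 2 * c"
    proof -
      have "exp (- (5 * R' / (4 * T))) \<le> 1" using F.R' F.T by simp
      then have "K * T\<^sup>2 * exp (- (5 * R' / (4 * T))) \<le> 3 / 20 * 1" using C.KT by (intro mult_mono) auto
      then show ?thesis by (simp add: C.c)
    qed
    have "72 / 7 * (l * T\<^sup>2) * ?r \<le> c * exp (- (R\<^sub>1 / T)) * ?r"
      using interaction_small by (rule mult_right_mono) simp
    also have "\<dots> \<le> c * profile ?r"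
      using profile_ge[of ?r] c_bounds(1) by (simp add: mult.assoc mult_left_mono)
    finally have "k * (3 * ?r) \<le> c * profile ?r" by (simp add: k_def)
    then have "(1 - 2 * c) * profile ?r + k * (3 * ?r) \<le> (1 - c) * profile ?r" by (simp add: algebra_simps)
    moreover have "ennreal ((1 - 2 * c) * profile ?r) + ennreal k * ennreal (3 * ?r) = ennreal ((1 - 2 * c) * profile ?r + k * (3 * ?r))"
      using k0 p c2 by (subst ennreal_plus) (auto simp: ennreal_mult)
    ultimately show "ennreal ((1 - 2 * c) * profile ?r) + ennreal k * ennreal (3 * ?r) \<le> ennreal ((1 - c) * profile ?r)"
      by (simp add: ennreal_leI)
  qed
  also have "\<dots> = ennreal ((1 - c) * rho R\<^sub>1 T x y)"
    using c_bounds by (subst sum_ennreal) (auto simp: rho_def z_def sum_distrib_left profile_nonneg)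
  finally show ?thesis .
qed

end

section \<open>Contraction in Wasserstein distance\<close>

lemma le_cmult_INF:
  fixes f :: "'i \<Rightarrow> ennreal"
  assumes k: "0 < k" and le: "\<And>i. i \<in> I \<Longrightarrow> a \<le> ennreal k * f i"
  shows "a \<le> ennreal k * (INF i\<in>I. f i)"
proof -
  have inv: "ennreal (1 / k) * (ennreal k * x) = x" "ennreal k * (ennreal (1 / k) * x) = x" for x
    using k by (simp_all add: mult.assoc[symmetric] ennreal_mult[symmetric])
  have "ennreal (1 / k) * a \<le> (INF i\<in>I. f i)"
  proof (rule INF_greatest)
    fix i assume "i \<in> I"
    then have "ennreal (1 / k) * a \<le> ennreal (1 / k) * (ennreal k * f i)" by (intro mult_left_mono le) auto
    then show "ennreal (1 / k) * a \<le> f i" by (simp only: inv)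
  qed
  then have "ennreal k * (ennreal (1 / k) * a) \<le> ennreal k * (INF i\<in>I. f i)" by (rule mult_left_mono) simp
  then show ?thesis by (simp only: inv)
qed

lemma wasserstein_mono:
  "(\<And>x y. \<delta> x y \<le> \<delta>' x y) \<Longrightarrow> wasserstein \<delta> \<nu> \<eta> \<le> wasserstein \<delta>' \<nu> \<eta>"
  unfolding wasserstein_def by (intro INF_mono' nn_integral_mono) (auto intro: ennreal_leI)

lemma wasserstein_le_cmult:
  assumes k: "0 < k" and le: "\<And>x y. \<delta> x y \<le> k * \<delta>' x y"
    and meas: "case_prod \<delta>' \<in> borel_measurable (\<nu> \<Otimes>\<^sub>M \<eta>)"
  shows "wasserstein \<delta> \<nu> \<eta> \<le> ennreal k * wasserstein \<delta>' \<nu> \<eta>"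
  unfolding wasserstein_def[of \<delta>']
proof (rule le_cmult_INF[OF k])
  fix \<omega> assume \<omega>: "\<omega> \<in> couplings \<nu> \<eta>"
  then have sets: "sets \<omega> = sets (\<nu> \<Otimes>\<^sub>M \<eta>)" by (simp add: couplings_def space_prob_algebra)
  have "case_prod \<delta>' \<in> borel_measurable \<omega>" using meas by (simp add: measurable_cong_sets[OF sets refl])
  from measurable_compose[OF this measurable_ennreal]
  have [measurable]: "(\<lambda>p. ennreal (\<delta>' (fst p) (snd p))) \<in> borel_measurable \<omega>" by (simp add: case_prod_unfold)
  have "wasserstein \<delta> \<nu> \<eta> \<le> (\<integral>\<^sup>+(x, y). ennreal (\<delta> x y) \<partial>\<omega>)"
    unfolding wasserstein_def using \<omega> by (rule INF_lower)
  also have "\<dots> \<le> (\<integral>\<^sup>+(x, y). ennreal k * ennreal (\<delta>' x y) \<partial>\<omega>)"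
    using k le by (intro nn_integral_mono) (auto simp: ennreal_mult'[symmetric] intro!: ennreal_leI)
  also have "\<dots> = ennreal k * (\<integral>\<^sup>+(x, y). ennreal (\<delta>' x y) \<partial>\<omega>)"
    by (subst nn_integral_cmult[symmetric]) (auto simp: case_prod_unfold)
  finally show "wasserstein \<delta> \<nu> \<eta> \<le> ennreal k * (\<integral>\<^sup>+(x, y). ennreal (\<delta>' x y) \<partial>\<omega>)" .
qed

text \<open>A Markov kernel given by a random map \<open>q\<close> with noise distribution \<open>G\<close>, together with a coupling
  of the noises of two copies, which may depend on their positions \<open>x\<close>, \<open>y\<close> and on additional
  randomness \<open>H\<close>, and which is contractive in expectation.\<close>

locale contractive_coupling =
  fixes G :: "'w measure" and H :: "'u measure" and q :: "'a::euclidean_space \<Rightarrow> 'w \<Rightarrow> 'a"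
    and \<Phi> :: "'a \<Rightarrow> 'a \<Rightarrow> 'w \<Rightarrow> 'u \<Rightarrow> 'w" and \<rho> :: "'a \<Rightarrow> 'a \<Rightarrow> real" and \<kappa> :: real
  assumes prob_G: "prob_space G" and prob_H: "prob_space H"
    and q_measurable: "(\<lambda>(x, w). q x w) \<in> borel_measurable (borel \<Otimes>\<^sub>M G)"
    and \<Phi>_measurable: "(\<lambda>((x, y), (w, u)). \<Phi> x y w u) \<in> (borel \<Otimes>\<^sub>M borel) \<Otimes>\<^sub>M (G \<Otimes>\<^sub>M H) \<rightarrow>\<^sub>M G"
    and \<Phi>_law: "distr (G \<Otimes>\<^sub>M H) G (\<lambda>(w, u). \<Phi> x y w u) = G"
    and \<rho>_measurable: "case_prod \<rho> \<in> borel_measurable (borel \<Otimes>\<^sub>M borel)" and \<rho>_nonneg: "0 \<le> \<rho> x y"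
    and \<kappa>: "0 < \<kappa>" "\<kappa> < 1"
    and contraction: "(\<integral>\<^sup>+w. \<integral>\<^sup>+u. ennreal (\<rho> (q x w) (q y (\<Phi> x y w u))) \<partial>H \<partial>G) \<le> ennreal (\<kappa> * \<rho> x y)"
begin

sublocale G: prob_space G by (rule prob_G)
sublocale H: prob_space H by (rule prob_H)
sublocale GH: pair_prob_space G H ..

definition kernel :: "'a \<Rightarrow> 'a measure" where
  "kernel x = distr G borel (q x)"

text \<open>One coupled step of two copies of the chain. Both marginals are given by \<open>kernel\<close>.\<close>

definition pair_kernel :: "'a \<times> 'a \<Rightarrow> ('a \<times> 'a) measure" where
  "pair_kernel = (\<lambda>(x, y). distr (G \<Otimes>\<^sub>M H) (borel \<Otimes>\<^sub>M borel) (\<lambda>(w, u). (q x w, q y (\<Phi> x y w u))))"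

lemma q_meas [measurable (raw)]:
  assumes [measurable]: "f \<in> borel_measurable M" "g \<in> M \<rightarrow>\<^sub>M G"
  shows "(\<lambda>x. q (f x) (g x)) \<in> borel_measurable M"
proof -
  have "(\<lambda>x. (f x, g x)) \<in> M \<rightarrow>\<^sub>M borel \<Otimes>\<^sub>M G" by measurable
  from measurable_compose[OF this q_measurable] show ?thesis by simp
qed

lemma \<Phi>_meas [measurable (raw)]:
  assumes [measurable]: "f1 \<in> borel_measurable M" "f2 \<in> borel_measurable M" "f3 \<in> M \<rightarrow>\<^sub>M G" "f4 \<in> M \<rightarrow>\<^sub>M H"
  shows "(\<lambda>x. \<Phi> (f1 x) (f2 x) (f3 x) (f4 x)) \<in> M \<rightarrow>\<^sub>M G"
proof -
  have "(\<lambda>x. ((f1 x, f2 x), (f3 x, f4 x))) \<in> M \<rightarrow>\<^sub>M (borel \<Otimes>\<^sub>M borel) \<Otimes>\<^sub>M (G \<Otimes>\<^sub>M H)" by measurable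
  from measurable_compose[OF this \<Phi>_measurable] show ?thesis by simp
qed

lemma \<rho>_meas [measurable (raw)]:
  assumes [measurable]: "f \<in> borel_measurable M" "g \<in> borel_measurable M"
  shows "(\<lambda>x. \<rho> (f x) (g x)) \<in> borel_measurable M"
proof -
  have "(\<lambda>x. (f x, g x)) \<in> M \<rightarrow>\<^sub>M borel \<Otimes>\<^sub>M borel" by measurable
  from measurable_compose[OF this \<rho>_measurable] show ?thesis by simp
qed

lemma G_in_prob_algebra: "G \<in> space (prob_algebra G)"
  by (simp add: space_prob_algebra prob_G)

lemma kernel_measurable [measurable]: "kernel \<in> borel \<rightarrow>\<^sub>M prob_algebra borel"
  unfolding kernel_def
  by (rule measurable_distr_prob_space2[OF measurable_const[OF G_in_prob_algebra] q_measurable])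

lemma pair_kernel_measurable [measurable]: "pair_kernel \<in> borel \<Otimes>\<^sub>M borel \<rightarrow>\<^sub>M prob_algebra (borel \<Otimes>\<^sub>M borel)"
proof -
  have "G \<Otimes>\<^sub>M H \<in> space (prob_algebra (G \<Otimes>\<^sub>M H))"
    by (simp add: space_prob_algebra GH.prob_space_axioms)
  moreover have "(\<lambda>(z, (w, u)). (q (fst z) w, q (snd z) (\<Phi> (fst z) (snd z) w u)))
      \<in> (borel \<Otimes>\<^sub>M borel) \<Otimes>\<^sub>M (G \<Otimes>\<^sub>M H) \<rightarrow>\<^sub>M borel \<Otimes>\<^sub>M borel" by measurable
  ultimately have "(\<lambda>z. distr (G \<Otimes>\<^sub>M H) (borel \<Otimes>\<^sub>M borel) ((\<lambda>z (w, u). (q (fst z) w, q (snd z) (\<Phi> (fst z) (snd z) w u))) z))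
      \<in> borel \<Otimes>\<^sub>M borel \<rightarrow>\<^sub>M prob_algebra (borel \<Otimes>\<^sub>M borel)"
    by (intro measurable_distr_prob_space2[OF measurable_const]) (auto simp: case_prod_unfold)
  then show ?thesis by (simp add: pair_kernel_def case_prod_unfold)
qed

lemma kernel_sub [measurable]: "kernel \<in> borel \<rightarrow>\<^sub>M subprob_algebra borel"
  by (rule measurable_prob_algebraD) measurable

lemma pair_kernel_sub [measurable]: "pair_kernel \<in> borel \<Otimes>\<^sub>M borel \<rightarrow>\<^sub>M subprob_algebra (borel \<Otimes>\<^sub>M borel)"
  by (rule measurable_prob_algebraD) measurable

lemma pair_kernel_marginals:
  "distr (pair_kernel z) borel fst = kernel (fst z)" "distr (pair_kernel z) borel snd = kernel (snd z)"
proof -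
  obtain x y where z: "z = (x, y)" by (cases z)
  have "distr (pair_kernel z) borel fst = distr (G \<Otimes>\<^sub>M H) borel (q x \<circ> fst)"
    unfolding z pair_kernel_def prod.case by (subst distr_distr) (auto simp: comp_def case_prod_unfold)
  also have "\<dots> = distr (distr (G \<Otimes>\<^sub>M H) G fst) borel (q x)" by (subst distr_distr) auto
  also have "distr (G \<Otimes>\<^sub>M H) G fst = G" by (rule H.distr_pair_fst)
  finally show "distr (pair_kernel z) borel fst = kernel (fst z)" by (simp add: z kernel_def)
  have "distr (pair_kernel z) borel snd = distr (G \<Otimes>\<^sub>M H) borel (q y \<circ> (\<lambda>(w, u). \<Phi> x y w u))"
    unfolding z pair_kernel_def prod.case by (subst distr_distr) (auto simp: comp_def case_prod_unfold)
  also have "\<dots> = distr (distr (G \<Otimes>\<^sub>M H) G (\<lambda>(w, u). \<Phi> x y w u)) borel (q y)" by (subst distr_distr) auto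
  also have "distr (G \<Otimes>\<^sub>M H) G (\<lambda>(w, u). \<Phi> x y w u) = G" by (rule \<Phi>_law)
  finally show "distr (pair_kernel z) borel snd = kernel (snd z)" by (simp add: z kernel_def)
qed

lemma nn_integral_pair_kernel:
  assumes [measurable]: "f \<in> borel_measurable (borel \<Otimes>\<^sub>M borel)"
  shows "(\<integral>\<^sup>+p. f p \<partial>pair_kernel (x, y)) = (\<integral>\<^sup>+w. \<integral>\<^sup>+u. f (q x w, q y (\<Phi> x y w u)) \<partial>H \<partial>G)"
  unfolding pair_kernel_def prod.case
  by (subst nn_integral_distr) (auto simp: H.nn_integral_fst[symmetric] case_prod_unfold)

lemma couplings_iff:
  assumes "sets \<nu> = sets borel" "sets \<eta> = sets borel"
  shows "\<omega> \<in> couplings \<nu> \<eta> \<longleftrightarrow> \<omega> \<in> space (prob_algebra (borel \<Otimes>\<^sub>M borel)) \<and> distr \<omega> borel fst = \<nu> \<and> distr \<omega> borel snd = \<eta>"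
proof -
  have "sets (\<nu> \<Otimes>\<^sub>M \<eta>) = sets (borel \<Otimes>\<^sub>M borel)" using assms by (rule sets_pair_measure_cong)
  moreover have "distr \<omega> \<nu> fst = distr \<omega> borel fst" "distr \<omega> \<eta> snd = distr \<omega> borel snd"
    using assms by (auto intro!: distr_cong)
  ultimately show ?thesis by (simp add: couplings_def space_prob_algebra)
qed

lemma bind_kernel_prob: "\<nu> \<in> space (prob_algebra borel) \<Longrightarrow> \<nu> \<bind> kernel \<in> space (prob_algebra borel)"
  using measurable_space[OF measurable_bind_prob_space[OF measurable_ident kernel_measurable]] by simp

lemma bind_pair_kernel_prob:
  "\<omega> \<in> space (prob_algebra (borel \<Otimes>\<^sub>M borel)) \<Longrightarrow> \<omega> \<bind> pair_kernel \<in> space (prob_algebra (borel \<Otimes>\<^sub>M borel))"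
  using measurable_space[OF measurable_bind_prob_space[OF measurable_ident pair_kernel_measurable]] by simp

lemma coupling_step:
  assumes \<nu>: "\<nu> \<in> space (prob_algebra borel)" and \<eta>: "\<eta> \<in> space (prob_algebra borel)" and \<omega>: "\<omega> \<in> couplings \<nu> \<eta>"
  shows "\<omega> \<bind> pair_kernel \<in> couplings (\<nu> \<bind> kernel) (\<eta> \<bind> kernel)"
proof -
  have \<omega>': "\<omega> \<in> space (prob_algebra (borel \<Otimes>\<^sub>M borel))" "distr \<omega> borel fst = \<nu>" "distr \<omega> borel snd = \<eta>"
    using \<omega> \<nu> \<eta> by (auto simp: couplings_iff space_prob_algebra)
  have sets: "sets \<omega> = sets (borel \<Otimes>\<^sub>M borel)" using \<omega>' by (simp add: space_prob_algebra)
  have ne: "space \<omega> \<noteq> {}" using sets_eq_imp_space_eq[OF sets] by (simp add: space_pair_measure)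
  have K: "pair_kernel \<in> \<omega> \<rightarrow>\<^sub>M subprob_algebra (borel \<Otimes>\<^sub>M borel)"
    using pair_kernel_sub by (simp add: measurable_cong_sets[OF sets refl])
  have F: "fst \<in> \<omega> \<rightarrow>\<^sub>M borel" "snd \<in> \<omega> \<rightarrow>\<^sub>M borel" by (simp_all add: measurable_cong_sets[OF sets refl])
  have "distr (\<omega> \<bind> pair_kernel) borel fst = \<omega> \<bind> (\<lambda>z. kernel (fst z))"
    by (subst distr_bind[OF K ne]) (auto simp: pair_kernel_marginals)
  also have "\<dots> = \<nu> \<bind> kernel"
    unfolding \<omega>'(2)[symmetric] by (rule bind_distr[OF F(1) kernel_sub ne, symmetric])
  finally have 1: "distr (\<omega> \<bind> pair_kernel) borel fst = \<nu> \<bind> kernel" .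
  have "distr (\<omega> \<bind> pair_kernel) borel snd = \<omega> \<bind> (\<lambda>z. kernel (snd z))"
    by (subst distr_bind[OF K ne]) (auto simp: pair_kernel_marginals)
  also have "\<dots> = \<eta> \<bind> kernel"
    unfolding \<omega>'(3)[symmetric] by (rule bind_distr[OF F(2) kernel_sub ne, symmetric])
  finally have 2: "distr (\<omega> \<bind> pair_kernel) borel snd = \<eta> \<bind> kernel" .
  show ?thesis
    using bind_kernel_prob[OF \<nu>] bind_kernel_prob[OF \<eta>] bind_pair_kernel_prob[OF \<omega>'(1)] 1 2
    by (simp add: couplings_iff space_prob_algebra)
qed

lemma nn_integral_bind_pair_kernel:
  assumes \<omega>: "\<omega> \<in> space (prob_algebra (borel \<Otimes>\<^sub>M borel))" and [measurable]: "f \<in> borel_measurable (borel \<Otimes>\<^sub>M borel)"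
  shows "(\<integral>\<^sup>+p. f p \<partial>(\<omega> \<bind> pair_kernel)) = (\<integral>\<^sup>+p. \<integral>\<^sup>+p'. f p' \<partial>pair_kernel p \<partial>\<omega>)"
proof (rule nn_integral_bind)
  have sets: "sets \<omega> = sets (borel \<Otimes>\<^sub>M borel)" using \<omega> by (simp add: space_prob_algebra)
  show "pair_kernel \<in> \<omega> \<rightarrow>\<^sub>M subprob_algebra (borel \<Otimes>\<^sub>M borel)"
    using pair_kernel_sub by (simp add: measurable_cong_sets[OF sets refl])
qed measurable

lemma wasserstein_step:
  assumes \<nu>: "\<nu> \<in> space (prob_algebra borel)" and \<eta>: "\<eta> \<in> space (prob_algebra borel)"
  shows "wasserstein \<rho> (\<nu> \<bind> kernel) (\<eta> \<bind> kernel) \<le> ennreal \<kappa> * wasserstein \<rho> \<nu> \<eta>"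
  unfolding wasserstein_def[of \<rho> \<nu>]
proof (rule le_cmult_INF[OF \<kappa>(1)])
  fix \<omega> assume \<omega>: "\<omega> \<in> couplings \<nu> \<eta>"
  then have \<omega>': "\<omega> \<in> space (prob_algebra (borel \<Otimes>\<^sub>M borel))"
    using \<nu> \<eta> by (auto simp: couplings_iff space_prob_algebra)
  then have sets [measurable_cong]: "sets \<omega> = sets (borel \<Otimes>\<^sub>M borel)" by (simp add: space_prob_algebra)
  have "wasserstein \<rho> (\<nu> \<bind> kernel) (\<eta> \<bind> kernel) \<le> (\<integral>\<^sup>+(x, y). ennreal (\<rho> x y) \<partial>(\<omega> \<bind> pair_kernel))"
    unfolding wasserstein_def using coupling_step[OF \<nu> \<eta> \<omega>] by (rule INF_lower)
  also have "\<dots> = (\<integral>\<^sup>+p. \<integral>\<^sup>+(x, y). ennreal (\<rho> x y) \<partial>pair_kernel p \<partial>\<omega>)"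
    by (rule nn_integral_bind_pair_kernel[OF \<omega>']) measurable
  also have "\<dots> \<le> (\<integral>\<^sup>+(x, y). ennreal \<kappa> * ennreal (\<rho> x y) \<partial>\<omega>)"
  proof (rule nn_integral_mono)
    fix p :: "'a \<times> 'a"
    obtain x y where p: "p = (x, y)" by (cases p)
    have "(\<integral>\<^sup>+(x, y). ennreal (\<rho> x y) \<partial>pair_kernel p) = (\<integral>\<^sup>+w. \<integral>\<^sup>+u. ennreal (\<rho> (q x w) (q y (\<Phi> x y w u))) \<partial>H \<partial>G)"
      unfolding p by (subst nn_integral_pair_kernel) auto
    also have "\<dots> \<le> ennreal \<kappa> * ennreal (\<rho> x y)"
      using contraction[of x y] \<kappa> \<rho>_nonneg by (simp add: ennreal_mult)
    finally show "(\<integral>\<^sup>+(x, y). ennreal (\<rho> x y) \<partial>pair_kernel p) \<le> (case p of (x, y) \<Rightarrow> ennreal \<kappa> * ennreal (\<rho> x y))"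
      by (simp add: p)
  qed
  also have "\<dots> = ennreal \<kappa> * (\<integral>\<^sup>+(x, y). ennreal (\<rho> x y) \<partial>\<omega>)"
    by (subst nn_integral_cmult[symmetric]) (auto simp: case_prod_unfold)
  finally show "wasserstein \<rho> (\<nu> \<bind> kernel) (\<eta> \<bind> kernel) \<le> ennreal \<kappa> * (\<integral>\<^sup>+(x, y). ennreal (\<rho> x y) \<partial>\<omega>)" .
qed

lemma kernel_iterate_Suc: "kernel_iterate \<nu> kernel (Suc m) = kernel_iterate \<nu> kernel m \<bind> kernel"
  by (simp add: kernel_iterate_def)

lemma kernel_iterate_0: "kernel_iterate \<nu> kernel 0 = \<nu>"
  by (simp add: kernel_iterate_def)

lemma kernel_iterate_prob:
  "\<nu> \<in> space (prob_algebra borel) \<Longrightarrow> kernel_iterate \<nu> kernel m \<in> space (prob_algebra borel)"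
  by (induction m) (auto simp: kernel_iterate_Suc kernel_iterate_0 bind_kernel_prob)

lemma wasserstein_iterate:
  assumes \<nu>: "\<nu> \<in> space (prob_algebra borel)" and \<eta>: "\<eta> \<in> space (prob_algebra borel)"
  shows "wasserstein \<rho> (kernel_iterate \<nu> kernel m) (kernel_iterate \<eta> kernel m) \<le> ennreal (\<kappa> ^ m) * wasserstein \<rho> \<nu> \<eta>"
proof (induction m)
  case (Suc m)
  have "wasserstein \<rho> (kernel_iterate \<nu> kernel (Suc m)) (kernel_iterate \<eta> kernel (Suc m))
      \<le> ennreal \<kappa> * wasserstein \<rho> (kernel_iterate \<nu> kernel m) (kernel_iterate \<eta> kernel m)"
    unfolding kernel_iterate_Suc by (intro wasserstein_step kernel_iterate_prob \<nu> \<eta>)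
  also have "\<dots> \<le> ennreal \<kappa> * (ennreal (\<kappa> ^ m) * wasserstein \<rho> \<nu> \<eta>)" by (intro mult_left_mono Suc) simp
  also have "\<dots> = ennreal (\<kappa> ^ Suc m) * wasserstein \<rho> \<nu> \<eta>"
    using \<kappa> by (simp add: mult.assoc[symmetric] ennreal_mult[symmetric])
  finally show ?case .
qed (simp add: kernel_iterate_0)

end

section \<open>Uniqueness of the invariant measure\<close>

text \<open>Indicators of closed sets are decreasing limits of Lipschitz functions.\<close>

lemma prob_eqI_lipschitz:
  fixes M N :: "'a::euclidean_space measure"
  assumes M: "M \<in> space (prob_algebra borel)" and N: "N \<in> space (prob_algebra borel)"
    and eq: "\<And>f C. (\<And>x. 0 \<le> f x \<and> f x \<le> 1) \<Longrightarrow> (\<And>x y. \<bar>f x - f y\<bar> \<le> C * dist x y) \<Longrightarrow> 0 \<le> C \<Longrightarrow>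
      (\<integral>x. f x \<partial>M) = (\<integral>x. (f x :: real) \<partial>N)"
  shows "M = N"
proof -
  have sets [measurable_cong]: "sets M = sets borel" "sets N = sets borel" and prob: "prob_space M" "prob_space N"
    using M N by (simp_all add: space_prob_algebra)
  interpret M: prob_space M by fact
  interpret N: prob_space N by fact
  have closed: "emeasure M F = emeasure N F" if F: "closed F" for F
  proof (cases "F = {}")
    case False
    define f where "f k x = max 0 (1 - real k * infdist x F)" for k x
    have f01: "0 \<le> f k x \<and> f k x \<le> 1" for k x by (simp add: f_def infdist_nonneg)
    have lip: "\<bar>f k x - f k y\<bar> \<le> real k * dist x y" for k x y
    proof -
      have "\<bar>infdist x F - infdist y F\<bar> \<le> dist x y"
        using infdist_triangle[of x F y] infdist_triangle[of y F x] by (simp add: dist_commute abs_le_iff)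
      then have "real k * \<bar>infdist x F - infdist y F\<bar> \<le> real k * dist x y" by (intro mult_left_mono) auto
      then have "\<bar>real k * infdist x F - real k * infdist y F\<bar> \<le> real k * dist x y"
        by (simp add: abs_mult right_diff_distrib[symmetric])
      then show ?thesis by (simp add: f_def)
    qed
    have [measurable]: "f k \<in> borel_measurable borel" for k
      unfolding f_def by (intro borel_measurable_continuous_onI continuous_intros)
    have lim: "(\<lambda>k. f k x) \<longlonglongrightarrow> indicator F x" for x
    proof (cases "x \<in> F")
      case True
      then show ?thesis by (simp add: f_def)
    next
      case False
      then have d: "0 < infdist x F" using F \<open>F \<noteq> {}\<close> by (simp add: infdist_pos_not_in_closed)
      obtain k0 :: nat where k0: "1 / infdist x F < real k0" using reals_Archimedean2 by blast
      have "f k x = 0" if "k0 \<le> k" for k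
      proof -
        have "1 < real k0 * infdist x F" using k0 d by (simp add: field_simps)
        also have "\<dots> \<le> real k * infdist x F" using that d by (intro mult_right_mono) auto
        finally show ?thesis by (simp add: f_def)
      qed
      then have "\<forall>\<^sub>F k in sequentially. f k x = 0" using eventually_sequentially by blast
      then show ?thesis using False by (simp add: tendsto_eventually)
    qed
    have conv: "(\<lambda>k. \<integral>x. f k x \<partial>P) \<longlonglongrightarrow> (\<integral>x. indicator F x \<partial>P)" if "prob_space P" "sets P = sets borel" for P
    proof -
      interpret P: prob_space P by fact
      note [measurable_cong] = that(2)
      have [measurable]: "F \<in> sets borel" using F by (rule borel_closed)
      show ?thesis
        by (rule integral_dominated_convergence[where w = "\<lambda>_. 1"]) (use lim f01 in auto)
    qed
    have "(\<lambda>k. \<integral>x. f k x \<partial>M) \<longlonglongrightarrow> (\<integral>x. indicator F x \<partial>N)"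
      using conv[OF prob(2) sets(2)] by (subst eq[OF f01 lip]) auto
    then have "(\<integral>x. indicator F x \<partial>M) = (\<integral>x. (indicator F x :: real) \<partial>N)"
      using conv[OF prob(1) sets(1)] LIMSEQ_unique by blast
    then have "measure M F = measure N F"
      using F sets_eq_imp_space_eq[OF sets(1)] sets_eq_imp_space_eq[OF sets(2)] by simp
    then show ?thesis by (simp add: M.emeasure_eq_measure N.emeasure_eq_measure)
  qed simp
  show "M = N"
  proof (rule measure_eqI_generator_eq[where E = "Collect closed" and \<Omega> = UNIV and A = "\<lambda>_. UNIV"])
    show "sets M = sigma_sets UNIV (Collect closed)" "sets N = sigma_sets UNIV (Collect closed)"
      by (simp_all add: sets borel_eq_closed)
  qed (auto simp: Int_stable_def closed)
qed

text \<open>For an invariant measure it is needed that closeness with respect to \<open>\<rho>\<close> is closeness of points, that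
  the random map passes to limits, and that the first step from \<open>0\<close> has a finite expected length.\<close>

locale contractive_coupling_moment = contractive_coupling G H q \<Phi> \<rho> \<kappa>
  for G :: "'w measure" and H :: "'u measure" and q :: "'a::euclidean_space \<Rightarrow> 'w \<Rightarrow> 'a"
    and \<Phi> :: "'a \<Rightarrow> 'a \<Rightarrow> 'w \<Rightarrow> 'u \<Rightarrow> 'w" and \<rho> :: "'a \<Rightarrow> 'a \<Rightarrow> real" and \<kappa> :: real +
  fixes \<alpha> :: real
  assumes \<alpha>: "0 < \<alpha>" and dist_le: "dist x y \<le> \<alpha> * \<rho> x y"
    and q_cont: "w \<in> space G \<Longrightarrow> isCont (\<lambda>x. q x w) x"
    and moment: "(\<integral>\<^sup>+w. ennreal (\<rho> 0 (q 0 w)) \<partial>G) < \<infinity>"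
begin

text \<open>The truncated cost \<open>min 1 (a \<rho>)\<close> contracts as well, and unlike \<open>\<rho>\<close> it is integrable with respect
  to every coupling. This settles uniqueness among all probability measures, without any moment
  condition.\<close>

lemma truncated_step:
  assumes a: "0 \<le> a"
  shows "(\<integral>\<^sup>+p'. ennreal (min 1 (a * \<rho> (fst p') (snd p'))) \<partial>pair_kernel p) \<le> ennreal (min 1 (a * \<kappa> * \<rho> (fst p) (snd p)))"
proof -
  obtain x y where p: "p = (x, y)" by (cases p)
  define I where "I = (\<integral>\<^sup>+w. \<integral>\<^sup>+u. ennreal (min 1 (a * \<rho> (q x w) (q y (\<Phi> x y w u)))) \<partial>H \<partial>G)"
  have "I \<le> (\<integral>\<^sup>+w. \<integral>\<^sup>+u. 1 \<partial>H \<partial>G)"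
    unfolding I_def by (intro nn_integral_mono) (auto simp: ennreal_1[symmetric] simp del: ennreal_1 intro!: ennreal_leI)
  then have I1: "I \<le> ennreal 1" by (simp add: G.emeasure_space_1 H.emeasure_space_1)
  have "I \<le> (\<integral>\<^sup>+w. \<integral>\<^sup>+u. ennreal a * ennreal (\<rho> (q x w) (q y (\<Phi> x y w u))) \<partial>H \<partial>G)"
    unfolding I_def using a by (intro nn_integral_mono) (auto simp: ennreal_mult'[symmetric] intro!: ennreal_leI)
  also have "\<dots> = (\<integral>\<^sup>+w. ennreal a * (\<integral>\<^sup>+u. ennreal (\<rho> (q x w) (q y (\<Phi> x y w u))) \<partial>H) \<partial>G)"
    by (intro nn_integral_cong nn_integral_cmult) measurable
  also have "\<dots> = ennreal a * (\<integral>\<^sup>+w. \<integral>\<^sup>+u. ennreal (\<rho> (q x w) (q y (\<Phi> x y w u))) \<partial>H \<partial>G)"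
    by (rule nn_integral_cmult) measurable
  also have "\<dots> \<le> ennreal a * ennreal (\<kappa> * \<rho> x y)" by (intro mult_left_mono contraction) simp
  also have "\<dots> = ennreal (a * \<kappa> * \<rho> x y)" using a by (simp add: ennreal_mult'[symmetric] mult.assoc)
  finally have I2: "I \<le> ennreal (a * \<kappa> * \<rho> x y)" .
  have "(\<integral>\<^sup>+p'. ennreal (min 1 (a * \<rho> (fst p') (snd p'))) \<partial>pair_kernel p) = I"
    unfolding p I_def by (subst nn_integral_pair_kernel) auto
  also have "I \<le> ennreal (min 1 (a * \<kappa> * \<rho> x y))"
    using I1 I2 by (cases "1 \<le> a * \<kappa> * \<rho> x y") (simp_all add: min_def)
  finally show ?thesis by (simp add: p)
qed

text \<open>Two invariant measures are coupled independently, and this coupling is propagated: all its iterates are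
  again couplings of the two measures, while the cost \<open>min 1 (a \<rho>)\<close> becomes
  \<open>min 1 (a \<kappa>\<^sup>m \<rho>)\<close> and tends to \<open>0\<close> by dominated convergence. As \<open>\<rho>\<close> dominates the Euclidean distance, the
  measures agree on bounded Lipschitz functions.\<close>

lemma invariant_unique:
  assumes \<mu>: "invariant_prob kernel \<mu>" and \<eta>: "invariant_prob kernel \<eta>"
  shows "\<mu> = \<eta>"
proof (rule prob_eqI_lipschitz)
  have inv: "\<mu> \<bind> kernel = \<mu>" "\<eta> \<bind> kernel = \<eta>" using \<mu> \<eta> by (auto simp: invariant_prob_def)
  show \<mu>P: "\<mu> \<in> space (prob_algebra borel)" and \<eta>P: "\<eta> \<in> space (prob_algebra borel)"
    using \<mu> \<eta> by (auto simp: invariant_prob_def)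
  have sets [measurable_cong]: "sets \<mu> = sets borel" "sets \<eta> = sets borel" and prob: "prob_space \<mu>" "prob_space \<eta>"
    using \<mu>P \<eta>P by (simp_all add: space_prob_algebra)
  interpret \<mu>: prob_space \<mu> by fact
  interpret \<eta>: prob_space \<eta> by fact
  interpret \<mu>\<eta>: pair_prob_space \<mu> \<eta> ..
  define \<omega> where "\<omega> m = ((\<lambda>\<omega>. \<omega> \<bind> pair_kernel) ^^ m) (\<mu> \<Otimes>\<^sub>M \<eta>)" for m
  have \<omega>_Suc: "\<omega> (Suc m) = \<omega> m \<bind> pair_kernel" for m by (simp add: \<omega>_def)
  have \<omega>: "\<omega> m \<in> couplings \<mu> \<eta>" for m
  proof (induction m)
    case 0
    have "distr (\<mu> \<Otimes>\<^sub>M \<eta>) \<mu> fst = \<mu>" by (rule \<eta>.distr_pair_fst)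
    moreover have "distr (\<mu> \<Otimes>\<^sub>M \<eta>) \<eta> snd = \<eta>"
    proof (rule measure_eqI)
      fix A assume "A \<in> sets (distr (\<mu> \<Otimes>\<^sub>M \<eta>) \<eta> snd)"
      then have A: "A \<in> sets \<eta>" by simp
      have "snd -` A \<inter> space (\<mu> \<Otimes>\<^sub>M \<eta>) = space \<mu> \<times> A"
        using sets.sets_into_space[OF A] by (auto simp: space_pair_measure)
      then show "emeasure (distr (\<mu> \<Otimes>\<^sub>M \<eta>) \<eta> snd) A = emeasure \<eta> A"
        using A by (simp add: emeasure_distr \<eta>.emeasure_pair_measure_Times \<mu>.emeasure_space_1)
    qed simp
    ultimately show ?case by (simp add: \<omega>_def couplings_def space_prob_algebra \<mu>\<eta>.prob_space_axioms)
  next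
    case (Suc m)
    then show ?case using coupling_step[OF \<mu>P \<eta>P] by (simp add: \<omega>_Suc inv)
  qed
  then have \<omega>P: "\<omega> m \<in> space (prob_algebra (borel \<Otimes>\<^sub>M borel))" for m using sets by (simp add: couplings_iff)
  have cost: "(\<integral>\<^sup>+p. ennreal (min 1 (a * \<rho> (fst p) (snd p))) \<partial>\<omega> m)
      \<le> (\<integral>\<^sup>+p. ennreal (min 1 (a * \<kappa> ^ m * \<rho> (fst p) (snd p))) \<partial>\<omega> 0)" if "0 \<le> a" for a m
    using that
  proof (induction m arbitrary: a)
    case (Suc m)
    have "(\<integral>\<^sup>+p. ennreal (min 1 (a * \<rho> (fst p) (snd p))) \<partial>\<omega> (Suc m))
        = (\<integral>\<^sup>+p. \<integral>\<^sup>+p'. ennreal (min 1 (a * \<rho> (fst p') (snd p'))) \<partial>pair_kernel p \<partial>\<omega> m)"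
      unfolding \<omega>_Suc by (rule nn_integral_bind_pair_kernel[OF \<omega>P]) measurable
    also have "\<dots> \<le> (\<integral>\<^sup>+p. ennreal (min 1 (a * \<kappa> * \<rho> (fst p) (snd p))) \<partial>\<omega> m)"
      using Suc.prems by (intro nn_integral_mono truncated_step)
    also have "\<dots> \<le> (\<integral>\<^sup>+p. ennreal (min 1 (a * \<kappa> * \<kappa> ^ m * \<rho> (fst p) (snd p))) \<partial>\<omega> 0)"
      using Suc.prems \<kappa> by (intro Suc.IH) auto
    finally show ?case by (simp add: mult.assoc)
  qed simp
  fix f :: "'a \<Rightarrow> real" and C :: real
  assume f01: "\<And>x. 0 \<le> f x \<and> f x \<le> 1" and lip: "\<And>x y. \<bar>f x - f y\<bar> \<le> C * dist x y" and C: "0 \<le> C"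
  have [measurable]: "f \<in> borel_measurable borel"
    using lip C by (intro borel_measurable_continuous_onI lipschitz_on_continuous_on[of C] lipschitz_onI) (auto simp: dist_real_def)
  have diff: "ennreal \<bar>(\<integral>x. f x \<partial>\<mu>) - (\<integral>x. f x \<partial>\<eta>)\<bar> \<le> (\<integral>\<^sup>+p. ennreal (min 1 (C * \<alpha> * \<kappa> ^ m * \<rho> (fst p) (snd p))) \<partial>(\<mu> \<Otimes>\<^sub>M \<eta>))" for m
  proof -
    have sets\<omega> [measurable_cong]: "sets (\<omega> m) = sets (borel \<Otimes>\<^sub>M borel)" using \<omega>P[of m] by (simp add: space_prob_algebra)
    interpret \<omega>: prob_space "\<omega> m" using \<omega>P[of m] by (simp add: space_prob_algebra)
    have marg: "distr (\<omega> m) borel fst = \<mu>" "distr (\<omega> m) borel snd = \<eta>" using \<omega>[of m] sets by (simp_all add: couplings_iff)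
    have int: "integrable (\<omega> m) (\<lambda>p. f (fst p))" "integrable (\<omega> m) (\<lambda>p. f (snd p))"
      using f01 by (auto intro!: \<omega>.integrable_const_bound[where B = 1])
    have "(\<integral>x. f x \<partial>\<mu>) = (\<integral>p. f (fst p) \<partial>\<omega> m)" "(\<integral>x. f x \<partial>\<eta>) = (\<integral>p. f (snd p) \<partial>\<omega> m)"
      by (subst marg[symmetric], subst integral_distr, auto)+
    then have "(\<integral>x. f x \<partial>\<mu>) - (\<integral>x. f x \<partial>\<eta>) = (\<integral>p. f (fst p) - f (snd p) \<partial>\<omega> m)"
      using int by simp
    then have "ennreal \<bar>(\<integral>x. f x \<partial>\<mu>) - (\<integral>x. f x \<partial>\<eta>)\<bar> \<le> (\<integral>\<^sup>+p. ennreal \<bar>f (fst p) - f (snd p)\<bar> \<partial>\<omega> m)"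
      using integral_norm_bound_ennreal[of "\<omega> m" "\<lambda>p. f (fst p) - f (snd p)"] int by simp
    also have "\<dots> \<le> (\<integral>\<^sup>+p. ennreal (min 1 (C * \<alpha> * \<rho> (fst p) (snd p))) \<partial>\<omega> m)"
    proof (intro nn_integral_mono ennreal_leI)
      fix p :: "'a \<times> 'a"
      have "\<bar>f (fst p) - f (snd p)\<bar> \<le> C * (\<alpha> * \<rho> (fst p) (snd p))"
        using lip[of "fst p" "snd p"] dist_le[of "fst p" "snd p"] C by (meson mult_left_mono order_trans)
      moreover have "\<bar>f (fst p) - f (snd p)\<bar> \<le> 1" using f01[of "fst p"] f01[of "snd p"] by (simp add: abs_le_iff)
      ultimately show "\<bar>f (fst p) - f (snd p)\<bar> \<le> min 1 (C * \<alpha> * \<rho> (fst p) (snd p))" by (simp add: mult.assoc)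
    qed
    also have "\<dots> \<le> (\<integral>\<^sup>+p. ennreal (min 1 (C * \<alpha> * \<kappa> ^ m * \<rho> (fst p) (snd p))) \<partial>\<omega> 0)"
      using C \<alpha> by (intro cost) auto
    finally show ?thesis by (simp add: \<omega>_def)
  qed
  have "(\<lambda>m. \<integral>\<^sup>+p. ennreal (min 1 (C * \<alpha> * \<kappa> ^ m * \<rho> (fst p) (snd p))) \<partial>(\<mu> \<Otimes>\<^sub>M \<eta>)) \<longlonglongrightarrow> (\<integral>\<^sup>+p. 0 \<partial>(\<mu> \<Otimes>\<^sub>M \<eta>))"
  proof (rule nn_integral_dominated_convergence[where w = "\<lambda>_. 1"])
    show "AE p in \<mu> \<Otimes>\<^sub>M \<eta>. (\<lambda>m. ennreal (min 1 (C * \<alpha> * \<kappa> ^ m * \<rho> (fst p) (snd p)))) \<longlonglongrightarrow> 0"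
    proof (rule AE_I2)
      fix p :: "'a \<times> 'a"
      have "(\<lambda>m. \<kappa> ^ m) \<longlonglongrightarrow> 0" using \<kappa> by (intro LIMSEQ_power_zero) auto
      then have "(\<lambda>m. min 1 (C * \<alpha> * \<kappa> ^ m * \<rho> (fst p) (snd p))) \<longlonglongrightarrow> min 1 (C * \<alpha> * 0 * \<rho> (fst p) (snd p))"
        by (intro tendsto_min tendsto_mult tendsto_const)
      then have "(\<lambda>m. ennreal (min 1 (C * \<alpha> * \<kappa> ^ m * \<rho> (fst p) (snd p)))) \<longlonglongrightarrow> ennreal (min 1 (C * \<alpha> * 0 * \<rho> (fst p) (snd p)))"
        by (rule tendsto_ennrealI)
      then show "(\<lambda>m. ennreal (min 1 (C * \<alpha> * \<kappa> ^ m * \<rho> (fst p) (snd p)))) \<longlonglongrightarrow> 0" by simp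
    qed
    show "AE p in \<mu> \<Otimes>\<^sub>M \<eta>. ennreal (min 1 (C * \<alpha> * \<kappa> ^ m * \<rho> (fst p) (snd p))) \<le> 1" for m
      by (intro AE_I2) (auto simp: ennreal_1[symmetric] simp del: ennreal_1 intro!: ennreal_leI)
    show "(\<integral>\<^sup>+p. 1 \<partial>(\<mu> \<Otimes>\<^sub>M \<eta>)) < \<infinity>" by (simp add: \<mu>\<eta>.emeasure_space_1)
  qed measurable
  then have "ennreal \<bar>(\<integral>x. f x \<partial>\<mu>) - (\<integral>x. f x \<partial>\<eta>)\<bar> \<le> 0"
    by (intro LIMSEQ_le_const) (auto intro: diff)
  then show "(\<integral>x. f x \<partial>\<mu>) = (\<integral>x. f x \<partial>\<eta>)" by simp
qed

section \<open>Existence of the invariant measure\<close>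

text \<open>The noises of all steps of a chain started in \<open>y\<close>, coupled step by step to the noises \<open>\<zeta>\<close> of a chain
  started in \<open>x\<close>, with the additional randomness \<open>U\<close>. They are independent with law \<open>G\<close> again, so that they
  can be used as the noises of another chain.\<close>

primcorec coupled_noise :: "'a \<Rightarrow> 'a \<Rightarrow> 'w stream \<Rightarrow> 'u stream \<Rightarrow> 'w stream" where
  "coupled_noise x y \<zeta> U = \<Phi> x y (shd \<zeta>) (shd U) ##
     coupled_noise (q x (shd \<zeta>)) (q y (\<Phi> x y (shd \<zeta>) (shd U))) (stl \<zeta>) (stl U)"

primrec run :: "nat \<Rightarrow> 'a \<Rightarrow> 'w stream \<Rightarrow> 'a" where
  "run 0 x \<zeta> = x"
| "run (Suc k) x \<zeta> = run k (q x (shd \<zeta>)) (stl \<zeta>)"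

lemma run_measurable [measurable (raw)]:
  assumes "f \<in> borel_measurable M" "g \<in> M \<rightarrow>\<^sub>M stream_space G"
  shows "(\<lambda>a. run k (f a) (g a)) \<in> borel_measurable M"
  using assms
proof (induction k arbitrary: f g)
  case (Suc k)
  note [measurable] = Suc.prems
  show ?case by (simp, rule Suc.IH) measurable
qed simp

lemma coupled_noise_measurable [measurable (raw)]:
  assumes "f1 \<in> borel_measurable M" "f2 \<in> borel_measurable M" "f3 \<in> M \<rightarrow>\<^sub>M stream_space G" "f4 \<in> M \<rightarrow>\<^sub>M stream_space H"
  shows "(\<lambda>a. coupled_noise (f1 a) (f2 a) (f3 a) (f4 a)) \<in> M \<rightarrow>\<^sub>M stream_space G"
proof -
  define F where "F f \<longleftrightarrow> (\<exists>f1 f2 f3 f4. f1 \<in> borel_measurable M \<and> f2 \<in> borel_measurable M \<and>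
    f3 \<in> M \<rightarrow>\<^sub>M stream_space G \<and> f4 \<in> M \<rightarrow>\<^sub>M stream_space H \<and> f = (\<lambda>a. coupled_noise (f1 a) (f2 a) (f3 a) (f4 a)))" for f
  have "F (\<lambda>a. coupled_noise (f1 a) (f2 a) (f3 a) (f4 a))" unfolding F_def using assms by blast
  then show ?thesis
  proof (coinduct rule: measurable_stream_coinduct)
    case (shd f)
    then obtain f1 f2 f3 f4 where [measurable]: "f1 \<in> borel_measurable M" "f2 \<in> borel_measurable M"
      "f3 \<in> M \<rightarrow>\<^sub>M stream_space G" "f4 \<in> M \<rightarrow>\<^sub>M stream_space H" and f: "f = (\<lambda>a. coupled_noise (f1 a) (f2 a) (f3 a) (f4 a))"
      unfolding F_def by blast
    show ?case unfolding f by simp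
  next
    case (stl f)
    then obtain f1 f2 f3 f4 where [measurable]: "f1 \<in> borel_measurable M" "f2 \<in> borel_measurable M"
      "f3 \<in> M \<rightarrow>\<^sub>M stream_space G" "f4 \<in> M \<rightarrow>\<^sub>M stream_space H" and f: "f = (\<lambda>a. coupled_noise (f1 a) (f2 a) (f3 a) (f4 a))"
      unfolding F_def by blast
    show ?case unfolding f F_def
      by (rule exI[of _ "\<lambda>a. q (f1 a) (shd (f3 a))"], rule exI[of _ "\<lambda>a. q (f2 a) (\<Phi> (f1 a) (f2 a) (shd (f3 a)) (shd (f4 a)))"],
          rule exI[of _ "\<lambda>a. stl (f3 a)"], rule exI[of _ "\<lambda>a. stl (f4 a)"]) (intro conjI; (measurable | simp))
  qed
qed

abbreviation GG :: "'w stream measure" where "GG \<equiv> stream_space G"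
abbreviation HH :: "'u stream measure" where "HH \<equiv> stream_space H"

lemma prob_GG: "prob_space GG" by (rule G.prob_space_stream_space)
lemma prob_HH: "prob_space HH" by (rule H.prob_space_stream_space)

lemma nn_integral_noise_step:
  assumes [measurable]: "(\<lambda>(\<zeta>, U). F \<zeta> U) \<in> borel_measurable (GG \<Otimes>\<^sub>M HH)"
  shows "(\<integral>\<^sup>+\<zeta>. \<integral>\<^sup>+U. F \<zeta> U \<partial>HH \<partial>GG) = (\<integral>\<^sup>+w. \<integral>\<^sup>+u. \<integral>\<^sup>+\<zeta>. \<integral>\<^sup>+U. F (w ## \<zeta>) (u ## U) \<partial>HH \<partial>GG \<partial>H \<partial>G)"
proof -
  interpret GG: prob_space GG by (rule prob_GG)
  interpret HH: prob_space HH by (rule prob_HH)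
  interpret P: pair_sigma_finite GG H ..
  have "(\<integral>\<^sup>+\<zeta>. \<integral>\<^sup>+U. F \<zeta> U \<partial>HH \<partial>GG) = (\<integral>\<^sup>+\<zeta>. \<integral>\<^sup>+u. \<integral>\<^sup>+U. F \<zeta> (u ## U) \<partial>HH \<partial>H \<partial>GG)"
    by (intro nn_integral_cong H.nn_integral_stream_space) measurable
  also have "\<dots> = (\<integral>\<^sup>+w. \<integral>\<^sup>+\<zeta>. \<integral>\<^sup>+u. \<integral>\<^sup>+U. F (w ## \<zeta>) (u ## U) \<partial>HH \<partial>H \<partial>GG \<partial>G)"
    by (rule G.nn_integral_stream_space) measurable
  also have "\<dots> = (\<integral>\<^sup>+w. \<integral>\<^sup>+u. \<integral>\<^sup>+\<zeta>. \<integral>\<^sup>+U. F (w ## \<zeta>) (u ## U) \<partial>HH \<partial>GG \<partial>H \<partial>G)"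
    by (intro nn_integral_cong P.Fubini'[symmetric]) measurable
  finally show ?thesis .
qed

text \<open>It suffices to compare the probabilities of cylinder sets, by induction on their length. The first
  coupled noise has law \<open>G\<close>, and given the first step, the remaining ones are the coupled noises of two chains that
  start in the new positions.\<close>

lemma coupled_noise_law:
  "distr (GG \<Otimes>\<^sub>M HH) GG (\<lambda>(\<zeta>, U). coupled_noise x y \<zeta> U) = GG"
proof (rule stream_space_eq_scylinder[where S = G and G = "sets G" and C = "{space G}"])
  interpret GG: prob_space GG by (rule prob_GG)
  interpret HH: prob_space HH by (rule prob_HH)
  interpret P: pair_prob_space GG HH ..
  show "prob_space (distr (GG \<Otimes>\<^sub>M HH) GG (\<lambda>(\<zeta>, U). coupled_noise x y \<zeta> U))"
    by (rule P.prob_space_distr) measurable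
  have em: "emeasure (distr (GG \<Otimes>\<^sub>M HH) GG (\<lambda>(\<zeta>, U). coupled_noise x y \<zeta> U)) A
      = (\<integral>\<^sup>+\<zeta>. \<integral>\<^sup>+U. indicator A (coupled_noise x y \<zeta> U) \<partial>HH \<partial>GG)" if A [measurable]: "A \<in> sets GG" for A x y
  proof -
    have "emeasure (distr (GG \<Otimes>\<^sub>M HH) GG (\<lambda>(\<zeta>, U). coupled_noise x y \<zeta> U)) A
        = (\<integral>\<^sup>+\<zeta>. indicator A \<zeta> \<partial>distr (GG \<Otimes>\<^sub>M HH) GG (\<lambda>(\<zeta>, U). coupled_noise x y \<zeta> U))" by simp
    also have "\<dots> = (\<integral>\<^sup>+p. indicator A (coupled_noise x y (fst p) (snd p)) \<partial>(GG \<Otimes>\<^sub>M HH))"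
      by (subst nn_integral_distr) (auto simp: case_prod_unfold)
    also have "\<dots> = (\<integral>\<^sup>+\<zeta>. \<integral>\<^sup>+U. indicator A (coupled_noise x y \<zeta> U) \<partial>HH \<partial>GG)"
      by (subst HH.nn_integral_fst[symmetric]) auto
    finally show ?thesis .
  qed
  have cyl: "emeasure (distr (GG \<Otimes>\<^sub>M HH) GG (\<lambda>(\<zeta>, U). coupled_noise x y \<zeta> U)) (scylinder (space G) xs)
      = emeasure GG (scylinder (space G) xs)" if "xs \<in> lists (sets G)" for xs x y
    using that
  proof (induction xs arbitrary: x y)
    case Nil
    have "scylinder (space G) [] = space GG" by (simp add: space_stream_space)
    moreover have "emeasure (distr (GG \<Otimes>\<^sub>M HH) GG (\<lambda>(\<zeta>, U). coupled_noise x y \<zeta> U)) (space GG) = 1"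
      using prob_space.emeasure_space_1[OF P.prob_space_distr, of "\<lambda>(\<zeta>, U). coupled_noise x y \<zeta> U" GG] by simp
    ultimately show ?case by (simp add: GG.emeasure_space_1)
  next
    case (Cons A As)
    then have A [measurable]: "A \<in> sets G" and As: "As \<in> lists (sets G)" by auto
    have S [measurable]: "scylinder (space G) As \<in> sets GG" "scylinder (space G) (A # As) \<in> sets GG"
      using sets_scylinder[of As G] sets_scylinder[of "A # As" G] A As by (auto simp del: scylinder.simps simp: in_lists_conv_set)
    have ind: "indicator (scylinder (space G) (A # As)) (w ## \<zeta>)
        = (indicator A w * indicator (scylinder (space G) As) \<zeta> :: ennreal)" if "w \<in> space G" "\<zeta> \<in> space GG" for w \<zeta>
      using that by (auto simp: indicator_def space_stream_space)
    have "emeasure (distr (GG \<Otimes>\<^sub>M HH) GG (\<lambda>(\<zeta>, U). coupled_noise x y \<zeta> U)) (scylinder (space G) (A # As))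
        = (\<integral>\<^sup>+w. \<integral>\<^sup>+u. \<integral>\<^sup>+\<zeta>. \<integral>\<^sup>+U. indicator (scylinder (space G) (A # As)) (coupled_noise x y (w ## \<zeta>) (u ## U)) \<partial>HH \<partial>GG \<partial>H \<partial>G)"
      by (subst em[OF S(2)], subst nn_integral_noise_step) measurable
    also have "\<dots> = (\<integral>\<^sup>+w. \<integral>\<^sup>+u. indicator A (\<Phi> x y w u) * emeasure GG (scylinder (space G) As) \<partial>H \<partial>G)"
    proof (intro nn_integral_cong)
      fix w u assume wu: "w \<in> space G" "u \<in> space H"
      let ?x = "q x w" and ?y = "q y (\<Phi> x y w u)"
      have \<Phi>: "\<Phi> x y w u \<in> space G" using measurable_space[OF \<Phi>_measurable, of "((x, y), (w, u))"] wu by (simp add: space_pair_measure)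
      have "(\<integral>\<^sup>+\<zeta>. \<integral>\<^sup>+U. indicator (scylinder (space G) (A # As)) (coupled_noise x y (w ## \<zeta>) (u ## U)) \<partial>HH \<partial>GG)
          = (\<integral>\<^sup>+\<zeta>. \<integral>\<^sup>+U. indicator A (\<Phi> x y w u) * indicator (scylinder (space G) As) (coupled_noise ?x ?y \<zeta> U) \<partial>HH \<partial>GG)"
      proof (intro nn_integral_cong)
        fix \<zeta> U assume \<zeta>: "\<zeta> \<in> space GG" "U \<in> space HH"
        have m: "(\<lambda>p. coupled_noise ?x ?y (fst p) (snd p)) \<in> GG \<Otimes>\<^sub>M HH \<rightarrow>\<^sub>M GG" by measurable
        have "coupled_noise ?x ?y \<zeta> U \<in> space GG"
          using measurable_space[OF m, of "(\<zeta>, U)"] \<zeta> by (simp add: space_pair_measure)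
        moreover have "coupled_noise x y (w ## \<zeta>) (u ## U) = \<Phi> x y w u ## coupled_noise ?x ?y \<zeta> U"
          by (subst coupled_noise.code) simp
        ultimately show "indicator (scylinder (space G) (A # As)) (coupled_noise x y (w ## \<zeta>) (u ## U))
            = (indicator A (\<Phi> x y w u) * indicator (scylinder (space G) As) (coupled_noise ?x ?y \<zeta> U) :: ennreal)"
          using ind[OF \<Phi>] by simp
      qed
      also have "\<dots> = indicator A (\<Phi> x y w u) * (\<integral>\<^sup>+\<zeta>. \<integral>\<^sup>+U. indicator (scylinder (space G) As) (coupled_noise ?x ?y \<zeta> U) \<partial>HH \<partial>GG)"
        by (subst nn_integral_cmult[symmetric], measurable, intro nn_integral_cong nn_integral_cmult) measurable
      also have "\<dots> = indicator A (\<Phi> x y w u) * emeasure GG (scylinder (space G) As)"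
        by (simp only: em[OF S(1), symmetric] Cons.IH As)
      finally show "(\<integral>\<^sup>+\<zeta>. \<integral>\<^sup>+U. indicator (scylinder (space G) (A # As)) (coupled_noise x y (w ## \<zeta>) (u ## U)) \<partial>HH \<partial>GG)
          = indicator A (\<Phi> x y w u) * emeasure GG (scylinder (space G) As)" .
    qed
    also have "\<dots> = (\<integral>\<^sup>+w. \<integral>\<^sup>+u. indicator A (\<Phi> x y w u) \<partial>H \<partial>G) * emeasure GG (scylinder (space G) As)"
      by (subst nn_integral_multc[symmetric], measurable, intro nn_integral_cong nn_integral_multc) measurable
    also have "(\<integral>\<^sup>+w. \<integral>\<^sup>+u. indicator A (\<Phi> x y w u) \<partial>H \<partial>G) = emeasure (distr (G \<Otimes>\<^sub>M H) G (\<lambda>(w, u). \<Phi> x y w u)) A"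
    proof -
      have "emeasure (distr (G \<Otimes>\<^sub>M H) G (\<lambda>(w, u). \<Phi> x y w u)) A
          = (\<integral>\<^sup>+w. indicator A w \<partial>distr (G \<Otimes>\<^sub>M H) G (\<lambda>(w, u). \<Phi> x y w u))" by simp
      also have "\<dots> = (\<integral>\<^sup>+p. indicator A (\<Phi> x y (fst p) (snd p)) \<partial>(G \<Otimes>\<^sub>M H))"
        by (subst nn_integral_distr) (auto simp: case_prod_unfold)
      also have "\<dots> = (\<integral>\<^sup>+w. \<integral>\<^sup>+u. indicator A (\<Phi> x y w u) \<partial>H \<partial>G)"
        by (subst H.nn_integral_fst[symmetric]) auto
      finally show ?thesis ..
    qed
    also have "\<dots> = emeasure G A" by (simp only: \<Phi>_law)
    also have "emeasure G A * emeasure GG (scylinder (space G) As) = emeasure GG (scylinder (space G) (A # As))"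
    proof -
      have "emeasure GG (scylinder (space G) (A # As)) = (\<integral>\<^sup>+\<zeta>. indicator (scylinder (space G) (A # As)) \<zeta> \<partial>GG)"
        using S by simp
      also have "\<dots> = (\<integral>\<^sup>+w. \<integral>\<^sup>+\<zeta>. indicator (scylinder (space G) (A # As)) (w ## \<zeta>) \<partial>GG \<partial>G)"
        using S by (intro G.nn_integral_stream_space) auto
      also have "\<dots> = (\<integral>\<^sup>+w. \<integral>\<^sup>+\<zeta>. indicator A w * indicator (scylinder (space G) As) \<zeta> \<partial>GG \<partial>G)"
        using ind by (intro nn_integral_cong)
      also have "\<dots> = (\<integral>\<^sup>+w. indicator A w * emeasure GG (scylinder (space G) As) \<partial>G)"
        using S by (simp add: nn_integral_cmult)
      also have "\<dots> = emeasure G A * emeasure GG (scylinder (space G) As)"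
        using A by (simp add: nn_integral_multc)
      finally show ?thesis ..
    qed
    finally show ?case .
  qed
  show "emeasure (distr (GG \<Otimes>\<^sub>M HH) GG (\<lambda>(\<zeta>, U). coupled_noise x y \<zeta> U)) (scylinder (space G) xs)
      = emeasure GG (scylinder (space G) xs)" if "xs \<noteq> []" "xs \<in> lists (sets G)" for xs
    using cyl[OF that(2)] .
  show "Int_stable (sets G)" by (rule sets.Int_stable)
  show "sets G = sets (sigma (space G) (sets G))" by simp
qed (auto simp: sets.space_closed prob_GG)

lemma nn_integral_coupled_noise:
  assumes [measurable]: "f \<in> borel_measurable GG"
  shows "(\<integral>\<^sup>+\<zeta>. \<integral>\<^sup>+U. f (coupled_noise x y \<zeta> U) \<partial>HH \<partial>GG) = (\<integral>\<^sup>+\<zeta>. f \<zeta> \<partial>GG)"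
proof -
  interpret HH: prob_space HH by (rule prob_HH)
  have "(\<integral>\<^sup>+\<zeta>. f \<zeta> \<partial>GG) = (\<integral>\<^sup>+\<zeta>. f \<zeta> \<partial>distr (GG \<Otimes>\<^sub>M HH) GG (\<lambda>(\<zeta>, U). coupled_noise x y \<zeta> U))"
    by (simp only: coupled_noise_law)
  also have "\<dots> = (\<integral>\<^sup>+p. f (coupled_noise x y (fst p) (snd p)) \<partial>(GG \<Otimes>\<^sub>M HH))"
    by (subst nn_integral_distr) (auto simp: case_prod_unfold)
  also have "\<dots> = (\<integral>\<^sup>+\<zeta>. \<integral>\<^sup>+U. f (coupled_noise x y \<zeta> U) \<partial>HH \<partial>GG)"
    by (subst HH.nn_integral_fst[symmetric]) auto
  finally show ?thesis ..
qed

lemma run_contraction: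
  "(\<integral>\<^sup>+\<zeta>. \<integral>\<^sup>+U. ennreal (\<rho> (run k x \<zeta>) (run k y (coupled_noise x y \<zeta> U))) \<partial>HH \<partial>GG) \<le> ennreal (\<kappa> ^ k * \<rho> x y)"
proof (induction k arbitrary: x y)
  case 0
  interpret GG: prob_space GG by (rule prob_GG)
  interpret HH: prob_space HH by (rule prob_HH)
  show ?case by (simp add: GG.emeasure_space_1 HH.emeasure_space_1)
next
  case (Suc k)
  have code: "coupled_noise x y (w ## \<zeta>) (u ## U) = \<Phi> x y w u ## coupled_noise (q x w) (q y (\<Phi> x y w u)) \<zeta> U" for w \<zeta> u U
    by (subst coupled_noise.code) simp
  have "(\<integral>\<^sup>+\<zeta>. \<integral>\<^sup>+U. ennreal (\<rho> (run (Suc k) x \<zeta>) (run (Suc k) y (coupled_noise x y \<zeta> U))) \<partial>HH \<partial>GG)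
      = (\<integral>\<^sup>+w. \<integral>\<^sup>+u. \<integral>\<^sup>+\<zeta>. \<integral>\<^sup>+U. ennreal (\<rho> (run (Suc k) x (w ## \<zeta>)) (run (Suc k) y (coupled_noise x y (w ## \<zeta>) (u ## U)))) \<partial>HH \<partial>GG \<partial>H \<partial>G)"
    by (rule nn_integral_noise_step) measurable
  also have "\<dots> \<le> (\<integral>\<^sup>+w. \<integral>\<^sup>+u. ennreal (\<kappa> ^ k) * ennreal (\<rho> (q x w) (q y (\<Phi> x y w u))) \<partial>H \<partial>G)"
    using Suc.IH \<kappa> by (intro nn_integral_mono) (simp add: code ennreal_mult'[symmetric])
  also have "\<dots> = (\<integral>\<^sup>+w. ennreal (\<kappa> ^ k) * (\<integral>\<^sup>+u. ennreal (\<rho> (q x w) (q y (\<Phi> x y w u))) \<partial>H) \<partial>G)"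
    by (intro nn_integral_cong nn_integral_cmult) measurable
  also have "\<dots> = ennreal (\<kappa> ^ k) * (\<integral>\<^sup>+w. \<integral>\<^sup>+u. ennreal (\<rho> (q x w) (q y (\<Phi> x y w u))) \<partial>H \<partial>G)"
    by (rule nn_integral_cmult) measurable
  also have "\<dots> \<le> ennreal (\<kappa> ^ k) * ennreal (\<kappa> * \<rho> x y)" by (intro mult_left_mono contraction) simp
  also have "\<dots> = ennreal (\<kappa> ^ Suc k * \<rho> x y)" using \<kappa> by (simp add: ennreal_mult'[symmetric] mult_ac)
  finally show ?case .
qed

end

context contractive_coupling_moment
begin

text \<open>Each stage of the backward construction uses one fresh noise for an additional first step, and a fresh
  stream for the coupling of the remaining steps.\<close>

abbreviation fresh_noise :: "('w \<times> 'u stream) stream measure" where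
  "fresh_noise \<equiv> stream_space (G \<Otimes>\<^sub>M HH)"

abbreviation \<Omega> :: "('w stream \<times> ('w \<times> 'u stream) stream) measure" where
  "\<Omega> \<equiv> GG \<Otimes>\<^sub>M fresh_noise"

text \<open>The noises of a chain from \<open>0\<close> that first moves to \<open>q 0 w\<close> and then follows, through the coupling, the
  chain from \<open>0\<close> with the noises \<open>\<zeta>\<close>.\<close>

definition extend_noise :: "'w stream \<Rightarrow> 'w \<times> 'u stream \<Rightarrow> 'w stream" where
  "extend_noise \<zeta> z = fst z ## coupled_noise 0 (q 0 (fst z)) \<zeta> (snd z)"

text \<open>Replacing the noises by the extended ones and dropping the used randomness preserves \<open>\<Omega>\<close>. Therefore the
  chain with the noises after \<open>j\<close> extensions has the law of the original chain, while consecutive ones are close.\<close>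

definition advance :: "'w stream \<times> ('w \<times> 'u stream) stream \<Rightarrow> 'w stream \<times> ('w \<times> 'u stream) stream" where
  "advance a = (extend_noise (fst a) (shd (snd a)), stl (snd a))"

definition backward_chain :: "nat \<Rightarrow> 'w stream \<times> ('w \<times> 'u stream) stream \<Rightarrow> 'a" where
  "backward_chain j a = run j 0 (fst ((advance ^^ j) a))"

lemma prob_GHH: "prob_space (G \<Otimes>\<^sub>M HH)"
proof -
  interpret HH: prob_space HH by (rule prob_HH)
  interpret P: pair_prob_space G HH ..
  show ?thesis by (rule P.prob_space_axioms)
qed

lemma prob_fresh_noise: "prob_space fresh_noise"
  by (rule prob_space.prob_space_stream_space[OF prob_GHH])

lemma prob_\<Omega>: "prob_space \<Omega>"
proof -
  interpret GG: prob_space GG by (rule prob_GG)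
  interpret F: prob_space fresh_noise by (rule prob_fresh_noise)
  interpret P: pair_prob_space GG fresh_noise ..
  show ?thesis by (rule P.prob_space_axioms)
qed

lemma extend_noise_measurable [measurable (raw)]:
  assumes [measurable]: "f \<in> M \<rightarrow>\<^sub>M GG" "g \<in> M \<rightarrow>\<^sub>M G \<Otimes>\<^sub>M HH"
  shows "(\<lambda>a. extend_noise (f a) (g a)) \<in> M \<rightarrow>\<^sub>M GG"
  unfolding extend_noise_def by measurable

lemma advance_measurable [measurable]: "advance \<in> \<Omega> \<rightarrow>\<^sub>M \<Omega>"
  unfolding advance_def by measurable

lemma advance_pow_measurable [measurable]: "advance ^^ j \<in> \<Omega> \<rightarrow>\<^sub>M \<Omega>"
proof (induction j)
  case (Suc j)
  then show ?case using measurable_comp[OF Suc advance_measurable] by simp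
qed (simp add: id_def)

lemma backward_chain_measurable [measurable]: "backward_chain j \<in> borel_measurable \<Omega>"
  unfolding backward_chain_def by measurable

lemma nn_integral_extend_noise:
  assumes [measurable]: "(\<lambda>(\<zeta>, z). k \<zeta> z) \<in> borel_measurable (GG \<Otimes>\<^sub>M (G \<Otimes>\<^sub>M HH))"
  shows "(\<integral>\<^sup>+\<zeta>. \<integral>\<^sup>+z. k \<zeta> z \<partial>(G \<Otimes>\<^sub>M HH) \<partial>GG) = (\<integral>\<^sup>+w. \<integral>\<^sup>+\<zeta>. \<integral>\<^sup>+U. k \<zeta> (w, U) \<partial>HH \<partial>GG \<partial>G)"
proof -
  interpret GG: prob_space GG by (rule prob_GG)
  interpret HH: prob_space HH by (rule prob_HH)
  interpret P: pair_sigma_finite GG G ..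
  have "(\<integral>\<^sup>+\<zeta>. \<integral>\<^sup>+z. k \<zeta> z \<partial>(G \<Otimes>\<^sub>M HH) \<partial>GG) = (\<integral>\<^sup>+\<zeta>. \<integral>\<^sup>+w. \<integral>\<^sup>+U. k \<zeta> (w, U) \<partial>HH \<partial>G \<partial>GG)"
    by (intro nn_integral_cong HH.nn_integral_fst[symmetric]) measurable
  also have "\<dots> = (\<integral>\<^sup>+w. \<integral>\<^sup>+\<zeta>. \<integral>\<^sup>+U. k \<zeta> (w, U) \<partial>HH \<partial>GG \<partial>G)"
    by (rule P.Fubini'[symmetric]) measurable
  finally show ?thesis .
qed

lemma nn_integral_advance:
  assumes [measurable]: "f \<in> borel_measurable \<Omega>"
  shows "(\<integral>\<^sup>+a. f (advance a) \<partial>\<Omega>) = (\<integral>\<^sup>+a. f a \<partial>\<Omega>)"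
proof -
  interpret GHH: prob_space "G \<Otimes>\<^sub>M HH" by (rule prob_GHH)
  interpret F: prob_space fresh_noise by (rule prob_fresh_noise)
  define h where "h \<zeta> = (\<integral>\<^sup>+F. f (\<zeta>, F) \<partial>fresh_noise)" for \<zeta>
  have [measurable]: "h \<in> borel_measurable GG" unfolding h_def by measurable
  have "(\<integral>\<^sup>+a. f (advance a) \<partial>\<Omega>) = (\<integral>\<^sup>+\<zeta>. \<integral>\<^sup>+F. f (extend_noise \<zeta> (shd F), stl F) \<partial>fresh_noise \<partial>GG)"
    unfolding advance_def by (subst F.nn_integral_fst[symmetric]) auto
  also have "\<dots> = (\<integral>\<^sup>+\<zeta>. \<integral>\<^sup>+z. \<integral>\<^sup>+F. f (extend_noise \<zeta> (shd (z ## F)), stl (z ## F)) \<partial>fresh_noise \<partial>(G \<Otimes>\<^sub>M HH) \<partial>GG)"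
    by (intro nn_integral_cong GHH.nn_integral_stream_space) measurable
  also have "\<dots> = (\<integral>\<^sup>+\<zeta>. \<integral>\<^sup>+z. h (extend_noise \<zeta> z) \<partial>(G \<Otimes>\<^sub>M HH) \<partial>GG)" by (simp add: h_def)
  also have "\<dots> = (\<integral>\<^sup>+w. \<integral>\<^sup>+\<zeta>. \<integral>\<^sup>+U. h (extend_noise \<zeta> (w, U)) \<partial>HH \<partial>GG \<partial>G)"
    by (rule nn_integral_extend_noise) measurable
  also have "\<dots> = (\<integral>\<^sup>+w. \<integral>\<^sup>+\<zeta>. h (w ## \<zeta>) \<partial>GG \<partial>G)"
  proof (rule nn_integral_cong)
    fix w assume [measurable]: "w \<in> space G"
    show "(\<integral>\<^sup>+\<zeta>. \<integral>\<^sup>+U. h (extend_noise \<zeta> (w, U)) \<partial>HH \<partial>GG) = (\<integral>\<^sup>+\<zeta>. h (w ## \<zeta>) \<partial>GG)"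
      unfolding extend_noise_def fst_conv snd_conv by (rule nn_integral_coupled_noise) measurable
  qed
  also have "\<dots> = (\<integral>\<^sup>+\<zeta>. h \<zeta> \<partial>GG)" by (rule G.nn_integral_stream_space[symmetric]) measurable
  also have "\<dots> = (\<integral>\<^sup>+a. f a \<partial>\<Omega>)" unfolding h_def by (rule F.nn_integral_fst) measurable
  finally show ?thesis .
qed

lemma nn_integral_advance_pow:
  assumes f: "f \<in> borel_measurable \<Omega>"
  shows "(\<integral>\<^sup>+a. f ((advance ^^ j) a) \<partial>\<Omega>) = (\<integral>\<^sup>+a. f a \<partial>\<Omega>)"
  using f
proof (induction j arbitrary: f)
  case (Suc j)
  note [measurable] = Suc.prems
  have "(\<integral>\<^sup>+a. f ((advance ^^ Suc j) a) \<partial>\<Omega>) = (\<integral>\<^sup>+a. (\<lambda>b. f (advance b)) ((advance ^^ j) a) \<partial>\<Omega>)" by simp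
  also have "\<dots> = (\<integral>\<^sup>+a. f (advance a) \<partial>\<Omega>)" by (rule Suc.IH) measurable
  also have "\<dots> = (\<integral>\<^sup>+a. f a \<partial>\<Omega>)" by (rule nn_integral_advance) measurable
  finally show ?case .
qed simp

text \<open>Consecutive backward chains are coupled: the older one makes one additional step from \<open>0\<close>
  first, and then follows the other one through \<open>\<Phi>\<close> for \<open>j\<close> contractive steps.\<close>

lemma backward_chain_increment:
  "(\<integral>\<^sup>+a. ennreal (\<rho> (backward_chain j a) (backward_chain (Suc j) a)) \<partial>\<Omega>)
    \<le> ennreal (\<kappa> ^ j) * (\<integral>\<^sup>+w. ennreal (\<rho> 0 (q 0 w)) \<partial>G)"
proof -
  interpret GHH: prob_space "G \<Otimes>\<^sub>M HH" by (rule prob_GHH)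
  interpret F: prob_space fresh_noise by (rule prob_fresh_noise)
  let ?k = "\<lambda>\<zeta> z. ennreal (\<rho> (run j 0 \<zeta>) (run (Suc j) 0 (extend_noise \<zeta> z)))"
  have "(\<integral>\<^sup>+a. ennreal (\<rho> (backward_chain j a) (backward_chain (Suc j) a)) \<partial>\<Omega>)
      = (\<integral>\<^sup>+a. (\<lambda>b. ?k (fst b) (shd (snd b))) ((advance ^^ j) a) \<partial>\<Omega>)"
    by (simp add: backward_chain_def advance_def)
  also have "\<dots> = (\<integral>\<^sup>+b. ?k (fst b) (shd (snd b)) \<partial>\<Omega>)" by (rule nn_integral_advance_pow) measurable
  also have "\<dots> = (\<integral>\<^sup>+\<zeta>. \<integral>\<^sup>+F. ?k \<zeta> (shd F) \<partial>fresh_noise \<partial>GG)" by (subst F.nn_integral_fst[symmetric]) auto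
  also have "\<dots> = (\<integral>\<^sup>+\<zeta>. \<integral>\<^sup>+z. \<integral>\<^sup>+F. ?k \<zeta> (shd (z ## F)) \<partial>fresh_noise \<partial>(G \<Otimes>\<^sub>M HH) \<partial>GG)"
    by (intro nn_integral_cong GHH.nn_integral_stream_space) measurable
  also have "\<dots> = (\<integral>\<^sup>+\<zeta>. \<integral>\<^sup>+z. ?k \<zeta> z \<partial>(G \<Otimes>\<^sub>M HH) \<partial>GG)" by (simp add: F.emeasure_space_1)
  also have "\<dots> = (\<integral>\<^sup>+w. \<integral>\<^sup>+\<zeta>. \<integral>\<^sup>+U. ?k \<zeta> (w, U) \<partial>HH \<partial>GG \<partial>G)" by (rule nn_integral_extend_noise) measurable
  also have "\<dots> \<le> (\<integral>\<^sup>+w. ennreal (\<kappa> ^ j) * ennreal (\<rho> 0 (q 0 w)) \<partial>G)"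
    using run_contraction[where x = 0] \<kappa> by (intro nn_integral_mono) (simp add: extend_noise_def ennreal_mult'[symmetric])
  also have "\<dots> = ennreal (\<kappa> ^ j) * (\<integral>\<^sup>+w. ennreal (\<rho> 0 (q 0 w)) \<partial>G)" by (rule nn_integral_cmult) measurable
  finally show ?thesis .
qed

text \<open>The expected increments form a geometric series, so that almost surely the increments are summable.\<close>

lemma backward_chain_converges: "AE a in \<Omega>. convergent (\<lambda>j. backward_chain j a)"
proof -
  define m where "m = enn2real (\<integral>\<^sup>+w. ennreal (\<rho> 0 (q 0 w)) \<partial>G)"
  have m: "(\<integral>\<^sup>+w. ennreal (\<rho> 0 (q 0 w)) \<partial>G) = ennreal m" "0 \<le> m" using moment by (simp_all add: m_def)
  have "(\<integral>\<^sup>+a. (\<Sum>j. ennreal (\<rho> (backward_chain j a) (backward_chain (Suc j) a))) \<partial>\<Omega>)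
      = (\<Sum>j. \<integral>\<^sup>+a. ennreal (\<rho> (backward_chain j a) (backward_chain (Suc j) a)) \<partial>\<Omega>)"
    by (rule nn_integral_suminf) measurable
  also have "\<dots> \<le> (\<Sum>j. ennreal (\<kappa> ^ j * m))"
  proof (intro suminf_le summableI)
    fix j
    show "(\<integral>\<^sup>+a. ennreal (\<rho> (backward_chain j a) (backward_chain (Suc j) a)) \<partial>\<Omega>) \<le> ennreal (\<kappa> ^ j * m)"
      using backward_chain_increment[of j] m \<kappa> by (simp add: ennreal_mult)
  qed
  also have "\<dots> = ennreal (\<Sum>j. \<kappa> ^ j * m)"
    using \<kappa> m by (intro suminf_ennreal2 summable_mult2 summable_geometric) auto
  finally have fin: "(\<integral>\<^sup>+a. (\<Sum>j. ennreal (\<rho> (backward_chain j a) (backward_chain (Suc j) a))) \<partial>\<Omega>) \<noteq> \<infinity>"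
    using ennreal_less_top by (metis infinity_ennreal_def not_less top.extremum_uniqueI top.not_eq_extremum)
  have "AE a in \<Omega>. (\<Sum>j. ennreal (\<rho> (backward_chain j a) (backward_chain (Suc j) a))) \<noteq> \<infinity>"
    by (rule nn_integral_PInf_AE[OF _ fin]) measurable
  then show ?thesis
  proof eventually_elim
    case (elim a)
    let ?Z = "\<lambda>j. backward_chain j a"
    have "summable (\<lambda>j. \<rho> (?Z j) (?Z (Suc j)))"
      using elim by (intro summable_suminf_not_top \<rho>_nonneg) simp
    then have "summable (\<lambda>j. \<alpha> * \<rho> (?Z j) (?Z (Suc j)))" by (rule summable_mult)
    then have "summable (\<lambda>j. norm (?Z (Suc j) - ?Z j))"
      by (rule summable_comparison_test') (use dist_le[of "?Z _" "?Z (Suc _)"] in \<open>simp add: dist_norm norm_minus_commute\<close>)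
    then have "summable (\<lambda>j. ?Z (Suc j) - ?Z j)" by (rule summable_norm_cancel)
    then have "convergent (\<lambda>n. \<Sum>j<n. ?Z (Suc j) - ?Z j)" by (simp add: summable_iff_convergent)
    then have "convergent (\<lambda>n. ?Z n - ?Z 0)" by (simp add: sum_lessThan_telescope[of ?Z])
    from convergent_add[OF this convergent_const[of "?Z 0"]] show ?case by simp
  qed
qed

lemma nn_integral_run_Suc:
  assumes [measurable]: "f \<in> borel_measurable borel"
  shows "(\<integral>\<^sup>+\<zeta>. f (run (Suc k) x \<zeta>) \<partial>GG) = (\<integral>\<^sup>+\<zeta>. \<integral>\<^sup>+w. f (q (run k x \<zeta>) w) \<partial>G \<partial>GG)"
proof (induction k arbitrary: x)
  case 0
  interpret GG: prob_space GG by (rule prob_GG)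
  have "(\<integral>\<^sup>+\<zeta>. f (run (Suc 0) x \<zeta>) \<partial>GG) = (\<integral>\<^sup>+w. \<integral>\<^sup>+\<zeta>. f (run (Suc 0) x (w ## \<zeta>)) \<partial>GG \<partial>G)"
    by (rule G.nn_integral_stream_space) measurable
  then show ?case by (simp add: GG.emeasure_space_1)
next
  case (Suc k)
  have "(\<integral>\<^sup>+\<zeta>. f (run (Suc (Suc k)) x \<zeta>) \<partial>GG) = (\<integral>\<^sup>+w. \<integral>\<^sup>+\<zeta>. f (run (Suc (Suc k)) x (w ## \<zeta>)) \<partial>GG \<partial>G)"
    by (rule G.nn_integral_stream_space) measurable
  also have "\<dots> = (\<integral>\<^sup>+w. \<integral>\<^sup>+\<zeta>. f (run (Suc k) (q x w) \<zeta>) \<partial>GG \<partial>G)" by simp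
  also have "\<dots> = (\<integral>\<^sup>+w. \<integral>\<^sup>+\<zeta>. \<integral>\<^sup>+w'. f (q (run (Suc k) x (w ## \<zeta>)) w') \<partial>G \<partial>GG \<partial>G)" 
  proof -
    have "(\<integral>\<^sup>+w. \<integral>\<^sup>+\<zeta>. f (run (Suc k) (q x w) \<zeta>) \<partial>GG \<partial>G) = (\<integral>\<^sup>+w. \<integral>\<^sup>+\<zeta>. \<integral>\<^sup>+w'. f (q (run k (q x w) \<zeta>) w') \<partial>G \<partial>GG \<partial>G)"
      by (simp only: Suc.IH)
    then show ?thesis by simp
  qed
  also have "\<dots> = (\<integral>\<^sup>+\<zeta>. \<integral>\<^sup>+w'. f (q (run (Suc k) x \<zeta>) w') \<partial>G \<partial>GG)"
    by (rule G.nn_integral_stream_space[symmetric]) measurable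
  finally show ?case .
qed

lemma nn_integral_backward_chain:
  assumes [measurable]: "f \<in> borel_measurable borel"
  shows "(\<integral>\<^sup>+a. f (backward_chain j a) \<partial>\<Omega>) = (\<integral>\<^sup>+\<zeta>. f (run j 0 \<zeta>) \<partial>GG)"
proof -
  interpret F: prob_space fresh_noise by (rule prob_fresh_noise)
  have "(\<integral>\<^sup>+a. f (backward_chain j a) \<partial>\<Omega>) = (\<integral>\<^sup>+a. (\<lambda>b. f (run j 0 (fst b))) ((advance ^^ j) a) \<partial>\<Omega>)"
    by (simp add: backward_chain_def)
  also have "\<dots> = (\<integral>\<^sup>+b. f (run j 0 (fst b)) \<partial>\<Omega>)" by (rule nn_integral_advance_pow) measurable
  also have "\<dots> = (\<integral>\<^sup>+\<zeta>. f (run j 0 \<zeta>) \<partial>GG)" by (subst F.nn_integral_fst[symmetric]) (auto simp: F.emeasure_space_1)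
  finally show ?thesis .
qed

text \<open>The law of the limit of the backward chains is invariant: the laws of the chains are the iterates
  of the kernel, and the kernel maps bounded continuous functions to such functions.\<close>

lemma invariant_exists: "\<exists>\<mu>. invariant_prob kernel \<mu>"
proof -
  interpret \<Omega>: prob_space \<Omega> by (rule prob_\<Omega>)
  define Z where "Z a = lim (\<lambda>j. backward_chain j a)" for a
  have [measurable]: "Z \<in> borel_measurable \<Omega>" unfolding Z_def by (rule borel_measurable_lim_metric) measurable
  define \<mu> where "\<mu> = distr \<Omega> borel Z"
  have \<mu>: "\<mu> \<in> space (prob_algebra borel)" unfolding \<mu>_def space_prob_algebra by (auto intro!: \<Omega>.prob_space_distr)
  have conv: "(\<lambda>j. \<integral>a. f (backward_chain j a) \<partial>\<Omega>) \<longlonglongrightarrow> (\<integral>a. f (Z a) \<partial>\<Omega>)"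
    if f: "continuous_on UNIV f" and f01: "\<And>x. 0 \<le> f x \<and> f x \<le> 1" for f :: "'a \<Rightarrow> real"
  proof (rule integral_dominated_convergence[where w = "\<lambda>_. 1"])
    have [measurable]: "f \<in> borel_measurable borel" using f by (rule borel_measurable_continuous_onI)
    show "(\<lambda>a. f (Z a)) \<in> borel_measurable \<Omega>" "\<And>j. (\<lambda>a. f (backward_chain j a)) \<in> borel_measurable \<Omega>" by measurable
    show "AE a in \<Omega>. (\<lambda>j. f (backward_chain j a)) \<longlonglongrightarrow> f (Z a)"
      using backward_chain_converges
    proof eventually_elim
      case (elim a)
      then have "(\<lambda>j. backward_chain j a) \<longlonglongrightarrow> Z a" by (simp add: Z_def convergent_LIMSEQ_iff)
      moreover have "isCont f (Z a)" using f by (simp add: continuous_on_eq_continuous_at)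
      ultimately show ?case by (rule isCont_tendsto_compose[rotated])
    qed
  qed (use f01 in auto)
  have nn: "(\<integral>\<^sup>+x. ennreal (f x) \<partial>P) = ennreal (\<integral>x. f x \<partial>P)" if "prob_space P" "f \<in> borel_measurable P" "\<And>x. 0 \<le> f x \<and> f x \<le> 1"
    for f :: "'b \<Rightarrow> real" and P
  proof -
    interpret P: prob_space P by fact
    show ?thesis using that by (intro nn_integral_eq_integral P.integrable_const_bound[where B = 1]) auto
  qed
  have "\<mu> \<bind> kernel = \<mu>"
  proof (rule prob_eqI_lipschitz)
    show "\<mu> \<bind> kernel \<in> space (prob_algebra borel)" by (rule bind_kernel_prob[OF \<mu>])
    show "\<mu> \<in> space (prob_algebra borel)" by (rule \<mu>)
    fix f :: "'a \<Rightarrow> real" and C :: real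
    assume f01: "\<And>x. 0 \<le> f x \<and> f x \<le> 1" and lip: "\<And>x y. \<bar>f x - f y\<bar> \<le> C * dist x y" and C: "0 \<le> C"
    have f_cont: "continuous_on UNIV f"
      using lip C by (intro lipschitz_on_continuous_on[of C] lipschitz_onI) (auto simp: dist_real_def)
    then have [measurable]: "f \<in> borel_measurable borel" by (rule borel_measurable_continuous_onI)
    define Pf where "Pf x = (\<integral>w. f (q x w) \<partial>G)" for x
    have Pf_nn: "ennreal (Pf x) = (\<integral>\<^sup>+w. ennreal (f (q x w)) \<partial>G)" for x
      unfolding Pf_def using f01 by (intro nn[symmetric] prob_G) auto
    have Pf01: "0 \<le> Pf x \<and> Pf x \<le> 1" for x
    proof -
      have "Pf x \<le> (\<integral>w. 1 \<partial>G)" unfolding Pf_def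
        using f01 by (intro integral_mono G.integrable_const_bound[where B = 1]) auto
      then show ?thesis using f01 by (simp add: Pf_def G.prob_space)
    qed
    have Pf_cont: "continuous_on UNIV Pf"
      unfolding continuous_on_eq_continuous_at[OF open_UNIV]
    proof
      fix x show "isCont Pf x"
        unfolding continuous_at_sequentially comp_def
      proof (intro allI impI)
        fix y :: "nat \<Rightarrow> 'a" assume y: "y \<longlonglongrightarrow> x"
        show "(\<lambda>n. Pf (y n)) \<longlonglongrightarrow> Pf x"
          unfolding Pf_def
        proof (rule integral_dominated_convergence[where w = "\<lambda>_. 1"])
          show "AE w in G. (\<lambda>n. f (q (y n) w)) \<longlonglongrightarrow> f (q x w)"
          proof (rule AE_I2)
            fix w assume "w \<in> space G"
            then have "(\<lambda>n. q (y n) w) \<longlonglongrightarrow> q x w" using isCont_tendsto_compose[OF q_cont y] by simp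
            moreover have "isCont f (q x w)" using f_cont by (simp add: continuous_on_eq_continuous_at)
            ultimately show "(\<lambda>n. f (q (y n) w)) \<longlonglongrightarrow> f (q x w)" by (rule isCont_tendsto_compose[rotated])
          qed
        qed (use f01 in auto)
      qed
    qed
    then have [measurable]: "Pf \<in> borel_measurable borel" by (rule borel_measurable_continuous_onI)
    have step: "(\<integral>a. f (backward_chain (Suc j) a) \<partial>\<Omega>) = (\<integral>a. Pf (backward_chain j a) \<partial>\<Omega>)" for j
    proof -
      have "ennreal (\<integral>a. f (backward_chain (Suc j) a) \<partial>\<Omega>) = (\<integral>\<^sup>+a. ennreal (f (backward_chain (Suc j) a)) \<partial>\<Omega>)"
        using f01 by (intro nn[symmetric] prob_\<Omega>) auto
      also have "\<dots> = (\<integral>\<^sup>+\<zeta>. ennreal (f (run (Suc j) 0 \<zeta>)) \<partial>GG)" by (rule nn_integral_backward_chain) measurable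
      also have "\<dots> = (\<integral>\<^sup>+\<zeta>. \<integral>\<^sup>+w. ennreal (f (q (run j 0 \<zeta>) w)) \<partial>G \<partial>GG)" by (rule nn_integral_run_Suc) measurable
      also have "\<dots> = (\<integral>\<^sup>+\<zeta>. ennreal (Pf (run j 0 \<zeta>)) \<partial>GG)" by (simp only: Pf_nn)
      also have "\<dots> = (\<integral>\<^sup>+a. ennreal (Pf (backward_chain j a)) \<partial>\<Omega>)"
        by (rule nn_integral_backward_chain[symmetric]) measurable
      also have "\<dots> = ennreal (\<integral>a. Pf (backward_chain j a) \<partial>\<Omega>)" using Pf01 by (intro nn prob_\<Omega>) auto
      finally show ?thesis
        using f01 Pf01 by (subst (asm) ennreal_inj) (auto intro!: integral_nonneg_AE)
    qed
    have "(\<lambda>j. \<integral>a. f (backward_chain (Suc j) a) \<partial>\<Omega>) \<longlonglongrightarrow> (\<integral>a. f (Z a) \<partial>\<Omega>)"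
      by (rule LIMSEQ_Suc[OF conv[OF f_cont f01]])
    moreover have "(\<lambda>j. \<integral>a. f (backward_chain (Suc j) a) \<partial>\<Omega>) \<longlonglongrightarrow> (\<integral>a. Pf (Z a) \<partial>\<Omega>)"
      unfolding step by (rule conv[OF Pf_cont Pf01])
    ultimately have eq: "(\<integral>a. f (Z a) \<partial>\<Omega>) = (\<integral>a. Pf (Z a) \<partial>\<Omega>)" by (rule LIMSEQ_unique)
    have \<mu>_prob: "prob_space \<mu>" "prob_space (\<mu> \<bind> kernel)" and sets [measurable_cong]: "sets \<mu> = sets borel" "sets (\<mu> \<bind> kernel) = sets borel"
      using \<mu> bind_kernel_prob[OF \<mu>] by (simp_all add: space_prob_algebra)
    have "ennreal (\<integral>x. f x \<partial>(\<mu> \<bind> kernel)) = (\<integral>\<^sup>+x. ennreal (f x) \<partial>(\<mu> \<bind> kernel))"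
      using f01 by (intro nn[symmetric] \<mu>_prob) auto
    also have "\<dots> = (\<integral>\<^sup>+x. \<integral>\<^sup>+y. ennreal (f y) \<partial>kernel x \<partial>\<mu>)"
      by (rule nn_integral_bind[where B = borel]) (auto simp: measurable_cong_sets[OF sets(1) refl])
    also have "\<dots> = (\<integral>\<^sup>+x. ennreal (Pf x) \<partial>\<mu>)"
      by (intro nn_integral_cong) (simp add: kernel_def nn_integral_distr Pf_nn)
    also have "\<dots> = ennreal (\<integral>x. Pf x \<partial>\<mu>)" using Pf01 by (intro nn \<mu>_prob) auto
    finally have "(\<integral>x. f x \<partial>(\<mu> \<bind> kernel)) = (\<integral>x. Pf x \<partial>\<mu>)"
      using f01 Pf01 by (subst (asm) ennreal_inj) (auto intro!: integral_nonneg_AE)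
    also have "\<dots> = (\<integral>x. f x \<partial>\<mu>)" using eq by (simp add: \<mu>_def integral_distr)
    finally show "(\<integral>x. f x \<partial>(\<mu> \<bind> kernel)) = (\<integral>x. f x \<partial>\<mu>)" .
  qed
  then show ?thesis using \<mu> by (auto simp: invariant_prob_def)
qed

end

section \<open>Convergence of unadjusted Hamiltonian Monte Carlo\<close>

lemma nn_integral_norm_std_gaussian:
  "(\<integral>\<^sup>+\<xi>. ennreal (norm \<xi>) \<partial>(std_gaussian :: 'a::euclidean_space measure)) < \<infinity>"
proof -
  let ?m = "\<integral>\<^sup>+x. ennreal (max 0 x) \<partial>std_normal_distribution"
  have abs: "(\<integral>\<^sup>+x. ennreal \<bar>x\<bar> \<partial>std_normal_distribution) = ?m + ?m"
  proof -
    have "(\<integral>\<^sup>+x. ennreal \<bar>x\<bar> \<partial>std_normal_distribution)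
        = (\<integral>\<^sup>+x. ennreal (max 0 x) + ennreal (max 0 (- x)) \<partial>std_normal_distribution)"
      by (intro nn_integral_cong) (auto simp: max_def)
    also have "\<dots> = ?m + (\<integral>\<^sup>+x. ennreal (max 0 (- x)) \<partial>std_normal_distribution)"
      by (rule nn_integral_add) auto
    also have "(\<integral>\<^sup>+x. ennreal (max 0 (- x)) \<partial>std_normal_distribution) = ?m"
      by (rule nn_integral_std_normal_even) measurable
    finally show ?thesis .
  qed
  have "(\<integral>\<^sup>+\<xi>. ennreal (norm \<xi>) \<partial>(std_gaussian :: 'a measure))
      \<le> (\<integral>\<^sup>+\<xi>. (\<Sum>e\<in>Basis. ennreal \<bar>e \<bullet> \<xi>\<bar>) \<partial>(std_gaussian :: 'a measure))"
  proof (rule nn_integral_mono)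
    fix \<xi> :: 'a
    have "norm \<xi> \<le> (\<Sum>e\<in>Basis. \<bar>e \<bullet> \<xi>\<bar>)" using norm_le_l1[of \<xi>] by (simp add: inner_commute)
    then show "ennreal (norm \<xi>) \<le> (\<Sum>e\<in>Basis. ennreal \<bar>e \<bullet> \<xi>\<bar>)"
      by (subst sum_ennreal) (auto intro: ennreal_leI)
  qed
  also have "\<dots> = (\<Sum>e\<in>Basis. \<integral>\<^sup>+\<xi>. ennreal \<bar>e \<bullet> \<xi>\<bar> \<partial>(std_gaussian :: 'a measure))"
    by (rule nn_integral_sum) (simp add: measurable_cong_sets[OF sets_std_gaussian refl])
  also have "\<dots> = (\<Sum>e\<in>(Basis :: 'a set). ?m + ?m)"
    unfolding abs[symmetric] by (intro sum.cong refl nn_integral_std_gaussian_inner[where f = "\<lambda>x. ennreal \<bar>x\<bar>"]) auto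
  also have "\<dots> < \<infinity>"
    using order_le_less_trans[OF std_normal_positive_part(1) ennreal_less_top]
    by (simp add: less_top[symmetric] ennreal_mult_eq_top_iff)
  finally show ?thesis .
qed

context hmc_contraction
begin

lemma dist_le_rho: "dist x y \<le> exp (R\<^sub>1 / T) * rho R\<^sub>1 T x (y :: real^'d^'n)"
proof -
  have "dist x y \<le> ell1 x y" using norm_vec_le_sum[of "x - y"] by (simp add: dist_norm ell1_def)
  also have "ell1 x y = exp (R\<^sub>1 / T) * (exp (- (R\<^sub>1 / T)) * ell1 x y)" by (simp add: exp_minus)
  also have "\<dots> \<le> exp (R\<^sub>1 / T) * rho R\<^sub>1 T x y" using ell1_le_rho by (intro mult_left_mono) auto
  finally show ?thesis .
qed

lemma position_moment: "(\<integral>\<^sup>+\<xi>. ennreal (rho R\<^sub>1 T 0 (position 0 \<xi>)) \<partial>std_gaussian) < \<infinity>"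
proof -
  interpret G: prob_space "std_gaussian :: (real^'d^'n) measure" by (rule prob_space_std_gaussian)
  obtain C where C: "0 \<le> C" "\<And>x y \<xi> \<eta>. norm (position x \<xi> - position y \<eta>) \<le> C * (norm (x - y) + norm (\<xi> - \<eta>))"
    using position_lipschitz by blast
  let ?n = "real CARD('n)"
  define B where "B = ?n * norm (position 0 0)"
  have bound: "rho R\<^sub>1 T 0 (position 0 \<xi>) \<le> B + ?n * C * norm \<xi>" for \<xi>
  proof -
    have "norm (position 0 \<xi>) \<le> norm (position 0 0) + C * norm \<xi>"
      using C(2)[of 0 \<xi> 0 0] norm_triangle_sub[of "position 0 \<xi>" "position 0 0"] by simp
    then have n: "?n * norm (position 0 \<xi>) \<le> ?n * (norm (position 0 0) + C * norm \<xi>)" by (rule mult_left_mono) simp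
    have "rho R\<^sub>1 T 0 (position 0 \<xi>) \<le> ell1 0 (position 0 \<xi>)" by (rule rho_le_ell1)
    also have "\<dots> \<le> ?n * norm (position 0 \<xi>)"
      unfolding ell1_def using sum_bounded_above[of UNIV "\<lambda>i. norm (position 0 \<xi> $ i)" "norm (position 0 \<xi>)"]
      by (simp add: Finite_Cartesian_Product.norm_nth_le)
    also note n
    finally show ?thesis by (simp add: B_def distrib_left mult.assoc)
  qed
  have B: "0 \<le> B" by (simp add: B_def)
  have nC: "0 \<le> ?n * C" using C(1) by simp
  have "(\<integral>\<^sup>+\<xi>. ennreal (rho R\<^sub>1 T 0 (position 0 \<xi>)) \<partial>std_gaussian)
      \<le> (\<integral>\<^sup>+\<xi>. ennreal B + ennreal (?n * C) * ennreal (norm \<xi>) \<partial>(std_gaussian :: (real^'d^'n) measure))"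
  proof (rule nn_integral_mono)
    fix \<xi> :: "real^'d^'n"
    have "ennreal (rho R\<^sub>1 T 0 (position 0 \<xi>)) \<le> ennreal (B + ?n * C * norm \<xi>)" by (rule ennreal_leI[OF bound])
    also have "\<dots> = ennreal B + ennreal (?n * C) * ennreal (norm \<xi>)"
      using B nC by (simp only: ennreal_plus mult_nonneg_nonneg norm_ge_zero ennreal_mult)
    finally show "ennreal (rho R\<^sub>1 T 0 (position 0 \<xi>)) \<le> ennreal B + ennreal (?n * C) * ennreal (norm \<xi>)" .
  qed
  also have "\<dots> = ennreal B + ennreal (?n * C) * (\<integral>\<^sup>+\<xi>. ennreal (norm \<xi>) \<partial>(std_gaussian :: (real^'d^'n) measure))"
    by (subst nn_integral_add) (auto simp: nn_integral_cmult G.emeasure_space_1[unfolded space_std_gaussian] measurable_cong_sets[OF sets_std_gaussian refl])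
  also have "\<dots> < \<infinity>"
    using nn_integral_norm_std_gaussian[where 'a = "real^'d^'n"] by (simp add: ennreal_mult_less_top)
  finally show ?thesis .
qed

sublocale P: contractive_coupling_moment std_gaussian uniforms position couple "rho R\<^sub>1 T" "1 - c" "exp (R\<^sub>1 / T)"
proof (intro contractive_coupling_moment.intro contractive_coupling.intro contractive_coupling_moment_axioms.intro)
  note G [measurable_cong] = sets_std_gaussian[where 'a = "real^'d^'n"]
  show "prob_space (std_gaussian :: (real^'d^'n) measure)" by (rule prob_space_std_gaussian)
  show "prob_space (uniforms :: ('n \<Rightarrow> real) measure)" by (rule prob_space_uniforms)
  show "(\<lambda>(x, w). position x w) \<in> borel_measurable (borel \<Otimes>\<^sub>M std_gaussian)" by measurable
  have "(\<lambda>((x, y), (w, u)). couple x y w u) \<in> borel_measurable ((borel \<Otimes>\<^sub>M borel) \<Otimes>\<^sub>M (std_gaussian \<Otimes>\<^sub>M uniforms))"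
    unfolding case_prod_unfold by measurable
  then show "(\<lambda>((x, y), (w, u)). couple x y w u) \<in> (borel \<Otimes>\<^sub>M borel) \<Otimes>\<^sub>M (std_gaussian \<Otimes>\<^sub>M uniforms) \<rightarrow>\<^sub>M std_gaussian"
    by (simp add: measurable_cong_sets[OF refl G])
  show "distr (std_gaussian \<Otimes>\<^sub>M uniforms) std_gaussian (\<lambda>(w, u). couple x y w u) = std_gaussian" for x y
    using couple_law[of x y] by (simp add: distr_cong[OF refl G refl])
  show "(\<lambda>(x, y). rho R\<^sub>1 T x (y :: real^'d^'n)) \<in> borel_measurable (borel \<Otimes>\<^sub>M borel)" by measurable
  show "0 \<le> rho R\<^sub>1 T x y" for x y :: "real^'d^'n" by (rule rho_nonneg)
  show "0 < 1 - c" "1 - c < 1" using c_bounds by auto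
  show "(\<integral>\<^sup>+w. \<integral>\<^sup>+u. ennreal (rho R\<^sub>1 T (position x w) (position y (couple x y w u))) \<partial>uniforms \<partial>std_gaussian)
      \<le> ennreal ((1 - c) * rho R\<^sub>1 T x y)" for x y by (rule one_step_contraction)
  show "0 < exp (R\<^sub>1 / T)" by simp
  show "dist x y \<le> exp (R\<^sub>1 / T) * rho R\<^sub>1 T x y" for x y :: "real^'d^'n" by (rule dist_le_rho)
  show "(\<integral>\<^sup>+w. ennreal (rho R\<^sub>1 T 0 (position 0 w)) \<partial>std_gaussian) < \<infinity>" by (rule position_moment)
  obtain C where C: "0 \<le> C" "\<And>x y \<xi> \<eta>. norm (position x \<xi> - position y \<eta>) \<le> C * (norm (x - y) + norm (\<xi> - \<eta>))"
    using position_lipschitz by blast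
  show "isCont (\<lambda>x. position x w) x" for w x
  proof -
    have "continuous_on UNIV (\<lambda>x. position x w)"
      using C(2)[of _ w _ w] C(1) by (intro lipschitz_on_continuous_on[of C] lipschitz_onI) (simp_all add: dist_norm)
    then show ?thesis by (simp add: continuous_on_eq_continuous_at)
  qed
qed

lemma hmc_kernel_eq: "hmc_kernel U T h = P.kernel"
proof
  fix x
  have "position x = (\<lambda>\<xi>. fst (hmc_flow U h T x \<xi>))" by (simp add: fun_eq_iff hmc_position_def)
  then show "hmc_kernel U T h x = P.kernel x" by (simp add: hmc_kernel_def P.kernel_def)
qed

lemma wasserstein_rho_iterate:
  assumes "\<nu> \<in> space (prob_algebra borel)" "\<eta> \<in> space (prob_algebra borel)"
  shows "wasserstein (rho R\<^sub>1 T) (kernel_iterate \<nu> (hmc_kernel U T h) m) (kernel_iterate \<eta> (hmc_kernel U T h) m)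
    \<le> ennreal (exp (- c * real m)) * wasserstein (rho R\<^sub>1 T) \<nu> \<eta>"
proof -
  have "(1 - c) ^ m \<le> exp (- c) ^ m" using exp_ge_add_one_self[of "- c"] c_bounds by (intro power_mono) auto
  also have "\<dots> = exp (- c * real m)" by (simp add: exp_of_nat_mult[symmetric] mult.commute)
  finally show ?thesis
    unfolding hmc_kernel_eq
    by (intro order_trans[OF P.wasserstein_iterate[OF assms]] mult_right_mono ennreal_leI) auto
qed

lemma wasserstein_ell1_iterate:
  assumes \<nu>: "\<nu> \<in> space (prob_algebra borel)" and \<eta>: "\<eta> \<in> space (prob_algebra borel)"
  shows "wasserstein ell1 (kernel_iterate \<nu> (hmc_kernel U T h) m) (kernel_iterate \<eta> (hmc_kernel U T h) m)
    \<le> ennreal (exp (R\<^sub>1 / T) * exp (- c * real m)) * wasserstein ell1 \<nu> \<eta>"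
proof -
  let ?W = "\<lambda>\<delta>. wasserstein \<delta> (kernel_iterate \<nu> (hmc_kernel U T h) m) (kernel_iterate \<eta> (hmc_kernel U T h) m)"
  have prob: "kernel_iterate \<nu> (hmc_kernel U T h) m \<in> space (prob_algebra borel)"
    "kernel_iterate \<eta> (hmc_kernel U T h) m \<in> space (prob_algebra borel)"
    unfolding hmc_kernel_eq by (intro P.kernel_iterate_prob \<nu> \<eta>)+
  then have sets: "sets (kernel_iterate \<nu> (hmc_kernel U T h) m \<Otimes>\<^sub>M kernel_iterate \<eta> (hmc_kernel U T h) m)
      = sets (borel \<Otimes>\<^sub>M (borel :: (real^'d^'n) measure))"
    by (intro sets_pair_measure_cong) (simp_all add: space_prob_algebra)
  have "?W ell1 \<le> ennreal (exp (R\<^sub>1 / T)) * ?W (rho R\<^sub>1 T)"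
  proof (rule wasserstein_le_cmult)
    fix x y :: "real^'d^'n"
    have "ell1 x y = exp (R\<^sub>1 / T) * (exp (- (R\<^sub>1 / T)) * ell1 x y)" by (simp add: exp_minus)
    also have "\<dots> \<le> exp (R\<^sub>1 / T) * rho R\<^sub>1 T x y" using ell1_le_rho by (intro mult_left_mono) auto
    finally show "ell1 x y \<le> exp (R\<^sub>1 / T) * rho R\<^sub>1 T x y" .
  qed (use P.\<rho>_measurable in \<open>simp_all add: measurable_cong_sets[OF sets refl]\<close>)
  also have "\<dots> \<le> ennreal (exp (R\<^sub>1 / T)) * (ennreal (exp (- c * real m)) * wasserstein (rho R\<^sub>1 T) \<nu> \<eta>)"
    by (intro mult_left_mono wasserstein_rho_iterate \<nu> \<eta>) simp
  also have "\<dots> \<le> ennreal (exp (R\<^sub>1 / T)) * (ennreal (exp (- c * real m)) * wasserstein ell1 \<nu> \<eta>)"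
    by (intro mult_left_mono wasserstein_mono rho_le_ell1) simp_all
  finally show ?thesis by (simp add: ennreal_mult mult.assoc)
qed

lemma ex1_invariant_prob: "\<exists>!\<mu>. invariant_prob (hmc_kernel U T h) \<mu>"
  unfolding hmc_kernel_eq using P.invariant_exists P.invariant_unique by blast

end

lemma kernel_iterate_invariant: "invariant_prob \<pi> \<mu> \<Longrightarrow> kernel_iterate \<mu> \<pi> m = \<mu>"
  by (induction m) (simp_all add: kernel_iterate_def invariant_prob_def)

text \<open>The threshold for \<open>m\<close> is obtained by taking logarithms. It is \<open>-\<infinity>\<close> for \<open>D\<^sub>0 = 0\<close> and \<open>\<infinity>\<close> for
  \<open>D\<^sub>0 = \<infinity>\<close>, and the claim is trivial in both cases.\<close>

lemma le_of_exponential_decay: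
  assumes c: "0 < c" and \<delta>: "0 < \<delta>" and decay: "D \<le> ennreal (exp a * exp (- c * real m)) * D\<^sub>0"
    and m: "ereal (1 / c) * (ereal a + ln_ext (D\<^sub>0 / ennreal \<delta>)) \<le> ereal (real m)"
  shows "D \<le> ennreal \<delta>"
proof (cases D\<^sub>0)
  case (real w)
  show ?thesis
  proof (cases "w = 0")
    case True
    then show ?thesis using decay real by simp
  next
    case False
    then have w: "0 < w" using real by simp
    have "D\<^sub>0 / ennreal \<delta> = ennreal (w / \<delta>)" using real \<delta> by (simp add: divide_ennreal)
    then have "ln_ext (D\<^sub>0 / ennreal \<delta>) = ereal (ln (w / \<delta>))" using w \<delta> by (simp add: ln_ext_def ennreal_eq_0_iff not_le)
    then have "1 / c * (a + ln (w / \<delta>)) \<le> real m" using m by simp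
    then have "a + ln (w / \<delta>) \<le> c * real m" using c by (simp add: field_simps)
    then have "exp (a + ln (w / \<delta>)) \<le> exp (c * real m)" by simp
    then have "exp a * (w / \<delta>) \<le> exp (c * real m)" using w \<delta> by (simp add: exp_add)
    then have "exp a * w \<le> exp (c * real m) * \<delta>" using \<delta> by (simp add: pos_divide_le_eq)
    then have "exp (- c * real m) * (exp a * w) \<le> exp (- c * real m) * (exp (c * real m) * \<delta>)" by (rule mult_left_mono) simp
    also have "\<dots> = \<delta>" by (simp add: mult.assoc[symmetric] exp_add[symmetric])
    finally have "exp a * exp (- c * real m) * w \<le> \<delta>" by (simp add: mult_ac)
    moreover have "D \<le> ennreal (exp a * exp (- c * real m) * w)"
      using decay real by (simp add: ennreal_mult)
    ultimately show ?thesis using ennreal_leI order_trans by blast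
  qed
next
  case top
  then have "ln_ext (D\<^sub>0 / ennreal \<delta>) = \<infinity>" by (simp add: ln_ext_def ennreal_top_divide)
  then show ?thesis using m c by simp
qed

theorem corollary7:
  fixes V W :: "real^'d \<Rightarrow> real"
    and U :: "real^'d^'n \<Rightarrow> real"
    and \<epsilon> K R L L' R' R\<^sub>1 T h\<^sub>1 c M :: real
  assumes V_C2: "twice_cont_differentiable V"
    and W_C2: "twice_cont_differentiable W"
    and eps_nonneg: "0 \<le> \<epsilon>"
    and U_eq: "U = mf_potential V W \<epsilon>"
    and U_int: "(\<integral>\<^sup>+ x. ennreal (exp (- U x)) \<partial>lborel) < \<infinity>"
    and V_min: "\<forall>x. V 0 \<le> V x" "V 0 = 0" "\<forall>x. 0 \<le> V x"
    and V_hess: "bdd_above (range (hess_norm V))"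
    and L_eq: "L = (SUP x. hess_norm V x)"
    and K_pos: "0 < K"
    and R_nonneg: "0 \<le> R"
    and V_convex: "\<forall>x y. R \<le> norm (x - y) \<longrightarrow>
           K * (norm (x - y))\<^sup>2 \<le> (x - y) \<bullet> (grad V x - grad V y)"
    and W_hess: "bdd_above (range (hess_norm W))"
    and L'_eq: "L' = (SUP x. hess_norm W x)"
    and R'_eq: "R' = 8 * R * sqrt ((L + K) / K)"
    and R1_eq: "R\<^sub>1 = 5 / 4 * (R' + 2 * T)"
    and T_pos: "0 < T"
    and h1_nonneg: "0 \<le> h\<^sub>1"
    \<comment> \<open>in \<^typ>\<open>ereal\<close>, so that the last term of the minimum is \<open>\<infinity>\<close> when \<open>R' = 0\<close>\<close>
    and T_bound: "ereal (L * (T + h\<^sub>1)\<^sup>2) \<le>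
           ereal (3 / 5) * min (ereal (1 / 4))
             (min (ereal (3 * K) / ereal (10 * L)) (ereal 3 / ereal (256 * 5 * L * R'\<^sup>2)))"
    and h1_bound: "h\<^sub>1 \<le> K * T / (525 * L + 235 * K)"
    and eps_bound: "\<epsilon> * L' <
           min (K / 6) (1 / 2 * (K * (R' + T) / (36 * 149))\<^sup>2 * exp (- (5 * (R' / T))))"
    and c_eq: "c = 1 / 156 * K * T\<^sup>2 * exp (- (5 * R' / (4 * T)))"
    and M_eq: "M = exp (5 / 4 * (R' / T + 2))"
  shows "\<forall>h\<in>{0..h\<^sub>1}. h = 0 \<or> T / h \<in> \<nat> \<longrightarrow>
    (\<forall>m. \<forall>\<nu>\<in>space (prob_algebra borel). \<forall>\<eta>\<in>space (prob_algebra borel).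
       wasserstein (rho R\<^sub>1 T) (kernel_iterate \<nu> (hmc_kernel U T h) m)
           (kernel_iterate \<eta> (hmc_kernel U T h) m)
         \<le> ennreal (exp (- c * real m)) * wasserstein (rho R\<^sub>1 T) \<nu> \<eta> \<and>
       wasserstein ell1 (kernel_iterate \<nu> (hmc_kernel U T h) m)
           (kernel_iterate \<eta> (hmc_kernel U T h) m)
         \<le> ennreal (M * exp (- c * real m)) * wasserstein ell1 \<nu> \<eta>) \<and>
    (\<exists>!\<mu>. invariant_prob (hmc_kernel U T h) \<mu>) \<and>
    (\<forall>\<mu>. invariant_prob (hmc_kernel U T h) \<mu> \<longrightarrow>
       (\<forall>\<nu>\<in>space (prob_algebra borel). \<forall>m.
          wasserstein ell1 (kernel_iterate \<nu> (hmc_kernel U T h) m) \<mu>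
            \<le> ennreal (M * exp (- c * real m)) * wasserstein ell1 \<nu> \<mu>) \<and>
       (\<forall>\<delta>>0. \<forall>\<nu>\<in>space (prob_algebra borel). \<forall>m.
          ereal (1 / c) * (ereal (5 / 2 + 5 * R' / (4 * T)) +
              ln_ext (wasserstein ell1 (kernel_iterate \<nu> (hmc_kernel U T h) 0) \<mu> / ennreal \<delta>))
            \<le> ereal (real m)
          \<longrightarrow> wasserstein ell1 (kernel_iterate \<nu> (hmc_kernel U T h) m) \<mu> \<le> ennreal \<delta>))"
proof (intro ballI impI)
  fix h assume h: "h \<in> {0..h\<^sub>1}" "h = 0 \<or> T / h \<in> \<nat>"
  have V_diff: "V differentiable (at y)" and W_diff: "W differentiable (at y)" for y
    using V_C2 W_C2 by (auto simp: twice_cont_differentiable_def)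
  have V_lip: "norm (grad V x - grad V y) \<le> L * norm (x - y)" for x y
    unfolding L_eq by (rule grad_lipschitz[OF V_C2 V_hess])
  have W_lip: "norm (grad W x - grad W y) \<le> L' * norm (x - y)" for x y
    unfolding L'_eq by (rule grad_lipschitz[OF W_C2 W_hess])
  have L': "0 \<le> L'" unfolding L'_eq by (rule hess_norm_Sup_nonneg[OF W_hess])
  have l: "0 \<le> \<epsilon> * L'" using eps_nonneg L' by simp
  note bounds = parameter_bounds[OF K_pos R_nonneg T_pos h1_nonneg l V_lip V_convex R'_eq T_bound eps_bound]
  have l_small: "\<epsilon> * L' \<le> K / 10 ^ 8"
  proof -
    have "K / 10 ^ 8 * exp (- (3 * (R' / T))) \<le> K / 10 ^ 8 * 1"
      using bounds(4) T_pos K_pos by (intro mult_left_mono) auto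
    then show ?thesis using bounds(6) by simp
  qed
  interpret hmc_contraction "force U" "grad V" L K "\<epsilon> * L'" R' T R\<^sub>1 c U h
  proof unfold_locales
    show "norm ((force U x $ i - force U y $ i) - (grad V (x $ i) - grad V (y $ i)))
        \<le> 2 * (\<epsilon> * L') * norm (x $ i - y $ i) + 2 * (\<epsilon> * L') / real CARD('n) * (\<Sum>j\<in>UNIV. norm (x $ j - y $ j))" for x y i
      unfolding U_eq by (rule mf_force_interaction[OF V_diff W_diff W_lip eps_nonneg L'])
  qed (use K_pos T_pos l l_small V_lip bounds h R1_eq c_eq in auto)
  have ln_M: "R\<^sub>1 / T = 5 / 2 + 5 * R' / (4 * T)" using T_pos unfolding R1_eq by (simp add: field_simps)
  then have M: "M = exp (R\<^sub>1 / T)" using T_pos by (simp add: M_eq ln_M)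
  let ?it = "\<lambda>\<nu> m. kernel_iterate \<nu> (hmc_kernel U T h) m"
  have to_invariant: "wasserstein ell1 (?it \<nu> m) \<mu> \<le> ennreal (M * exp (- c * real m)) * wasserstein ell1 \<nu> \<mu>"
    if \<mu>: "invariant_prob (hmc_kernel U T h) \<mu>" and \<nu>: "\<nu> \<in> space (prob_algebra borel)" for \<mu> \<nu> m
  proof -
    have "\<mu> \<in> space (prob_algebra borel)" using \<mu> by (simp add: invariant_prob_def)
    then show ?thesis
      using wasserstein_ell1_iterate[OF \<nu>, of \<mu> m] unfolding kernel_iterate_invariant[OF \<mu>] M by simp
  qed
  have close: "wasserstein ell1 (?it \<nu> m) \<mu> \<le> ennreal \<delta>"
    if "invariant_prob (hmc_kernel U T h) \<mu>" "\<nu> \<in> space (prob_algebra borel)" "0 < \<delta>"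
      and m: "ereal (1 / c) * (ereal (5 / 2 + 5 * R' / (4 * T)) + ln_ext (wasserstein ell1 (?it \<nu> 0) \<mu> / ennreal \<delta>)) \<le> ereal (real m)"
    for \<mu> \<nu> \<delta> m
  proof (rule le_of_exponential_decay[OF c_bounds(1) \<open>0 < \<delta>\<close> _ m])
    show "wasserstein ell1 (?it \<nu> m) \<mu>
        \<le> ennreal (exp (5 / 2 + 5 * R' / (4 * T)) * exp (- c * real m)) * wasserstein ell1 (?it \<nu> 0) \<mu>"
      using to_invariant[OF that(1,2), of m] by (simp add: M ln_M kernel_iterate_def)
  qed
  show "(\<forall>m. \<forall>\<nu>\<in>space (prob_algebra borel). \<forall>\<eta>\<in>space (prob_algebra borel).
       wasserstein (rho R\<^sub>1 T) (?it \<nu> m) (?it \<eta> m) \<le> ennreal (exp (- c * real m)) * wasserstein (rho R\<^sub>1 T) \<nu> \<eta> \<and>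
       wasserstein ell1 (?it \<nu> m) (?it \<eta> m) \<le> ennreal (M * exp (- c * real m)) * wasserstein ell1 \<nu> \<eta>) \<and>
    (\<exists>!\<mu>. invariant_prob (hmc_kernel U T h) \<mu>) \<and>
    (\<forall>\<mu>. invariant_prob (hmc_kernel U T h) \<mu> \<longrightarrow>
       (\<forall>\<nu>\<in>space (prob_algebra borel). \<forall>m.
          wasserstein ell1 (?it \<nu> m) \<mu> \<le> ennreal (M * exp (- c * real m)) * wasserstein ell1 \<nu> \<mu>) \<and>
       (\<forall>\<delta>>0. \<forall>\<nu>\<in>space (prob_algebra borel). \<forall>m.
          ereal (1 / c) * (ereal (5 / 2 + 5 * R' / (4 * T)) + ln_ext (wasserstein ell1 (?it \<nu> 0) \<mu> / ennreal \<delta>)) \<le> ereal (real m)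
          \<longrightarrow> wasserstein ell1 (?it \<nu> m) \<mu> \<le> ennreal \<delta>))"
    using wasserstein_rho_iterate wasserstein_ell1_iterate[folded M] ex1_invariant_prob to_invariant close by blast
qed

end
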